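(* Let $\phi\in H^{s}(\mathbb{R}^{d})$ be a nonnegative refinable function with $\nu_{2}(\phi)>\varsigma>s>d/2$ and $\operatorname{supp}(\phi)\subseteq[0,M_{1}]\times\cdots\times[0,M_{d}]$, whose mask symbol has $\kappa+1$ sum rules with $\kappa+1>\varsigma$. Let $\Omega\subseteq\mathbb{R}^{d}$ be a bounded region of interest such that $\mathbf 0\notin\Lambda_{\Omega,N}$ for every $N\ge1$, and let $\Xi_{\Omega,N}=\{(\mathbf k,\mathbf k',\mathbf k''):\mathbf k\in\Lambda_{\Omega,N},\ \mathbf k'=(1+2^{-N})\mathbf k,\ \mathbf k''=(1-2^{-N})\mathbf k\}$. Let $\{g_N\}_{N=1}^\infty$ be a sequence of uniformly $\gamma$-admissible spherical reference waves on $\{\Xi_{\Omega,N}\}_{N=1}^\infty$. Then there exist constants $C(s,\varsigma),\widehat C_1(s,\varsigma,\Omega)>0$ such that for any $f\in H^{s}(\mathbb{R}^{d})$ satisfying $\nu_2(f)>\varsigma>s$ and any level $N\ge1$, $$\Big\|f|_{\Omega}-\Big(\sum_{\mathbf k\in\Lambda_{\Omega,N}}\mathring f(2^{-N}\mathbf k)\phi(2^N\cdot-\mathbf k)\Big)\Big|_{\Omega}\Big\|_{L^2(\mathbb R^d)}\le C(s,\varsigma)\|f\|_{H^{\varsigma}(\mathbb{R}^{d})}2^{-N(\varsigma-s)/2}+\gamma\widehat C_1(s,\varsigma,\Omega)\|f\|_{H^{\varsigma}(\mathbb{R}^{d})}\big(\|f\|_{H^{\varsigma}(\mathbb{R}^{d})}+\sup_{k\ge1}\sup_{\mathbf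 x\in\Omega}|g_k(\mathbf x)|\big)2^{-N\zeta},$$ where $\zeta=\min\{1,\varsigma-s\}$ and $\mathring f(2^{-N}\mathbf k)$ is the value reconstructed from the single-shot intensities.
   Context: **Sobolev spaces.** $\widehat f(\xi)=\int_{\mathbb R^d}f(\mathbf x)e^{-\mathbf i\mathbf x\cdot\xi}d\mathbf x$; $H^{s}(\mathbb R^d)$ is the space of $f:\mathbb R^d\to\mathbb C$ with $\int|\widehat f(\xi)|^2(1+\|\xi\|_2^2)^sd\xi<\infty$, with norm $\|f\|_{H^s(\mathbb R^d)}=(2\pi)^{-d/2}(\int|\widehat f(\xi)|^2(1+\|\xi\|_2^2)^sd\xi)^{1/2}$; $\nu_2(f)=\sup\{s\in\mathbb R:f\in H^s(\mathbb R^d)\}$. For $s>d/2$ functions in $H^s(\mathbb R^d)$ are identified with their continuous representatives. $f|_\Omega$ is the restriction of $f$ to $\Omega$ (its $L^2$ norm is computed over $\Omega$). **Refinable functions.** $\phi$ is refinable if $\widehat\phi(2\xi)=\widehat a(\xi)\widehat\phi(\xi)$ for a $2\pi\mathbb Z^d$-periodic function $\widehat a$ (the mask symbol), normalized by $\widehat\phi(\mathbf 0)=1$. The mask symbol has $\kappa+1$ sum rules if $\widehat a(\xi+2\pi\gamma')=O(\|\xi\|_2^{\kappa+1})$ as $\xi\to\mathbf 0$ for every representative $\gamma'$ of a nonzero coset of $[2^{-1}\mathbb Z^d]/\mathbb Z^d$. **Index sets.** $\Omega$ is bounded and $\mathbb Z_\Omega^d:=\Omega\cap\mathbb Z^d\ne\emptyset$.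 $L_{l,\min}=\min\{k_l:(k_1,\dots,k_d)\in\mathbb Z^d_\Omega\}$, $L_{l,\max}=\max\{k_l:(k_1,\dots,k_d)\in\mathbb Z^d_\Omega\}$, and $\Lambda_{\Omega,N}=\{(k_1,\dots,k_d)\in\mathbb Z^d:2^NL_{l,\min}-M_l\le k_l\le2^NL_{l,\max},\ l=1,\dots,d\}$, with $M_l>0$. **Spherical waves and admissibility.** A spherical wave is $g(\mathbf x)=\frac{b}{\|\mathbf x\|_2}e^{\mathbf i\nu\|\mathbf x\|_2}$ on $\mathbb R^d\setminus\{\mathbf 0\}$ with $b>0$, $\nu\in\mathbb R\setminus\{0\}$. $g_N$ is $\gamma$-admissible ($0<\gamma<\infty$) on $\Xi_{\Omega,N}$ w.r.t. level $N$ if (i) for all $(\mathbf k,\mathbf k',\mathbf k'')\in\Xi_{\Omega,N}$, $g_N(2^{-N}\mathbf k)\ne g_N(2^{-N}\mathbf k')$ and $g_N(2^{-N}\mathbf k)\ne g_N(2^{-N}\mathbf k'')$; and (ii) $$\max_{(\mathbf k,\mathbf k',\mathbf k'')\in\Xi_{\Omega,N}}\frac{\max\{|g_N(2^{-N}\mathbf k)-g_N(2^{-N}\mathbf k')|,\ |\overline{g_N}(2^{-N}\mathbf k)-\overline{g_N}(2^{-N}\mathbf k'')|\}}{|\Im[(g_N(2^{-N}\mathbf k)-g_N(2^{-N}\mathbf k'))(\overline{g_N}(2^{-N}\mathbf k)-\overline{g_N}(2^{-N}\mathbf k''))]|}\le\gamma$$ (the quotient being $+\infty$ if its denominator is $0$).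 $\{g_N\}_{N\ge1}$ is uniformly $\gamma$-admissible on $\{\Xi_{\Omega,N}\}_{N\ge1}$ if every $g_N$ is $\gamma$-admissible on $\Xi_{\Omega,N}$ w.r.t. level $N$ and $\sup_{N\ge1}\sup_{(\mathbf k,\mathbf k',\mathbf k'')\in\Xi_{\Omega,N}}\{|g_N(2^{-N}\mathbf k)|,|g_N(2^{-N}\mathbf k')|,|g_N(2^{-N}\mathbf k'')|\}<\infty$. **Reconstructed samples.** For $\mathbf k\in\Lambda_{\Omega,N}$ with triple $(\mathbf k,\mathbf k',\mathbf k'')\in\Xi_{\Omega,N}$, put $I_{N,\mathbf m}=|f(2^{-N}\mathbf m)+g_N(2^{-N}\mathbf m)|^2$ for $\mathbf m\in\{\mathbf k,\mathbf k',\mathbf k''\}$, $c+\mathbf i\,\delta=g_N(2^{-N}\mathbf k)-g_N(2^{-N}\mathbf k')$, $h+\mathbf i\,e=g_N(2^{-N}\mathbf k)-g_N(2^{-N}\mathbf k'')$ with $c,\delta,h,e$ real, and $\mu=-\Im[(g_N(2^{-N}\mathbf k)-g_N(2^{-N}\mathbf k'))(\overline{g_N}(2^{-N}\mathbf k)-\overline{g_N}(2^{-N}\mathbf k''))]$ (nonzero by admissibility). Then $\mathring f(2^{-N}\mathbf k)=u+\mathbf i v$ where $$\begin{bmatrix} u \\ v \end{bmatrix}=\frac{1}{2\mu}\begin{bmatrix} e & -\delta \\ -h & c \end{bmatrix}\begin{bmatrix} I_{N,\mathbf k}-I_{N,\mathbf k'}+|g_N(2^{-N}\mathbf k')|^2-|g_N(2^{-N}\mathbf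 k)|^2 \\ I_{N,\mathbf k}-I_{N,\mathbf k''}+|g_N(2^{-N}\mathbf k'')|^2-|g_N(2^{-N}\mathbf k)|^2 \end{bmatrix}.$$
   Formalization: Adds that Ω is measurable and, up to a null set, lies in the box ∏[L_{l,min}, L_{l,max}] spanned by its lattice points; otherwise the bound fails for f supported in Ω outside that box, where the sum vanishes for large N. *)

theory Defs
  imports "HOL-Analysis.Analysis" "HOL-Library.Landau_Symbols"
begin

definition fourier :: "(real^'d \<Rightarrow> complex) \<Rightarrow> real^'d \<Rightarrow> complex" where
  "fourier f \<xi> = (LINT x|lebesgue. f x * exp (- (\<i> * complex_of_real (x \<bullet> \<xi>))))"

definition square_integrable :: "(real^'d \<Rightarrow> complex) \<Rightarrow> bool" where
  "square_integrable f \<longleftrightarrow>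
     f \<in> borel_measurable lebesgue \<and> integrable lebesgue (\<lambda>x. (cmod (f x))\<^sup>2)"

text \<open>A function in \<open>L\<^sup>2\<close> need not be integrable, so its Fourier transform is Plancherel's: the
  \<open>L\<^sup>2\<close>-limit, as the radius grows, of the Fourier integrals over balls. It is determined up to
  null sets, and agrees almost everywhere with \<open>fourier f\<close> when \<open>f\<close> is also integrable.\<close>

definition has_fourier_L2 :: "(real^'d \<Rightarrow> complex) \<Rightarrow> (real^'d \<Rightarrow> complex) \<Rightarrow> bool" where
  "has_fourier_L2 f F \<longleftrightarrow> square_integrable f \<and> square_integrable F \<and>
     ((\<lambda>R::real. \<integral>\<^sup>+ \<xi>. ennreal ((cmod (fourier (\<lambda>x. if norm x < R then f x else 0) \<xi> - F \<xi>))\<^sup>2)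
          \<partial>lebesgue) \<longlongrightarrow> 0) at_top"

definition fourier_L2 :: "(real^'d \<Rightarrow> complex) \<Rightarrow> real^'d \<Rightarrow> complex" where
  "fourier_L2 f = (SOME F. has_fourier_L2 f F)"

text \<open>For \<open>s \<ge> 0\<close> this is the full space \<open>H\<^sup>s\<close>, which consists of \<open>L\<^sup>2\<close> functions. For \<open>s < 0\<close> it is
  only the \<open>L\<^sup>2\<close> part of \<open>H\<^sup>s\<close>; this does not affect the critical exponent \<open>nu2 f\<close> of a function
  \<open>f\<close> in \<open>L\<^sup>2\<close>.\<close>

definition sobolev :: "real \<Rightarrow> (real^'d \<Rightarrow> complex) set" where
  "sobolev s = {f. \<exists>F. has_fourier_L2 f F \<and>
      integrable lebesgue (\<lambda>\<xi>. (cmod (F \<xi>))\<^sup>2 * (1 + (norm \<xi>)\<^sup>2) powr s)}"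

definition sobolev_norm :: "real \<Rightarrow> (real^'d \<Rightarrow> complex) \<Rightarrow> real" where
  "sobolev_norm s f = (2 * pi) powr (- (real CARD('d) / 2)) *
      sqrt (LINT \<xi>|lebesgue. (cmod (fourier_L2 f \<xi>))\<^sup>2 * (1 + (norm \<xi>)\<^sup>2) powr s)"

definition nu2 :: "(real^'d \<Rightarrow> complex) \<Rightarrow> ereal" where
  "nu2 f = (SUP s\<in>{s. f \<in> sobolev s}. ereal s)"

text \<open>The norm of \<open>h\<close> restricted to \<open>\<Omega>\<close> in \<open>L\<^sup>2\<close>, infinite if the restriction is not in \<open>L\<^sup>2\<close>.\<close>

definition L2_norm_on :: "(real^'d) set \<Rightarrow> (real^'d \<Rightarrow> complex) \<Rightarrow> ennreal" where
  "L2_norm_on \<Omega> h =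
     (if set_borel_measurable lebesgue \<Omega> h \<and> set_integrable lebesgue \<Omega> (\<lambda>x. (cmod (h x))\<^sup>2)
      then ennreal (sqrt (LINT x:\<Omega>|lebesgue. (cmod (h x))\<^sup>2)) else \<infinity>)"

definition int_lattice :: "(real^'d) set" where
  "int_lattice = {k. \<forall>l. k $ l \<in> \<int>}"

definition refinable :: "(real^'d \<Rightarrow> complex) \<Rightarrow> (real^'d \<Rightarrow> complex) \<Rightarrow> bool" where
  "refinable \<phi> a \<longleftrightarrow>
     (\<forall>\<xi>. \<forall>k\<in>int_lattice. a (\<xi> + (2 * pi) *\<^sub>R k) = a \<xi>) \<and>
     (\<forall>\<xi>. fourier \<phi> (2 *\<^sub>R \<xi>) = a \<xi> * fourier \<phi> \<xi>) \<and>
     fourier \<phi> 0 = 1"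

definition has_sum_rules :: "(real^'d \<Rightarrow> complex) \<Rightarrow> nat \<Rightarrow> bool" where
  "has_sum_rules a n \<longleftrightarrow>
     (\<forall>\<gamma>'. 2 *\<^sub>R \<gamma>' \<in> int_lattice \<and> \<gamma>' \<notin> int_lattice \<longrightarrow>
        (\<lambda>\<xi>. a (\<xi> + (2 * pi) *\<^sub>R \<gamma>')) \<in> O[at 0](\<lambda>\<xi>. complex_of_real (norm \<xi> ^ n)))"

definition Lmin :: "(real^'d) set \<Rightarrow> real^'d" where
  "Lmin \<Omega> = (\<chi> l. Min ((\<lambda>k. k $ l) ` (\<Omega> \<inter> int_lattice)))"

definition Lmax :: "(real^'d) set \<Rightarrow> real^'d" where
  "Lmax \<Omega> = (\<chi> l. Max ((\<lambda>k. k $ l) ` (\<Omega> \<inter> int_lattice)))"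

text \<open>If \<open>\<phi>\<close> is supported in \<open>cbox 0 M\<close>, the shifts \<open>\<phi> (2 ^ N *\<^sub>R x - k)\<close> with \<open>k\<close> outside
  \<open>Lambda M \<Omega> N\<close> vanish for \<open>x\<close> in \<open>cbox (Lmin \<Omega>) (Lmax \<Omega>)\<close>, the box spanned by the lattice points
  of \<open>\<Omega>\<close>, but in general not for all \<open>x\<close> in \<open>\<Omega>\<close>.\<close>

definition Lambda :: "real^'d \<Rightarrow> (real^'d) set \<Rightarrow> nat \<Rightarrow> (real^'d) set" where
  "Lambda M \<Omega> N = {k \<in> int_lattice.
     \<forall>l. 2 ^ N * Lmin \<Omega> $ l - M $ l \<le> k $ l \<and> k $ l \<le> 2 ^ N * Lmax \<Omega> $ l}"

text \<open>The second and third entries of a triple need not be lattice points.\<close>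

definition Xi :: "real^'d \<Rightarrow> (real^'d) set \<Rightarrow> nat \<Rightarrow> ((real^'d) \<times> (real^'d) \<times> (real^'d)) set" where
  "Xi M \<Omega> N = {(k, k', k'') | k k' k''.
     k \<in> Lambda M \<Omega> N \<and> k' = (1 + 1 / 2 ^ N) *\<^sub>R k \<and> k'' = (1 - 1 / 2 ^ N) *\<^sub>R k}"

definition spherical_wave :: "(real^'d \<Rightarrow> complex) \<Rightarrow> bool" where
  "spherical_wave g \<longleftrightarrow> (\<exists>b \<nu> :: real. b > 0 \<and> \<nu> \<noteq> 0 \<and>
     (\<forall>x. x \<noteq> 0 \<longrightarrow>
        g x = complex_of_real (b / norm x) * exp (\<i> * complex_of_real (\<nu> * norm x))))"

abbreviation at_level :: "(real^'d \<Rightarrow> complex) \<Rightarrow> nat \<Rightarrow> real^'d \<Rightarrow> complex" where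
  "at_level g N k \<equiv> g ((1 / 2 ^ N) *\<^sub>R k)"

definition cross_term ::
  "(real^'d \<Rightarrow> complex) \<Rightarrow> nat \<Rightarrow> real^'d \<Rightarrow> real^'d \<Rightarrow> real^'d \<Rightarrow> real" where
  "cross_term g N k k' k'' =
     Im ((at_level g N k - at_level g N k') * (cnj (at_level g N k) - cnj (at_level g N k'')))"

definition admissibility_quotient ::
  "(real^'d \<Rightarrow> complex) \<Rightarrow> nat \<Rightarrow> real^'d \<Rightarrow> real^'d \<Rightarrow> real^'d \<Rightarrow> ereal" where
  "admissibility_quotient g N k k' k'' =
     (if cross_term g N k k' k'' = 0 then \<infinity>
      else ereal (max (cmod (at_level g N k - at_level g N k'))
                      (cmod (cnj (at_level g N k) - cnj (at_level g N k'')))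
                  / \<bar>cross_term g N k k' k''\<bar>))"

definition admissible ::
  "real \<Rightarrow> (real^'d \<Rightarrow> complex) \<Rightarrow> ((real^'d) \<times> (real^'d) \<times> (real^'d)) set \<Rightarrow> nat \<Rightarrow> bool" where
  "admissible \<gamma> g \<Xi> N \<longleftrightarrow>
     (\<forall>(k, k', k'')\<in>\<Xi>. at_level g N k \<noteq> at_level g N k' \<and> at_level g N k \<noteq> at_level g N k'') \<and>
     (SUP (k, k', k'')\<in>\<Xi>. admissibility_quotient g N k k' k'') \<le> ereal \<gamma>"

definition uniformly_admissible ::
  "real \<Rightarrow> (nat \<Rightarrow> real^'d \<Rightarrow> complex) \<Rightarrow> (nat \<Rightarrow> ((real^'d) \<times> (real^'d) \<times> (real^'d)) set) \<Rightarrow> bool" where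
  "uniformly_admissible \<gamma> g \<Xi> \<longleftrightarrow>
     (\<forall>N\<ge>1. admissible \<gamma> (g N) (\<Xi> N) N) \<and>
     (SUP N\<in>{1..}. SUP (k, k', k'')\<in>\<Xi> N.
        ennreal (Max {cmod (at_level (g N) N k), cmod (at_level (g N) N k'),
                      cmod (at_level (g N) N k'')})) < \<infinity>"

definition intensity ::
  "(real^'d \<Rightarrow> complex) \<Rightarrow> (real^'d \<Rightarrow> complex) \<Rightarrow> nat \<Rightarrow> real^'d \<Rightarrow> real" where
  "intensity f g N m = (cmod (at_level f N m + at_level g N m))\<^sup>2"

definition reconstruct_triple ::
  "(real^'d \<Rightarrow> complex) \<Rightarrow> (real^'d \<Rightarrow> complex) \<Rightarrow> nat \<Rightarrow>
     real^'d \<Rightarrow> real^'d \<Rightarrow> real^'d \<Rightarrow> complex" where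
  "reconstruct_triple f g N k k' k'' =
     (let c = Re (at_level g N k - at_level g N k');
          \<delta> = Im (at_level g N k - at_level g N k');
          h = Re (at_level g N k - at_level g N k'');
          e = Im (at_level g N k - at_level g N k'');
          \<mu> = - cross_term g N k k' k'';
          r = intensity f g N k - intensity f g N k'
              + (cmod (at_level g N k'))\<^sup>2 - (cmod (at_level g N k))\<^sup>2;
          r' = intensity f g N k - intensity f g N k''
              + (cmod (at_level g N k''))\<^sup>2 - (cmod (at_level g N k))\<^sup>2
      in Complex ((e * r - \<delta> * r') / (2 * \<mu>)) ((- h * r + c * r') / (2 * \<mu>)))"

definition reconstructed_sample ::
  "(real^'d \<Rightarrow> complex) \<Rightarrow> (real^'d \<Rightarrow> complex) \<Rightarrow> nat \<Rightarrow> real^'d \<Rightarrow> complex" where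
  "reconstructed_sample f g N k =
     reconstruct_triple f g N k ((1 + 1 / 2 ^ N) *\<^sub>R k) ((1 - 1 / 2 ^ N) *\<^sub>R k)"

end

theory Submission
  imports Defs "HOL-Probability.Characteristic_Functions" "HOL-Real_Asymp.Real_Asymp"
begin

text \<open>The partial sums \<open>\<Sum>\<^sub>k f (2\<^sup>-\<^sup>N k) \<phi> (2\<^sup>N x - k)\<close> are compared with \<open>f\<close> pointwise.
  The sum rules make \<open>fourier \<phi>\<close> vanish on \<open>2 \<pi> \<int>\<^sup>d\<close> away from the origin, so the shifts of \<open>\<phi>\<close>
  form a nonnegative partition of unity; and \<open>H\<^sup>\<sigma>\<close> embeds into the Hoelder functions of exponent
  \<open>\<zeta> = min 1 (\<sigma> - s)\<close>. Hence the error with exact samples, and likewise the error of the reconstructed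
  samples, is of order \<open>2 powr (- N \<zeta>)\<close> uniformly on the bounded set \<open>\<Omega>\<close>.

  The quotient in the admissibility condition is at least \<open>1 / \<bar>g\<^sub>N (x) - g\<^sub>N ((1 + 2\<^sup>-\<^sup>N) x)\<bar>\<close>, so
  \<open>\<gamma> \<bar>g\<^sub>N (x)\<bar> \<ge> 1/2\<close> at every lattice point \<open>x\<close> of \<open>\<Omega>\<close>. This lets the second term of
  the bound absorb the approximation error as well; the first term is never needed, and
  \<open>C = 1\<close> works.\<close>

section \<open>Gaussian and weight integrals\<close>

text \<open>A square integrable f has its transform only as an L2 limit, with no pointwise inversion
  formula. Point values are therefore reached through Gaussian averages, and Cauchy-Schwarz against
  (1 + |\<xi>|^2) powr (- s), integrable because s > d/2, gives the Hoelder bound. The surplus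
  \<sigma> - s pays for the exponent; the cap at 1 reflects that exponentials are only Lipschitz.

  Were f constant on a triple, |f|^2 would drop out of the intensity differences and the two-by-two
  system would return f exactly. The reconstruction error is thus the oscillation of f over the
  triple, amplified by \<gamma> and the sizes of f and g. As k' and k'' dilate k by 1 + 2^-N and 1 -
  2^-N and 2^-N k stays in a fixed ball, this oscillation is of order 2 powr (- N \<zeta>).

  The sampling points may leave \<Omega>, where the supremum in the bound says nothing about g. A
  spherical wave has modulus b / |x|, so its moduli at any two points compare by geometry alone; all
  are measured against the one at a fixed lattice point \<open>x0\<close> of \<Omega>. This keeps
  \<open>C\<^sub>1\<close> independent of the waves.\<close>

lemma borel_measurable_vec_nth:
  "(\<lambda>x::real^'d. x $ l) \<in> borel_measurable borel"
  by (intro borel_measurable_continuous_onI continuous_intros)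

text \<open>Fubini for functions that split over the coordinates. \<open>lborel_eq\<close> presents
  the measure as the image of a product indexed by \<open>Basis\<close> rather than by the index
  type, so \<open>j\<close> recovers a coordinate from its basis vector.\<close>

lemma
  fixes h :: "'d::finite \<Rightarrow> real \<Rightarrow> complex"
  assumes h: "\<And>l. integrable lborel (h l)"
  shows integrable_prod_components: "integrable lborel (\<lambda>x::real^'d. \<Prod>l\<in>UNIV. h l (x $ l))"
    and integral_prod_components:
      "(LINT x|(lborel :: (real^'d) measure). (\<Prod>l\<in>UNIV. h l (x $ l))) = (\<Prod>l\<in>UNIV. (LINT t|lborel. h l t))"
proof -
  interpret product_sigma_finite "\<lambda>b::real^'d. lborel :: real measure" ..
  define j where "j b = (THE l. b = axis l (1::real))" for b :: "real^'d"
  have j: "j (axis l 1) = l" for l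
    by (auto simp: j_def axis_eq_axis)
  have Bas: "Basis = (\<lambda>l. axis l (1::real)) ` (UNIV :: 'd set)"
    by (auto simp: Basis_vec_def)
  have inj: "inj_on (\<lambda>l. axis l (1::real)) (UNIV :: 'd set)"
    by (auto simp: inj_on_def axis_eq_axis)
  let ?T = "\<lambda>f. \<Sum>b\<in>(Basis::(real^'d) set). f b *\<^sub>R b"
  let ?P = "\<lambda>x::real^'d. \<Prod>l\<in>UNIV. h l (x $ l)"
  have T: "?T \<in> measurable (\<Pi>\<^sub>M b\<in>(Basis::(real^'d) set). lborel) borel"
    by measurable
  have [measurable]: "h l \<in> borel_measurable borel" for l
    using borel_measurable_integrable[OF h[of l]] by simp
  have P: "?P \<in> borel_measurable borel"
    by (intro borel_measurable_prod measurable_compose[OF borel_measurable_vec_nth]) auto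
  have comp: "?T f $ l = f (axis l 1)" for f l
  proof -
    have "?T f \<bullet> axis l 1 = f (axis l 1)"
      by (intro inner_sum_left_Basis) (simp add: Bas)
    then show ?thesis by (simp add: inner_axis)
  qed
  have eq: "?P (?T f) = (\<Prod>b\<in>Basis. h (j b) (f b))" for f
    unfolding comp unfolding Bas by (subst prod.reindex[OF inj]) (simp add: j)
  have i: "integrable lborel (h (j b))" for b by (rule h)
  have I: "integrable (\<Pi>\<^sub>M b\<in>(Basis::(real^'d) set). lborel) (\<lambda>f. ?P (?T f))"
    unfolding eq by (rule product_integrable_prod) (auto intro: i)
  show "integrable lborel ?P"
    unfolding lborel_eq[where ?'a = "real^'d"]
    by (subst integrable_distr_eq[OF T P]) (rule I)
  have "(LINT x|lborel. ?P x) = (LINT f|(\<Pi>\<^sub>M b\<in>(Basis::(real^'d) set). lborel). ?P (?T f))"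
    by (subst lborel_eq) (rule integral_distr[OF T P])
  also have "\<dots> = (\<Prod>b\<in>(Basis::(real^'d) set). (LINT t|lborel. h (j b) t))"
    unfolding eq by (rule product_integral_prod) (auto intro: i)
  also have "\<dots> = (\<Prod>l\<in>UNIV. (LINT t|lborel. h l t))"
    unfolding Bas by (subst prod.reindex[OF inj]) (simp add: j)
  finally show "(LINT x|lborel. ?P x) = (\<Prod>l\<in>UNIV. (LINT t|lborel. h l t))" .
qed

lemma lborel_integral_affine:
  fixes f :: "'a::euclidean_space \<Rightarrow> 'b::{banach, second_countable_topology}"
  assumes [measurable]: "f \<in> borel_measurable borel" and c: "c \<noteq> 0"
  shows "(LINT x|lborel. f x) = \<bar>c\<bar> ^ DIM('a) *\<^sub>R (LINT u|lborel. f (t + c *\<^sub>R u))"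
    (is "?l = ?r")
proof -
  have "?l = (LINT x|density (distr lborel borel (\<lambda>x. t + c *\<^sub>R x)) (\<lambda>_. ennreal (\<bar>c\<bar>^DIM('a))). f x)"
    by (subst lborel_affine[OF c, of t]) (simp add: ennreal_power)
  also have "\<dots> = (LINT x|distr lborel borel (\<lambda>x. t + c *\<^sub>R x). \<bar>c\<bar>^DIM('a) *\<^sub>R f x)"
    by (rule integral_density) auto
  also have "\<dots> = (LINT u|lborel. \<bar>c\<bar>^DIM('a) *\<^sub>R f (t + c *\<^sub>R u))"
    by (rule integral_distr) auto
  finally show ?thesis by simp
qed

lemma lborel_integrable_affine:
  fixes f :: "'a::euclidean_space \<Rightarrow> 'b::{banach, second_countable_topology}"
  assumes f: "integrable lborel f" and c: "c \<noteq> 0"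
  shows "integrable lborel (\<lambda>u. f (t + c *\<^sub>R u))"
proof -
  have [measurable]: "f \<in> borel_measurable borel" using f by auto
  have "integrable (density (distr lborel borel (\<lambda>x. t + c *\<^sub>R x)) (\<lambda>_. ennreal (\<bar>c\<bar>^DIM('a)))) f"
    using f by (subst (asm) lborel_affine[OF c, of t]) (simp add: ennreal_power)
  then have "integrable lborel (\<lambda>x. \<bar>c\<bar> ^ DIM('a) *\<^sub>R f (t + c *\<^sub>R x))"
    by (simp add: integrable_density integrable_distr_eq)
  from integrable_scaleR_right[OF this, of "1 / \<bar>c\<bar> ^ DIM('a)"] show ?thesis
    using c by simp
qed

text \<open>The standard normal density without its normalising factor. It is an eigenfunction of
  the Fourier transform with eigenvalue (2 \<pi>)^(d/2), the origin of the powers of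
  \<open>sqrt (2 * pi)\<close> below.\<close>

definition gauss :: "real^'d \<Rightarrow> real" where
  "gauss x = exp (- (norm x)\<^sup>2 / 2)"

lemma gauss_pos: "0 < gauss x" and gauss_le_1: "gauss x \<le> 1"
  by (simp_all add: gauss_def)

lemma gauss_measurable [measurable]: "gauss \<in> borel_measurable borel"
  unfolding gauss_def by (intro borel_measurable_continuous_onI continuous_intros) auto

lemma norm_vec_sq: "(norm x)\<^sup>2 = (\<Sum>l\<in>UNIV. (x $ l)\<^sup>2)" for x :: "real^'d"
  by (simp add: norm_vec_def L2_set_def sum_nonneg)

lemma gauss_prod: "gauss x = (\<Prod>l\<in>UNIV. exp (- (x $ l)\<^sup>2 / 2))"
  by (simp add: gauss_def norm_vec_sq sum_negf sum_divide_distrib flip: exp_sum)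

text \<open>The characteristic function of the standard normal law, freed from the factor of the
  density.\<close>

lemma integral_gauss_1d:
  "integrable lborel (\<lambda>x. complex_of_real (exp (- x\<^sup>2 / 2)) * exp (\<i> * complex_of_real (t * x)))"
  "(LINT x|lborel. complex_of_real (exp (- x\<^sup>2 / 2)) * exp (\<i> * complex_of_real (t * x)))
    = complex_of_real (sqrt (2 * pi) * exp (- t\<^sup>2 / 2))"
proof -
  have e: "complex_of_real (exp (- x\<^sup>2 / 2)) = complex_of_real (sqrt (2 * pi)) * std_normal_density x"
    for x by (simp add: std_normal_density_def)
  have "integrable lborel std_normal_density" by simp
  then have "integrable lborel (\<lambda>x. complex_of_real (std_normal_density x))"
    by (rule integrable_of_real)
  then have 1: "integrable lborel (\<lambda>x. complex_of_real (std_normal_density x) * exp (\<i> * complex_of_real (t * x)))"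
    by (rule Bochner_Integration.integrable_bound) (auto simp: norm_mult)
  then show "integrable lborel (\<lambda>x. complex_of_real (exp (- x\<^sup>2 / 2)) * exp (\<i> * complex_of_real (t * x)))"
    unfolding e mult.assoc by (rule integrable_mult_right)
  have "char std_normal_distribution t = (LINT x|lborel. std_normal_density x *\<^sub>R iexp (t * x))"
    unfolding char_def by (rule integral_density) auto
  with char_std_normal_distribution
  have "(LINT x|lborel. complex_of_real (std_normal_density x) * exp (\<i> * complex_of_real (t * x)))
    = complex_of_real (exp (- t\<^sup>2 / 2))"
    by (simp add: scaleR_conv_of_real fun_eq_iff)
  then have "(LINT x|lborel. complex_of_real (sqrt (2 * pi)) *
      (complex_of_real (std_normal_density x) * exp (\<i> * complex_of_real (t * x))))
    = complex_of_real (sqrt (2 * pi) * exp (- t\<^sup>2 / 2))"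
    by (subst integral_mult_right_zero) simp
  then show "(LINT x|lborel. complex_of_real (exp (- x\<^sup>2 / 2)) * exp (\<i> * complex_of_real (t * x)))
    = complex_of_real (sqrt (2 * pi) * exp (- t\<^sup>2 / 2))"
    by (simp only: e mult.assoc)
qed

lemma
  fixes t :: "real^'d"
  shows integrable_gauss_exp:
      "integrable lborel (\<lambda>x::real^'d. complex_of_real (gauss x) * exp (\<i> * complex_of_real (t \<bullet> x)))"
    and integral_gauss_exp:
      "(LINT x|(lborel :: (real^'d) measure). complex_of_real (gauss x) * exp (\<i> * complex_of_real (t \<bullet> x)))
        = complex_of_real (sqrt (2 * pi) ^ CARD('d) * gauss t)"
proof -
  have *: "complex_of_real (gauss x) * exp (\<i> * complex_of_real (t \<bullet> x)) =
      (\<Prod>l\<in>UNIV. complex_of_real (exp (- (x $ l)\<^sup>2 / 2)) * exp (\<i> * complex_of_real (t $ l * x $ l)))"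
    for x :: "real^'d"
    unfolding gauss_prod inner_vec_def by (simp add: prod.distrib sum_distrib_left exp_sum)
  show "integrable lborel (\<lambda>x::real^'d. complex_of_real (gauss x) * exp (\<i> * complex_of_real (t \<bullet> x)))"
    unfolding * by (rule integrable_prod_components) (rule integral_gauss_1d)
  show "(LINT x|(lborel :: (real^'d) measure). complex_of_real (gauss x) * exp (\<i> * complex_of_real (t \<bullet> x)))
        = complex_of_real (sqrt (2 * pi) ^ CARD('d) * gauss t)"
    unfolding * by (subst integral_prod_components[OF integral_gauss_1d(1)])
      (unfold integral_gauss_1d(2), simp add: gauss_prod prod.distrib)
qed

lemma integrable_gauss: "integrable lborel (gauss :: real^'d \<Rightarrow> real)"
  using integrable_Re[OF integrable_gauss_exp[of "0::real^'d"]] by simp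

lemma integral_gauss: "(LINT x|(lborel :: (real^'d) measure). gauss x) = sqrt (2 * pi) ^ CARD('d)"
proof -
  have "complex_of_real (LINT x|(lborel :: (real^'d) measure). gauss x) = complex_of_real (sqrt (2 * pi) ^ CARD('d))"
    using integral_gauss_exp[of "0::real^'d"] by (simp add: gauss_def)
  then show ?thesis using of_real_eq_iff by blast
qed

section \<open>Integrability of the Sobolev weight\<close>

text \<open>The majorant consists of the two tails |t| powr (- 2 p), integrable since 2 p > 1, and
  the indicator of the interval between them.\<close>

lemma integrable_japanese_bracket_1d:
  assumes "p > 1/2"
  shows "integrable lborel (\<lambda>t::real. (1 + t\<^sup>2) powr (- p))"
proof -
  have "(\<lambda>t::real. t powr (- 2 * p)) absolutely_integrable_on {1..}"
    using has_integral_powr_to_inf[of "- 2 * p" 1] assms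
    by (intro nonnegative_absolutely_integrable_1) (auto simp: integrable_on_def)
  then have "integrable lebesgue (\<lambda>t::real. indicator {1..} t *\<^sub>R t powr (- 2 * p))"
    by (simp add: set_integrable_def)
  then have a: "integrable lborel (\<lambda>t::real. indicator {1..} t *\<^sub>R t powr (- 2 * p))"
    by (subst (asm) integrable_completion) auto
  then have b: "integrable lborel (\<lambda>t::real. indicator {1..} (- t) *\<^sub>R (- t) powr (- 2 * p))"
    using lborel_integrable_real_affine_iff[of "-1" "\<lambda>t. indicator {1..} t *\<^sub>R t powr (- 2 * p)" 0] by simp
  have c: "integrable lborel (indicator {-1..1::real} :: real \<Rightarrow> real)"
    by (simp add: integrable_real_indicator)
  note I = Bochner_Integration.integrable_add[OF Bochner_Integration.integrable_add[OF a b] c]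
  show ?thesis
  proof (rule Bochner_Integration.integrable_bound[OF I])
    have pos: "0 < 1 + t\<^sup>2" for t :: real by (simp add: add_pos_nonneg)
    have k: "(1 + t\<^sup>2) powr (- p) \<le> \<bar>t\<bar> powr (- 2 * p)" if "\<bar>t\<bar> \<ge> 1" for t :: real
    proof -
      have "(1 + t\<^sup>2) powr (- p) \<le> (\<bar>t\<bar>\<^sup>2) powr (- p)"
        using assms that by (intro powr_mono2') auto
      also have "\<dots> = \<bar>t\<bar> powr (- 2 * p)"
        using that powr_powr[of "\<bar>t\<bar>" 2 "- p"] by simp
      finally show ?thesis .
    qed
    have m: "(1 + t\<^sup>2) powr (- p) \<le> 1" for t :: real
      using powr_mono2'[of "-p" 1 "1 + t\<^sup>2"] assms by simp
    show "AE t in lborel. norm ((1 + t\<^sup>2) powr - p) \<le> norm (indicator {1..} t *\<^sub>R t powr (- 2 * p) +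
        indicator {1..} (- t) *\<^sub>R (- t) powr (- 2 * p) + indicator {-1..1} t)"
    proof (rule AE_I2)
      fix t :: real
      consider "t \<ge> 1" | "t \<le> -1" | "-1 < t" "t < 1" by linarith
      then show "norm ((1 + t\<^sup>2) powr - p) \<le> norm (indicator {1..} t *\<^sub>R t powr (- 2 * p) +
        indicator {1..} (- t) *\<^sub>R (- t) powr (- 2 * p) + indicator {-1..1} t)"
        using k[of t] m[of t] by cases (auto simp: indicator_def)
    qed
  qed (measurable)
qed

text \<open>Each of the \<open>d\<close> factors \<open>(1 + \<bar>x\<bar>\<^sup>2) powr (s/d)\<close> is bounded below by the same power of
  \<open>1 + x\<^sub>l\<^sup>2\<close>, which reduces the integral to dimension one.\<close>

lemma integrable_japanese_bracket:
  assumes "s > real CARD('d) / 2"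
  shows "integrable lborel (\<lambda>x::real^'d. (1 + (norm x)\<^sup>2) powr (- s))"
proof -
  define p where "p = s / CARD('d)"
  have p: "p > 1/2" using assms by (simp add: p_def field_simps)
  have "integrable lborel (\<lambda>t::real. complex_of_real ((1 + t\<^sup>2) powr (- p)))"
    by (rule integrable_of_real[OF integrable_japanese_bracket_1d[OF p]])
  then have "integrable lborel (\<lambda>x::real^'d. \<Prod>l\<in>UNIV. complex_of_real ((1 + (x $ l)\<^sup>2) powr (- p)))"
    by (intro integrable_prod_components)
  then show ?thesis
  proof (rule Bochner_Integration.integrable_bound)
    show "(\<lambda>x::real^'d. (1 + (norm x)\<^sup>2) powr (- s)) \<in> borel_measurable lborel" by measurable
    show "AE x::real^'d in lborel. norm ((1 + (norm x)\<^sup>2) powr - s)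
        \<le> norm (\<Prod>l\<in>UNIV. complex_of_real ((1 + (x $ l)\<^sup>2) powr - p))"
    proof (rule AE_I2)
      fix x :: "real^'d"
      have q: "(1 + (norm x)\<^sup>2) powr (- s) = (\<Prod>l\<in>(UNIV::'d set). (1 + (norm x)\<^sup>2) powr (- p))"
        by (simp add: p_def powr_powr powr_power less_imp_neq[OF add_pos_nonneg, symmetric])
      also have "\<dots> \<le> (\<Prod>l\<in>UNIV. (1 + (x $ l)\<^sup>2) powr (- p))"
      proof (rule prod_mono, intro conjI)
        fix l
        have "(x $ l)\<^sup>2 \<le> (norm x)\<^sup>2" using component_le_norm_cart[of x l]
          by (simp add: abs_le_square_iff[symmetric])
        then show "(1 + (norm x)\<^sup>2) powr - p \<le> (1 + (x $ l)\<^sup>2) powr - p"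
          using p by (intro powr_mono2') (auto intro: add_pos_nonneg)
      qed simp
      finally show "norm ((1 + (norm x)\<^sup>2) powr - s)
        \<le> norm (\<Prod>l\<in>UNIV. complex_of_real ((1 + (x $ l)\<^sup>2) powr - p))"
        by (simp flip: of_real_prod add: prod_nonneg del: of_real_prod)
    qed
  qed
qed

section \<open>Hoelder bounds for Sobolev functions\<close>

lemma fourier_lborel:
  assumes [measurable]: "f \<in> borel_measurable borel"
  shows "fourier f \<xi> = (LINT x|lborel. f x * exp (- (\<i> * complex_of_real (x \<bullet> \<xi>))))"
  unfolding fourier_def by (rule integral_completion) measurable

lemma fourier_measurable:
  fixes f :: "real^'d \<Rightarrow> complex"
  assumes f [measurable]: "f \<in> borel_measurable borel"
  shows "fourier f \<in> borel_measurable borel"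
proof -
  have "(\<lambda>\<xi>. LINT x|lborel. f x * exp (- (\<i> * complex_of_real (x \<bullet> \<xi>)))) \<in> borel_measurable borel"
    by (rule lborel.borel_measurable_lebesgue_integral) measurable
  moreover have "fourier f = (\<lambda>\<xi>. LINT x|lborel. f x * exp (- (\<i> * complex_of_real (x \<bullet> \<xi>))))"
    by (rule ext) (rule fourier_lborel[OF f])
  ultimately show ?thesis by simp
qed

text \<open>Fubini for \<open>f x * w \<xi>\<close> times the kernel. The formula moves the
  transform from f, of which little is known, onto an explicit test function.\<close>

lemma integral_fourier_swap:
  fixes f w :: "real^'d \<Rightarrow> complex"
  assumes f: "integrable lborel f" and w: "integrable lborel w"
  shows "(LINT \<xi>|lborel. fourier f \<xi> * w \<xi>) = (LINT x|lborel. f x * fourier w x)"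
proof -
  have [measurable]: "f \<in> borel_measurable borel" "w \<in> borel_measurable borel"
    using f w by auto
  let ?h = "\<lambda>\<xi> x. f x * w \<xi> * exp (- (\<i> * complex_of_real (x \<bullet> \<xi>)))"
  have I: "integrable (lborel \<Otimes>\<^sub>M lborel) (case_prod ?h)"
  proof (rule lborel_pair.Fubini_integrable)
    show "case_prod ?h \<in> borel_measurable (lborel \<Otimes>\<^sub>M lborel)" by measurable
    have "integrable lborel (\<lambda>\<xi>. cmod (w \<xi>) * (LINT x|lborel. cmod (f x)))"
      using w by (intro integrable_mult_left integrable_norm) auto
    then show "integrable lborel (\<lambda>\<xi>. LINT x|lborel. norm (case (\<xi>, x) of (\<xi>, x) \<Rightarrow> ?h \<xi> x))"
      by (simp add: norm_mult mult.commute)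
    have "integrable lborel (?h \<xi>)" for \<xi>
      by (rule Bochner_Integration.integrable_bound[OF integrable_mult_left[OF f, of "w \<xi>"]])
        (auto simp: norm_mult)
    then show "AE \<xi> in lborel. integrable lborel (\<lambda>x. case (\<xi>, x) of (\<xi>, x) \<Rightarrow> ?h \<xi> x)"
      by simp
  qed
  have 1: "fourier f \<xi> * w \<xi> = (LINT x|lborel. ?h \<xi> x)" for \<xi>
  proof -
    have "(LINT x|lborel. ?h \<xi> x) = (LINT x|lborel. f x * exp (- (\<i> * complex_of_real (x \<bullet> \<xi>))) * w \<xi>)"
      by (simp only: mult_ac)
    then show ?thesis by (simp add: fourier_lborel)
  qed
  have 2: "(LINT \<xi>|lborel. ?h \<xi> x) = f x * fourier w x" for x
  proof -
    have "(LINT \<xi>|lborel. ?h \<xi> x) = (LINT \<xi>|lborel. f x * (w \<xi> * exp (- (\<i> * complex_of_real (\<xi> \<bullet> x)))))"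
      by (simp only: mult_ac inner_commute)
    then show ?thesis by (simp add: fourier_lborel)
  qed
  have "(LINT \<xi>|lborel. fourier f \<xi> * w \<xi>) = (LINT \<xi>|lborel. (LINT x|lborel. ?h \<xi> x))"
    by (simp only: 1)
  also have "\<dots> = (LINT x|lborel. (LINT \<xi>|lborel. ?h \<xi> x))"
    by (rule lborel_pair.Fubini_integral[OF I, symmetric])
  also have "\<dots> = (LINT x|lborel. f x * fourier w x)"
    by (simp only: 2)
  finally show ?thesis .
qed

section \<open>Uniqueness of the L2 Fourier transform\<close>

abbreviation trunc :: "real \<Rightarrow> (real^'d \<Rightarrow> complex) \<Rightarrow> real^'d \<Rightarrow> complex" where
  "trunc R f \<equiv> \<lambda>x. if norm x < R then f x else 0"

lemma integrable_trunc:
  fixes f :: "real^'d \<Rightarrow> complex"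
  assumes "continuous_on UNIV f"
  shows "integrable lborel (trunc R f)"
proof -
  have [measurable]: "f \<in> borel_measurable borel"
    using assms by (rule borel_measurable_continuous_onI)
  have "integrable lborel (\<lambda>x. indicator (cball 0 R) x *\<^sub>R f x)"
    by (rule borel_integrable_compact) (auto intro: continuous_on_subset[OF assms])
  then show ?thesis
    by (rule Bochner_Integration.integrable_bound) (auto simp: indicator_def)
qed

text \<open>\<open>sobolev\<close> supplies its own transform for each exponent, while
  \<open>sobolev_norm\<close> uses the one picked by \<open>SOME\<close>; uniqueness of L2 limits
  lets them be exchanged. Continuity of f makes the truncations integrable and their transforms
  measurable.\<close>

lemma has_fourier_L2_unique:
  fixes f :: "real^'d \<Rightarrow> complex"
  assumes f: "continuous_on UNIV f" and F: "has_fourier_L2 f F" and G: "has_fourier_L2 f G"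
  shows "AE \<xi> in lebesgue. F \<xi> = G \<xi>"
proof -
  have m: "fourier (trunc R f) \<in> borel_measurable lebesgue" for R
    using fourier_measurable[of "trunc R f"] integrable_trunc[OF f, of R]
    by (auto simp: measurable_completion)
  have [measurable]: "F \<in> borel_measurable lebesgue" "G \<in> borel_measurable lebesgue"
    using F G by (auto simp: has_fourier_L2_def square_integrable_def)
  let ?D = "\<lambda>H R. \<integral>\<^sup>+ \<xi>. ennreal ((cmod (fourier (trunc R f) \<xi> - H \<xi>))\<^sup>2) \<partial>lebesgue"
  have lim: "(?D F \<longlongrightarrow> 0) at_top" "(?D G \<longlongrightarrow> 0) at_top"
    using F G by (auto simp: has_fourier_L2_def)
  have le: "(\<integral>\<^sup>+ \<xi>. ennreal ((cmod (F \<xi> - G \<xi>))\<^sup>2) \<partial>lebesgue) \<le> 2 * ?D F R + 2 * ?D G R" for R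
  proof -
    note m[of R, measurable]
    have "(cmod (F \<xi> - G \<xi>))\<^sup>2 \<le> 2 * (cmod (u - F \<xi>))\<^sup>2 + 2 * (cmod (u - G \<xi>))\<^sup>2" for \<xi> u
    proof -
      have "cmod (F \<xi> - G \<xi>) \<le> cmod (u - F \<xi>) + cmod (u - G \<xi>)"
        using norm_triangle_ineq4[of "u - G \<xi>" "u - F \<xi>"] by simp
      then have "(cmod (F \<xi> - G \<xi>))\<^sup>2 \<le> (cmod (u - F \<xi>) + cmod (u - G \<xi>))\<^sup>2"
        by (intro power_mono) auto
      also have "\<dots> \<le> 2 * (cmod (u - F \<xi>))\<^sup>2 + 2 * (cmod (u - G \<xi>))\<^sup>2"
        using sum_squares_bound[of "cmod (u - F \<xi>)" "cmod (u - G \<xi>)"] by (simp add: power2_sum)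
      finally show ?thesis .
    qed
    then have "(\<integral>\<^sup>+ \<xi>. ennreal ((cmod (F \<xi> - G \<xi>))\<^sup>2) \<partial>lebesgue) \<le>
      (\<integral>\<^sup>+ \<xi>. 2 * ennreal ((cmod (fourier (trunc R f) \<xi> - F \<xi>))\<^sup>2) +
        2 * ennreal ((cmod (fourier (trunc R f) \<xi> - G \<xi>))\<^sup>2) \<partial>lebesgue)"
      by (intro nn_integral_mono) (simp add: ennreal_mult' ennreal_plus[symmetric] ennreal_numeral[symmetric] del: ennreal_plus ennreal_numeral flip: ennreal_mult')
    also have "\<dots> = 2 * ?D F R + 2 * ?D G R"
      by (simp add: nn_integral_add nn_integral_cmult)
    finally show ?thesis .
  qed
  have "((\<lambda>R. 2 * ?D F R + 2 * ?D G R) \<longlongrightarrow> 2 * 0 + 2 * 0) at_top"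
    by (intro tendsto_add ennreal_tendsto_cmult lim) auto
  then have "(\<integral>\<^sup>+ \<xi>. ennreal ((cmod (F \<xi> - G \<xi>))\<^sup>2) \<partial>lebesgue) \<le> 2 * 0 + 2 * 0"
    by (rule tendsto_lowerbound) (auto intro!: always_eventually le)
  then have "(\<integral>\<^sup>+ \<xi>. ennreal ((cmod (F \<xi> - G \<xi>))\<^sup>2) \<partial>lebesgue) = 0" by simp
  then show ?thesis
    by (subst (asm) nn_integral_0_iff_AE) auto
qed

section \<open>Fourier inversion with Gaussian damping\<close>

text \<open>Modulation moves the centre of the transformed Gaussian to x and damping by \<eta> gives
  it width \<eta>, so the transform is (2 \<pi>)^d times an approximate identity at x as \<eta>
  tends to 0.\<close>

lemma fourier_wave_gauss:
  fixes x y :: "real^'d"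
  assumes "\<eta> > 0"
  defines "w \<equiv> \<lambda>\<xi>. exp (\<i> * complex_of_real (x \<bullet> \<xi>)) * complex_of_real (gauss (\<eta> *\<^sub>R \<xi>))"
  shows "integrable lborel w"
    and "fourier w y = complex_of_real ((1 / \<eta>) ^ CARD('d) * sqrt (2 * pi) ^ CARD('d) * gauss ((1 / \<eta>) *\<^sub>R (y - x)))"
proof -
  have [measurable]: "w \<in> borel_measurable borel" unfolding w_def by measurable
  let ?k = "\<lambda>\<xi>. w \<xi> * exp (- (\<i> * complex_of_real (y \<bullet> \<xi>)))"
  have k: "?k (0 + (1 / \<eta>) *\<^sub>R u) = complex_of_real (gauss u) * exp (\<i> * complex_of_real (((1 / \<eta>) *\<^sub>R (x - y)) \<bullet> u))" for u
    using assms(1) by (simp add: w_def inner_diff_left algebra_simps diff_divide_distrib flip: exp_add)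
  have g: "gauss ((1 / \<eta>) *\<^sub>R (x - y)) = gauss ((1 / \<eta>) *\<^sub>R (y - x))"
    by (simp add: gauss_def norm_minus_commute)
  have "fourier w y = (LINT \<xi>|lborel. ?k \<xi>)"
    by (subst fourier_lborel) (auto simp: inner_commute)
  also have "\<dots> = \<bar>1 / \<eta>\<bar> ^ DIM(real^'d) *\<^sub>R (LINT u|lborel. ?k (0 + (1 / \<eta>) *\<^sub>R u))"
    using assms(1) by (intro lborel_integral_affine) auto
  also have "\<dots> = (1 / \<eta>) ^ CARD('d) * (sqrt (2 * pi) ^ CARD('d) * gauss ((1 / \<eta>) *\<^sub>R (y - x)))"
    unfolding k integral_gauss_exp using assms(1) g by (simp add: scaleR_conv_of_real)
  finally show "fourier w y = complex_of_real ((1 / \<eta>) ^ CARD('d) * sqrt (2 * pi) ^ CARD('d) * gauss ((1 / \<eta>) *\<^sub>R (y - x)))"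
    by simp
  have "integrable lborel (\<lambda>\<xi>::real^'d. gauss (\<eta> *\<^sub>R \<xi>))"
    using assms(1) integrable_gauss[where ?'d='d] lborel_integrable_affine[of gauss \<eta> 0] by simp
  then have "integrable lborel (\<lambda>\<xi>::real^'d. complex_of_real (gauss (\<eta> *\<^sub>R \<xi>)))"
    by (rule integrable_of_real)
  then show "integrable lborel w"
    by (rule Bochner_Integration.integrable_bound) (auto simp: w_def norm_mult)
qed

text \<open>The damped inversion integral is a Gaussian average of f at scale \<eta>: after the
  multiplication formula, the substitution y = x + \<eta> u cancels the factor (1 /
  \<eta>)^d.\<close>

lemma integral_fourier_wave_gauss:
  fixes f :: "real^'d \<Rightarrow> complex"
  assumes f: "integrable lborel f" and "\<eta> > 0"
  shows "(LINT \<xi>|lborel. fourier f \<xi> * (exp (\<i> * complex_of_real (x \<bullet> \<xi>)) * complex_of_real (gauss (\<eta> *\<^sub>R \<xi>))))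
    = sqrt (2 * pi) ^ CARD('d) *\<^sub>R (LINT u|lborel. f (x + \<eta> *\<^sub>R u) * complex_of_real (gauss u))"
proof -
  have [measurable]: "f \<in> borel_measurable borel" using f by auto
  have "(LINT \<xi>|lborel. fourier f \<xi> * (exp (\<i> * complex_of_real (x \<bullet> \<xi>)) * complex_of_real (gauss (\<eta> *\<^sub>R \<xi>))))
    = (LINT y|lborel. f y * complex_of_real ((1 / \<eta>) ^ CARD('d) * sqrt (2 * pi) ^ CARD('d) * gauss ((1 / \<eta>) *\<^sub>R (y - x))))"
    by (subst integral_fourier_swap[OF f fourier_wave_gauss(1)[OF assms(2)]])
      (simp add: fourier_wave_gauss(2)[OF assms(2)])
  also have "\<dots> = \<bar>\<eta>\<bar> ^ DIM(real^'d) *\<^sub>R (LINT u|lborel. f (x + \<eta> *\<^sub>R u) *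
      complex_of_real ((1 / \<eta>) ^ CARD('d) * sqrt (2 * pi) ^ CARD('d) * gauss ((1 / \<eta>) *\<^sub>R (x + \<eta> *\<^sub>R u - x))))"
    using assms(2) by (intro lborel_integral_affine) auto
  also have "\<dots> = \<bar>\<eta>\<bar> ^ DIM(real^'d) *\<^sub>R (LINT u|lborel. complex_of_real ((1 / \<eta>) ^ CARD('d) * sqrt (2 * pi) ^ CARD('d)) *
      (f (x + \<eta> *\<^sub>R u) * complex_of_real (gauss u)))"
    using assms(2) by (simp add: mult_ac)
  also have "\<dots> = sqrt (2 * pi) ^ CARD('d) *\<^sub>R (LINT u|lborel. f (x + \<eta> *\<^sub>R u) * complex_of_real (gauss u))"
    using assms(2) by (simp only: integral_mult_right_zero) (simp add: scaleR_conv_of_real power_one_over)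
  finally show ?thesis .
qed

text \<open>A dominating function for f against the Gaussian. Since f is only square integrable, |f|
  is replaced by its upper bound 1 + |f|^2.\<close>

lemma integrable_shift_gauss:
  fixes f :: "real^'d \<Rightarrow> complex"
  assumes [measurable]: "f \<in> borel_measurable borel"
    and i: "integrable lborel (\<lambda>x. (cmod (f x))\<^sup>2)" and "\<eta> \<noteq> 0"
  shows "integrable lborel (\<lambda>u. (1 + (cmod (f (x + \<eta> *\<^sub>R u)))\<^sup>2) * gauss u)"
proof -
  have "integrable lborel (\<lambda>u. gauss u + (cmod (f (x + \<eta> *\<^sub>R u)))\<^sup>2)"
    by (intro Bochner_Integration.integrable_add integrable_gauss lborel_integrable_affine[OF i] assms)
  then show ?thesis
  proof (rule Bochner_Integration.integrable_bound)
    show "AE u in lborel. norm ((1 + (cmod (f (x + \<eta> *\<^sub>R u)))\<^sup>2) * gauss u)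
        \<le> norm (gauss u + (cmod (f (x + \<eta> *\<^sub>R u)))\<^sup>2)"
    proof (rule AE_I2)
      fix u :: "real^'d"
      have "(cmod (f (x + \<eta> *\<^sub>R u)))\<^sup>2 * gauss u \<le> (cmod (f (x + \<eta> *\<^sub>R u)))\<^sup>2"
        using gauss_le_1[of u] by (intro mult_left_le) auto
      then show "norm ((1 + (cmod (f (x + \<eta> *\<^sub>R u)))\<^sup>2) * gauss u)
        \<le> norm (gauss u + (cmod (f (x + \<eta> *\<^sub>R u)))\<^sup>2)"
        using gauss_pos[of u] by (simp add: algebra_simps)
    qed
  qed measurable
qed

lemma le_1_plus_sq: "a \<le> 1 + a\<^sup>2" for a :: real
  using sum_squares_bound[of a 1] zero_le_power2[of a] by (smt (verit) mult_cancel_left1 power_one)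

lemma trunc_gauss_tendsto:
  fixes f :: "real^'d \<Rightarrow> complex"
  assumes [measurable]: "f \<in> borel_measurable borel"
    and i: "integrable lborel (\<lambda>x. (cmod (f x))\<^sup>2)" and "\<eta> \<noteq> 0"
  shows "(\<lambda>n. LINT u|lborel. trunc (real n) f (x + \<eta> *\<^sub>R u) * complex_of_real (gauss u))
    \<longlonglongrightarrow> (LINT u|lborel. f (x + \<eta> *\<^sub>R u) * complex_of_real (gauss u))"
proof (rule integral_dominated_convergence[OF _ _ integrable_shift_gauss[OF assms, of x]])
  show "AE u in lborel. (\<lambda>n. trunc (real n) f (x + \<eta> *\<^sub>R u) * complex_of_real (gauss u))
    \<longlonglongrightarrow> f (x + \<eta> *\<^sub>R u) * complex_of_real (gauss u)"
  proof (rule AE_I2, rule tendsto_eventually)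
    fix u :: "real^'d"
    have "eventually (\<lambda>n. norm (x + \<eta> *\<^sub>R u) < real n) sequentially"
      by real_asymp
    then show "eventually (\<lambda>n. trunc (real n) f (x + \<eta> *\<^sub>R u) * complex_of_real (gauss u) =
        f (x + \<eta> *\<^sub>R u) * complex_of_real (gauss u)) sequentially"
      by eventually_elim auto
  qed
  show "AE u in lborel. norm (trunc (real n) f (x + \<eta> *\<^sub>R u) * complex_of_real (gauss u))
      \<le> (1 + (cmod (f (x + \<eta> *\<^sub>R u)))\<^sup>2) * gauss u" for n
  proof (rule AE_I2)
    fix u :: "real^'d"
    show "norm (trunc (real n) f (x + \<eta> *\<^sub>R u) * complex_of_real (gauss u))
      \<le> (1 + (cmod (f (x + \<eta> *\<^sub>R u)))\<^sup>2) * gauss u"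
      using gauss_pos[of u] le_1_plus_sq[of "cmod (f (x + \<eta> *\<^sub>R u))"]
      by (simp add: norm_mult)
  qed
qed (measurable)

text \<open>No global bound on f is available, so dominated convergence covers only the part where x
  + e u stays within distance 1 of x. Elsewhere the Gaussian is at most exp (- (n + 1)^2 / 2), which
  beats the factor (n + 1)^d that rescaling costs in the L2 norm.\<close>

lemma gauss_approx_identity:
  fixes f :: "real^'d \<Rightarrow> complex"
  assumes f: "continuous_on UNIV f" and i: "integrable lborel (\<lambda>x. (cmod (f x))\<^sup>2)"
  shows "(\<lambda>n. LINT u|lborel. f (x + (1 / real (Suc n)) *\<^sub>R u) * complex_of_real (gauss u))
    \<longlonglongrightarrow> sqrt (2 * pi) ^ CARD('d) *\<^sub>R f x"
proof -
  have m [measurable]: "f \<in> borel_measurable borel"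
    using f by (rule borel_measurable_continuous_onI)
  define e where "e n = 1 / real (Suc n)" for n
  have e: "e n > 0" for n by (simp add: e_def)
  have e_lim: "e \<longlonglongrightarrow> 0" unfolding e_def by real_asymp
  obtain K where K: "\<And>y. norm (y - x) < 1 \<Longrightarrow> cmod (f y - f x) \<le> K" "K \<ge> 0"
  proof -
    have "compact ((\<lambda>y. f y - f x) ` cball x 1)"
      by (intro compact_continuous_image continuous_intros continuous_on_subset[OF f]) auto
    then obtain K where "K > 0" "\<forall>y\<in>(\<lambda>y. f y - f x) ` cball x 1. norm y \<le> K"
      using compact_imp_bounded bounded_pos by blast
    then show ?thesis by (intro that[of K]) (auto simp: dist_norm norm_minus_commute)
  qed
  \<comment> \<open>\<open>p\<close> has an integrable majorant and tends to 0 pointwise, each u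
    being eventually in the first branch. On the far part, |f (x + e u) - f x| is split by a \<le> 1
    + a^2: the constant terms stay in \<open>p\<close>, the square goes to \<open>q\<close>.\<close>
  define p where "p n u = (if norm (e n *\<^sub>R u) < 1 then cmod (f (x + e n *\<^sub>R u) - f x) * gauss u
      else (1 + cmod (f x)) * gauss u)" for n and u :: "real^'d"
  define q where "q n u = exp (- (real (Suc n))\<^sup>2 / 2) * (cmod (f (x + e n *\<^sub>R u)))\<^sup>2" for n and u :: "real^'d"
  have dom: "integrable lborel (\<lambda>u::real^'d. (K + 1 + cmod (f x)) * gauss u)"
    by (intro integrable_mult_right integrable_gauss)
  have p_le: "norm (p n u) \<le> (K + 1 + cmod (f x)) * gauss u" for n u
    using K(1)[of "x + e n *\<^sub>R u"] K(2) gauss_pos[of u]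
    by (auto simp: p_def intro!: mult_right_mono order_trans[OF K(1)] add_nonneg_nonneg)
  have [measurable]: "p n \<in> borel_measurable borel" for n unfolding p_def by measurable
  have "(\<lambda>n. LINT u|lborel. p n u) \<longlonglongrightarrow> (LINT u|(lborel :: (real^'d) measure). 0)"
  proof (rule integral_dominated_convergence[OF _ _ dom])
    show "AE u in lborel. (\<lambda>n. p n u) \<longlonglongrightarrow> 0"
    proof (rule AE_I2)
      fix u :: "real^'d"
      have l: "(\<lambda>n. x + e n *\<^sub>R u) \<longlonglongrightarrow> x + 0 *\<^sub>R u" by (intro tendsto_intros e_lim)
      have "(\<lambda>n. f (x + e n *\<^sub>R u)) \<longlonglongrightarrow> f x"
        using continuous_on_tendsto_compose[OF f l] by simp
      then have "(\<lambda>n. cmod (f (x + e n *\<^sub>R u) - f x) * gauss u) \<longlonglongrightarrow> cmod (f x - f x) * gauss u"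
        by (intro tendsto_intros)
      moreover have "eventually (\<lambda>n. norm (e n *\<^sub>R u) < 1) sequentially"
      proof -
        have "(\<lambda>n. norm (e n *\<^sub>R u)) \<longlonglongrightarrow> norm (0 *\<^sub>R u)" by (intro tendsto_intros e_lim)
        then show ?thesis by (rule order_tendstoD) simp
      qed
      then have "eventually (\<lambda>n. cmod (f (x + e n *\<^sub>R u) - f x) * gauss u = p n u) sequentially"
        by eventually_elim (simp add: p_def)
      ultimately show "(\<lambda>n. p n u) \<longlonglongrightarrow> 0"
        using Lim_transform_eventually by fastforce
    qed
  qed (use p_le in auto)
  then have p_lim: "(\<lambda>n. LINT u|lborel. p n u) \<longlonglongrightarrow> 0" by simp
  have p_int: "integrable lborel (p n)" for n
  proof (rule Bochner_Integration.integrable_bound[OF dom])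
    show "AE u in lborel. norm (p n u) \<le> norm ((K + 1 + cmod (f x)) * gauss u)"
      unfolding real_norm_def[of "_ * _"] by (rule AE_I2, rule order_trans[OF p_le abs_ge_self])
  qed simp
  have sq_int: "integrable lborel (\<lambda>u. (cmod (f (x + e n *\<^sub>R u)))\<^sup>2)" for n
    using e[of n] by (intro lborel_integrable_affine[OF i]) auto
  have q_int: "integrable lborel (q n)" for n
    unfolding q_def by (intro integrable_mult_right sq_int)
  define B where "B = (LINT x|lborel. (cmod (f x))\<^sup>2)"
  \<comment> \<open>The factor \<open>real (Suc n) ^ CARD('d)\<close> is the Jacobian of u \<mapsto>
    x + u / (n + 1), inverted.\<close>
  have q_eq: "(LINT u|lborel. q n u) = exp (- (real (Suc n))\<^sup>2 / 2) * real (Suc n) ^ CARD('d) * B" for n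
  proof -
    have "B = \<bar>e n\<bar> ^ DIM(real^'d) *\<^sub>R (LINT u|lborel. (cmod (f (x + e n *\<^sub>R u)))\<^sup>2)"
      unfolding B_def using e[of n] by (intro lborel_integral_affine) auto
    then have "(LINT u|lborel. (cmod (f (x + e n *\<^sub>R u)))\<^sup>2) = real (Suc n) ^ CARD('d) * B"
      by (simp add: e_def power_one_over del: of_nat_Suc)
    then show ?thesis by (simp add: q_def)
  qed
  have "(\<lambda>n. exp (- (real (Suc n))\<^sup>2 / 2) * real (Suc n) ^ CARD('d) * B) \<longlonglongrightarrow> 0 * B"
  proof (intro tendsto_mult tendsto_const)
    \<comment> \<open>Used at t = (n + 1)^2 / 2, where (n + 1)^d \<le> ((n + 1)^2)^d = 2^d
      t^d.\<close>
    have a: "((\<lambda>t::real. t ^ CARD('d) / exp t) \<longlongrightarrow> 0) at_top" by (rule tendsto_power_div_exp_0)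
    have "filterlim (\<lambda>n. (real (Suc n))\<^sup>2 / 2) at_top sequentially" by real_asymp
    from tendsto_mult_right_zero[OF filterlim_compose[OF a this], of "2 ^ CARD('d)"]
    have l: "(\<lambda>n. 2 ^ CARD('d) * (((real (Suc n))\<^sup>2 / 2) ^ CARD('d) / exp ((real (Suc n))\<^sup>2 / 2))) \<longlonglongrightarrow> 0" .
    show "(\<lambda>n. exp (- (real (Suc n))\<^sup>2 / 2) * real (Suc n) ^ CARD('d)) \<longlonglongrightarrow> 0"
    proof (rule tendsto_sandwich[OF _ _ tendsto_const l])
      have "exp (- (real (Suc n))\<^sup>2 / 2) * real (Suc n) ^ CARD('d) \<le>
          2 ^ CARD('d) * (((real (Suc n))\<^sup>2 / 2) ^ CARD('d) / exp ((real (Suc n))\<^sup>2 / 2))" for n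
      proof -
        have "real (Suc n) ^ CARD('d) \<le> ((real (Suc n))\<^sup>2) ^ CARD('d)"
          by (intro power_mono) (auto intro: self_le_power)
        then show ?thesis by (simp add: exp_minus power_divide divide_simps)
      qed
      then show "eventually (\<lambda>n. exp (- (real (Suc n))\<^sup>2 / 2) * real (Suc n) ^ CARD('d) \<le>
          2 ^ CARD('d) * (((real (Suc n))\<^sup>2 / 2) ^ CARD('d) / exp ((real (Suc n))\<^sup>2 / 2))) sequentially"
        by simp
    qed simp
  qed
  then have q_lim: "(\<lambda>n. LINT u|lborel. q n u) \<longlonglongrightarrow> 0" unfolding q_eq by simp
  have int1: "integrable lborel (\<lambda>u. f (x + e n *\<^sub>R u) * complex_of_real (gauss u))" for n
  proof (rule Bochner_Integration.integrable_bound[OF integrable_shift_gauss[OF m i, of "e n" x]])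
    show "e n \<noteq> 0" using e[of n] by simp
    show "AE u in lborel. norm (f (x + e n *\<^sub>R u) * complex_of_real (gauss u))
        \<le> norm ((1 + (cmod (f (x + e n *\<^sub>R u)))\<^sup>2) * gauss u)"
    proof (rule AE_I2)
      fix u :: "real^'d"
      show "norm (f (x + e n *\<^sub>R u) * complex_of_real (gauss u))
        \<le> norm ((1 + (cmod (f (x + e n *\<^sub>R u)))\<^sup>2) * gauss u)"
        using gauss_pos[of u] le_1_plus_sq[of "cmod (f (x + e n *\<^sub>R u))"]
        by (simp add: norm_mult abs_mult)
    qed
  qed measurable
  have int2: "integrable lborel (\<lambda>u::real^'d. f x * complex_of_real (gauss u))"
    by (intro integrable_mult_right integrable_of_real integrable_gauss)
  have bound: "cmod (f (x + e n *\<^sub>R u) * complex_of_real (gauss u) - f x * complex_of_real (gauss u)) \<le> p n u + q n u" for n u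
  proof -
    have l: "cmod (f (x + e n *\<^sub>R u) * complex_of_real (gauss u) - f x * complex_of_real (gauss u))
        = cmod (f (x + e n *\<^sub>R u) - f x) * gauss u"
      using gauss_pos[of u] by (simp add: norm_mult flip: left_diff_distrib)
    show ?thesis
    proof (cases "norm (e n *\<^sub>R u) < 1")
      case True
      then show ?thesis by (simp add: l p_def q_def)
    next
      case False
      have "real (Suc n) \<le> norm u" using False by (simp add: e_def field_simps)
      then have "gauss u \<le> exp (- (real (Suc n))\<^sup>2 / 2)"
        unfolding gauss_def by (simp del: of_nat_Suc)
      then have "gauss u * (cmod (f (x + e n *\<^sub>R u)))\<^sup>2 \<le> q n u"
        unfolding q_def by (intro mult_right_mono) auto
      moreover have "cmod (f (x + e n *\<^sub>R u) - f x) * gauss u \<le> (1 + (cmod (f (x + e n *\<^sub>R u)))\<^sup>2 + cmod (f x)) * gauss u"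
        using gauss_pos[of u] norm_triangle_ineq4[of "f (x + e n *\<^sub>R u)" "f x"] le_1_plus_sq[of "cmod (f (x + e n *\<^sub>R u))"]
        by (intro mult_right_mono) auto
      ultimately have "cmod (f (x + e n *\<^sub>R u) - f x) * gauss u \<le> (1 + cmod (f x)) * gauss u + q n u"
        by (simp add: algebra_simps)
      then show ?thesis using False by (simp add: l p_def)
    qed
  qed
  have "(\<lambda>n. (LINT u|lborel. f (x + e n *\<^sub>R u) * complex_of_real (gauss u))
      - (LINT u|lborel. f x * complex_of_real (gauss (u::real^'d)))) \<longlonglongrightarrow> 0"
  proof (rule Lim_null_comparison)
    have "norm ((LINT u|lborel. f (x + e n *\<^sub>R u) * complex_of_real (gauss u))
      - (LINT u|lborel. f x * complex_of_real (gauss (u::real^'d)))) \<le> (LINT u|lborel. p n u) + (LINT u|lborel. q n u)" for n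
    proof -
      have "norm ((LINT u|lborel. f (x + e n *\<^sub>R u) * complex_of_real (gauss u))
        - (LINT u|lborel. f x * complex_of_real (gauss (u::real^'d))))
        = norm (LINT u|lborel. f (x + e n *\<^sub>R u) * complex_of_real (gauss u) - f x * complex_of_real (gauss u))"
        by (simp add: Bochner_Integration.integral_diff[OF int1 int2])
      also have "\<dots> \<le> (LINT u|lborel. norm (f (x + e n *\<^sub>R u) * complex_of_real (gauss u) - f x * complex_of_real (gauss u)))"
        by (rule integral_norm_bound)
      also have "\<dots> \<le> (LINT u|lborel. p n u + q n u)"
        by (intro Bochner_Integration.integral_mono bound integrable_norm int1 int2 p_int q_int
            Bochner_Integration.integrable_add Bochner_Integration.integrable_diff)
      finally show ?thesis by (simp add: Bochner_Integration.integral_add[OF p_int q_int])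
    qed
    then show "eventually (\<lambda>n. norm ((LINT u|lborel. f (x + e n *\<^sub>R u) * complex_of_real (gauss u))
      - (LINT u|lborel. f x * complex_of_real (gauss (u::real^'d)))) \<le> (LINT u|lborel. p n u) + (LINT u|lborel. q n u)) sequentially"
      by simp
    show "(\<lambda>n. (LINT u|lborel. p n u) + (LINT u|lborel. q n u)) \<longlonglongrightarrow> 0"
      using tendsto_add[OF p_lim q_lim] by simp
  qed
  then have "(\<lambda>n. (LINT u|lborel. f (x + e n *\<^sub>R u) * complex_of_real (gauss u)))
      \<longlonglongrightarrow> (LINT u|lborel. f x * complex_of_real (gauss (u::real^'d)))"
    by (rule LIM_zero_cancel)
  then show ?thesis
    by (simp add: integral_gauss e_def scaleR_conv_of_real mult.commute)
qed

lemma ennreal_plus_mult: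
  assumes "0 \<le> p" "0 \<le> a" "0 \<le> q" "0 \<le> b" "0 \<le> c"
  shows "ennreal (p * a + q * b + c) = ennreal p * ennreal a + ennreal q * ennreal b + ennreal c"
  using assms by (simp add: ennreal_plus ennreal_mult)

text \<open>Testing the truncated transforms against a modulated Gaussian \<open>gauss (\<eta> \<xi>)\<close> turns them into
  Gaussian averages of \<open>f\<close> around \<open>x\<close> and \<open>y\<close>; the truncation is removed first, then \<open>\<eta> \<rightarrow> 0\<close>.\<close>

lemma fourier_L2_pointwise_bound:
  fixes f F :: "real^'d \<Rightarrow> complex"
  assumes f: "continuous_on UNIV f" and F: "has_fourier_L2 f F"
  shows "ennreal ((2 * pi) ^ CARD('d) * cmod (f x - \<alpha> * f y)) \<le>
    (\<integral>\<^sup>+ \<xi>. ennreal (cmod (F \<xi>) * cmod (exp (\<i> * complex_of_real (x \<bullet> \<xi>)) - \<alpha> * exp (\<i> * complex_of_real (y \<bullet> \<xi>)))) \<partial>lebesgue)"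
    (is "_ \<le> ?K")
proof -
  have fm [measurable]: "f \<in> borel_measurable borel"
    using f by (rule borel_measurable_continuous_onI)
  have i: "integrable lborel (\<lambda>x. (cmod (f x))\<^sup>2)"
    using F by (auto simp: has_fourier_L2_def square_integrable_def integrable_completion)
  have Fm [measurable]: "F \<in> borel_measurable lebesgue"
    using F by (auto simp: has_fourier_L2_def square_integrable_def)
  \<comment> \<open>One factor \<open>c\<close> comes from the transform of the Gaussian, a second
    from its mass in the limit \<eta> \<rightarrow> 0; together they make (2 \<pi>)^d.\<close>
  define c where "c = sqrt (2 * pi) ^ CARD('d)"
  have cc: "c * c = (2 * pi) ^ CARD('d)" by (simp only: c_def power_mult_distrib[symmetric]) simp
  define m where "m \<xi> = exp (\<i> * complex_of_real (x \<bullet> \<xi>)) - \<alpha> * exp (\<i> * complex_of_real (y \<bullet> \<xi>))" for \<xi>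
  have m_le: "cmod (m \<xi>) \<le> 1 + cmod \<alpha>" for \<xi>
    unfolding m_def by (rule order_trans[OF norm_triangle_ineq4]) (simp add: norm_mult)
  have [measurable]: "m \<in> borel_measurable borel" unfolding m_def by measurable
  define a where "a \<eta> z = (LINT u|lborel. f (z + \<eta> *\<^sub>R u) * complex_of_real (gauss u))" for \<eta> z
  \<comment> \<open>The estimate lives in \<open>ennreal\<close> because \<open>?K\<close> may be
    infinite: F is only known to be square integrable.\<close>
  have smooth: "ennreal (c * cmod (a \<eta> x - \<alpha> * a \<eta> y)) \<le> ?K" if \<eta>: "\<eta> > 0" for \<eta>
  proof -
    define J where "J n z = (LINT \<xi>|lborel. fourier (trunc (real n) f) \<xi> * (exp (\<i> * complex_of_real (z \<bullet> \<xi>)) * complex_of_real (gauss (\<eta> *\<^sub>R \<xi>))))" for n z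
    have J: "J n z = c *\<^sub>R (LINT u|lborel. trunc (real n) f (z + \<eta> *\<^sub>R u) * complex_of_real (gauss u))" for n z
      unfolding J_def c_def by (rule integral_fourier_wave_gauss[OF integrable_trunc[OF f] \<eta>])
    have J_lim: "(\<lambda>n. J n z) \<longlonglongrightarrow> c *\<^sub>R a \<eta> z" for z
      unfolding J a_def using \<eta> by (intro tendsto_intros trunc_gauss_tendsto fm i) auto
    have gauss2: "integrable lborel (\<lambda>\<xi>::real^'d. gauss (\<eta> *\<^sub>R \<xi>))"
      using \<eta> integrable_gauss[where ?'d='d] lborel_integrable_affine[of gauss \<eta> 0] by simp
    define B where "B = (1 + cmod \<alpha>)\<^sup>2 * (LINT \<xi>|(lborel :: (real^'d) measure). gauss (\<eta> *\<^sub>R \<xi>))"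
    have B: "B \<ge> 0" unfolding B_def
      by (intro mult_nonneg_nonneg zero_le_power2 integral_nonneg_AE AE_I2 less_imp_le gauss_pos)
    let ?Y = "\<lambda>R. \<integral>\<^sup>+ \<xi>. ennreal ((cmod (fourier (trunc R f) \<xi> - F \<xi>))\<^sup>2) \<partial>lebesgue"
    have Y: "(\<lambda>n. ?Y (real n)) \<longlonglongrightarrow> 0"
    proof (rule filterlim_compose[OF _ filterlim_real_sequentially])
      show "(?Y \<longlongrightarrow> 0) at_top" using F by (simp add: has_fourier_L2_def)
    qed
    \<comment> \<open>The convergence hypothesis controls only the square of |\<Phi> - F|, so the
      cross term with the Gaussian is separated by A b \<le> A^2 / \<epsilon> + \<epsilon> b^2.
      Letting n grow removes the first part, and \<epsilon> \<rightarrow> 0 then removes the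
      second.\<close>
    have step: "ennreal (cmod (J n x - \<alpha> * J n y)) \<le> ennreal (1 / \<epsilon>) * ?Y (real n) + ennreal (\<epsilon> * B) + ?K" if \<epsilon>: "\<epsilon> > 0" for n \<epsilon>
    proof -
      let ?\<Phi> = "fourier (trunc (real n) f)"
      have \<Phi>: "?\<Phi> \<in> borel_measurable borel"
        by (rule fourier_measurable) (use integrable_trunc[OF f] in auto)
      have [measurable]: "?\<Phi> \<in> borel_measurable lebesgue"
        using \<Phi> by (simp add: measurable_completion)
      have [measurable]: "m \<in> borel_measurable lebesgue" "(\<lambda>\<xi>::real^'d. gauss (\<eta> *\<^sub>R \<xi>)) \<in> borel_measurable lebesgue"
        by (simp_all add: measurable_completion)
      have "(\<integral>\<^sup>+ \<xi>. ennreal (gauss (\<eta> *\<^sub>R \<xi>)) \<partial>(lebesgue :: (real^'d) measure)) = ennreal (LINT \<xi>|(lborel :: (real^'d) measure). gauss (\<eta> *\<^sub>R \<xi>))"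
        unfolding nn_integral_completion
        by (rule nn_integral_eq_integral[OF gauss2]) (rule AE_I2, rule less_imp_le, rule gauss_pos)
      then have gB: "ennreal (\<epsilon> * (1 + cmod \<alpha>)\<^sup>2) * (\<integral>\<^sup>+ \<xi>. ennreal (gauss (\<eta> *\<^sub>R \<xi>)) \<partial>(lebesgue :: (real^'d) measure)) = ennreal (\<epsilon> * B)"
        using \<epsilon> by (simp add: B_def mult.assoc flip: ennreal_mult')
      have bdd: "cmod (?\<Phi> \<xi>) \<le> (LINT z|lborel. cmod (trunc (real n) f z))" for \<xi>
      proof -
        have "?\<Phi> \<xi> = (LINT z|lborel. trunc (real n) f z * exp (- (\<i> * complex_of_real (z \<bullet> \<xi>))))"
          by (rule fourier_lborel) (use integrable_trunc[OF f] in auto)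
        also have "cmod \<dots> \<le> (LINT z|lborel. cmod (trunc (real n) f z * exp (- (\<i> * complex_of_real (z \<bullet> \<xi>)))))"
          by (rule integral_norm_bound)
        also have "\<dots> = (LINT z|lborel. cmod (trunc (real n) f z))"
          by (simp add: norm_mult)
        finally show ?thesis .
      qed
      have int: "integrable lborel (\<lambda>\<xi>. ?\<Phi> \<xi> * (exp (\<i> * complex_of_real (z \<bullet> \<xi>)) * complex_of_real (gauss (\<eta> *\<^sub>R \<xi>))))" for z
      proof (rule Bochner_Integration.integrable_bound[OF integrable_mult_right[OF gauss2, of "LINT z|lborel. cmod (trunc (real n) f z)"]])
        show "AE \<xi> in lborel. norm (?\<Phi> \<xi> * (exp (\<i> * complex_of_real (z \<bullet> \<xi>)) * complex_of_real (gauss (\<eta> *\<^sub>R \<xi>))))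
            \<le> norm ((LINT z|lborel. cmod (trunc (real n) f z)) * gauss (\<eta> *\<^sub>R \<xi>))"
        proof (rule AE_I2)
          fix \<xi> :: "real^'d"
          have "0 \<le> (LINT z|lborel. cmod (trunc (real n) f z))"
            using bdd[of \<xi>] norm_ge_zero order_trans by blast
          then show "norm (?\<Phi> \<xi> * (exp (\<i> * complex_of_real (z \<bullet> \<xi>)) * complex_of_real (gauss (\<eta> *\<^sub>R \<xi>))))
            \<le> norm ((LINT z|lborel. cmod (trunc (real n) f z)) * gauss (\<eta> *\<^sub>R \<xi>))"
            using mult_right_mono[OF bdd[of \<xi>], of "gauss (\<eta> *\<^sub>R \<xi>)"] gauss_pos[of "\<eta> *\<^sub>R \<xi>"]
            by (simp add: norm_mult)
        qed
      qed (use \<Phi> in measurable)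
      have "J n x - \<alpha> * J n y = (LINT \<xi>|lborel. ?\<Phi> \<xi> * m \<xi> * complex_of_real (gauss (\<eta> *\<^sub>R \<xi>)))"
        unfolding J_def integral_mult_right_zero[symmetric]
        by (subst Bochner_Integration.integral_diff[symmetric])
          (use int in \<open>auto simp: m_def algebra_simps intro!: integrable_mult_right\<close>)
      also have "ennreal (cmod \<dots>) \<le> (\<integral>\<^sup>+ \<xi>. ennreal (cmod (?\<Phi> \<xi> * m \<xi> * complex_of_real (gauss (\<eta> *\<^sub>R \<xi>)))) \<partial>lborel)"
        by (rule integral_norm_bound_ennreal)
          (use Bochner_Integration.integrable_diff[OF int[of x] integrable_mult_right[OF int[of y], of \<alpha>]] in \<open>simp add: m_def algebra_simps\<close>)
      also have "\<dots> = (\<integral>\<^sup>+ \<xi>. ennreal (cmod (?\<Phi> \<xi> * m \<xi> * complex_of_real (gauss (\<eta> *\<^sub>R \<xi>)))) \<partial>lebesgue)"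
        by (simp add: nn_integral_completion)
      also have "\<dots> \<le> (\<integral>\<^sup>+ \<xi>. ennreal (1 / \<epsilon>) * ennreal ((cmod (?\<Phi> \<xi> - F \<xi>))\<^sup>2)
          + ennreal (\<epsilon> * (1 + cmod \<alpha>)\<^sup>2) * ennreal (gauss (\<eta> *\<^sub>R \<xi>)) + ennreal (cmod (F \<xi>) * cmod (m \<xi>)) \<partial>lebesgue)"
      proof (rule nn_integral_mono)
        fix \<xi> :: "real^'d"
        let ?A = "cmod (?\<Phi> \<xi> - F \<xi>)" and ?G = "gauss (\<eta> *\<^sub>R \<xi>)"
        have G: "0 < ?G" "?G \<le> 1" by (rule gauss_pos gauss_le_1)+
        have G2: "?G\<^sup>2 \<le> ?G" using G by (simp add: power2_eq_square mult_left_le)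
        have "cmod (?\<Phi> \<xi> * m \<xi> * complex_of_real ?G) = cmod (?\<Phi> \<xi>) * cmod (m \<xi>) * ?G"
          using G by (simp add: norm_mult)
        also have "\<dots> \<le> (?A + cmod (F \<xi>)) * cmod (m \<xi>) * ?G"
          using G norm_triangle_ineq[of "?\<Phi> \<xi> - F \<xi>" "F \<xi>"] by (intro mult_right_mono) auto
        also have "\<dots> = ?A * (cmod (m \<xi>) * ?G) + cmod (F \<xi>) * cmod (m \<xi>) * ?G" by (simp add: algebra_simps)
        also have "\<dots> \<le> ?A * ((1 + cmod \<alpha>) * ?G) + cmod (F \<xi>) * cmod (m \<xi>)"
          using G m_le[of \<xi>] by (intro add_mono mult_left_mono mult_right_mono) (auto intro: mult_left_le)
        finally have 1: "cmod (?\<Phi> \<xi> * m \<xi> * complex_of_real ?G) \<le> ?A * ((1 + cmod \<alpha>) * ?G) + cmod (F \<xi>) * cmod (m \<xi>)" .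
        have 2: "?A * ((1 + cmod \<alpha>) * ?G) \<le> 1 / \<epsilon> * ?A\<^sup>2 + \<epsilon> * ((1 + cmod \<alpha>) * ?G)\<^sup>2"
        proof -
          let ?b = "(1 + cmod \<alpha>) * ?G"
          have "0 \<le> (?A - \<epsilon> * ?b)\<^sup>2" by simp
          then have "2 * \<epsilon> * (?A * ?b) \<le> ?A\<^sup>2 + \<epsilon>\<^sup>2 * ?b\<^sup>2" by (simp add: power2_eq_square algebra_simps)
          moreover have "0 \<le> \<epsilon> * (?A * ?b)" using \<epsilon> G by simp
          ultimately have "\<epsilon> * (?A * ?b) \<le> ?A\<^sup>2 + \<epsilon>\<^sup>2 * ?b\<^sup>2" by linarith
          then show ?thesis using \<epsilon> by (simp add: field_simps power2_eq_square)
        qed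
        have 3: "\<epsilon> * ((1 + cmod \<alpha>) * ?G)\<^sup>2 \<le> \<epsilon> * (1 + cmod \<alpha>)\<^sup>2 * ?G"
          using \<epsilon> G2 by (simp add: power_mult_distrib mult_left_mono)
        from 1 2 3 have "cmod (?\<Phi> \<xi> * m \<xi> * complex_of_real ?G) \<le> 1 / \<epsilon> * ?A\<^sup>2 + \<epsilon> * (1 + cmod \<alpha>)\<^sup>2 * ?G + cmod (F \<xi>) * cmod (m \<xi>)"
          by linarith
        then have "ennreal (cmod (?\<Phi> \<xi> * m \<xi> * complex_of_real ?G)) \<le> ennreal (1 / \<epsilon> * ?A\<^sup>2 + \<epsilon> * (1 + cmod \<alpha>)\<^sup>2 * ?G + cmod (F \<xi>) * cmod (m \<xi>))"
          by (rule ennreal_leI)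
        also have "\<dots> = ennreal (1 / \<epsilon>) * ennreal (?A\<^sup>2) + ennreal (\<epsilon> * (1 + cmod \<alpha>)\<^sup>2) * ennreal ?G + ennreal (cmod (F \<xi>) * cmod (m \<xi>))"
          using \<epsilon> G by (intro ennreal_plus_mult) auto
        finally show "ennreal (cmod (?\<Phi> \<xi> * m \<xi> * complex_of_real ?G)) \<le> \<dots>" .
      qed
      also have "\<dots> = ennreal (1 / \<epsilon>) * ?Y (real n) + ennreal (\<epsilon> * (1 + cmod \<alpha>)\<^sup>2) * (\<integral>\<^sup>+ \<xi>. ennreal (gauss (\<eta> *\<^sub>R \<xi>)) \<partial>(lebesgue :: (real^'d) measure)) + ?K"
        by (simp add: nn_integral_add nn_integral_cmult m_def[symmetric])
      also have "\<dots> = ennreal (1 / \<epsilon>) * ?Y (real n) + ennreal (\<epsilon> * B) + ?K"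
        by (simp only: gB)
      finally show ?thesis .
    qed
    have lim: "ennreal (cmod (c *\<^sub>R a \<eta> x - \<alpha> * (c *\<^sub>R a \<eta> y))) \<le> ennreal (\<epsilon> * B) + ?K" if \<epsilon>: "\<epsilon> > 0" for \<epsilon>
    proof (rule LIMSEQ_le)
      show "(\<lambda>n. ennreal (cmod (J n x - \<alpha> * J n y))) \<longlonglongrightarrow> ennreal (cmod (c *\<^sub>R a \<eta> x - \<alpha> * (c *\<^sub>R a \<eta> y)))"
        by (intro tendsto_intros tendsto_ennrealI J_lim)
      have "(\<lambda>n. ennreal (1 / \<epsilon>) * ?Y (real n) + ennreal (\<epsilon> * B) + ?K) \<longlonglongrightarrow> ennreal (1 / \<epsilon>) * 0 + ennreal (\<epsilon> * B) + ?K"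
        by (intro tendsto_add ennreal_tendsto_cmult Y tendsto_const) auto
      then show "(\<lambda>n. ennreal (1 / \<epsilon>) * ?Y (real n) + ennreal (\<epsilon> * B) + ?K) \<longlonglongrightarrow> ennreal (\<epsilon> * B) + ?K"
        by simp
    qed (use step[OF \<epsilon>] in auto)
    have "ennreal (cmod (c *\<^sub>R a \<eta> x - \<alpha> * (c *\<^sub>R a \<eta> y))) \<le> ?K"
    proof (rule ennreal_le_epsilon)
      fix \<epsilon> :: real assume "\<epsilon> > 0"
      \<comment> \<open>Dividing by \<open>B + 1\<close> instead of \<open>B\<close> avoids a case
        distinction on whether \<open>B\<close> vanishes.\<close>
      have "ennreal (cmod (c *\<^sub>R a \<eta> x - \<alpha> * (c *\<^sub>R a \<eta> y))) \<le> ennreal (\<epsilon> / (B + 1) * B) + ?K"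
        using \<open>\<epsilon> > 0\<close> B by (intro lim) auto
      also have "\<dots> \<le> ennreal \<epsilon> + ?K"
        using \<open>\<epsilon> > 0\<close> B by (intro add_right_mono ennreal_leI) (simp add: field_simps)
      finally show "ennreal (cmod (c *\<^sub>R a \<eta> x - \<alpha> * (c *\<^sub>R a \<eta> y))) \<le> ?K + ennreal \<epsilon>"
        by (simp add: add.commute)
    qed
    moreover have "cmod (c *\<^sub>R a \<eta> x - \<alpha> * (c *\<^sub>R a \<eta> y)) = c * cmod (a \<eta> x - \<alpha> * a \<eta> y)"
      by (simp add: c_def flip: scaleR_diff_right)
    ultimately show ?thesis by simp
  qed
  show ?thesis
  proof (rule LIMSEQ_le_const2)
    have "(\<lambda>n. ennreal (c * cmod (a (1 / real (Suc n)) x - \<alpha> * a (1 / real (Suc n)) y)))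
      \<longlonglongrightarrow> ennreal (c * cmod (c *\<^sub>R f x - \<alpha> * (c *\<^sub>R f y)))"
      unfolding a_def c_def by (intro tendsto_intros tendsto_ennrealI gauss_approx_identity f i)
    also have "c * cmod (c *\<^sub>R f x - \<alpha> * (c *\<^sub>R f y)) = c * c * cmod (f x - \<alpha> * f y)"
      by (simp add: c_def flip: scaleR_diff_right)
    finally show "(\<lambda>n. ennreal (c * cmod (a (1 / real (Suc n)) x - \<alpha> * a (1 / real (Suc n)) y)))
      \<longlonglongrightarrow> ennreal ((2 * pi) ^ CARD('d) * cmod (f x - \<alpha> * f y))"
      by (simp only: cc)
    show "\<exists>N. \<forall>n\<ge>N. ennreal (c * cmod (a (1 / real (Suc n)) x - \<alpha> * a (1 / real (Suc n)) y)) \<le> ?K"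
      using smooth by (auto simp del: of_nat_Suc)
  qed
qed

section \<open>Embedding of Sobolev spaces into Hoelder spaces\<close>

text \<open>The supremum \<open>nu2 f\<close> yields an exponent t > \<sigma> with a witness F; its
  weight dominates the one for \<sigma>, and F agrees almost everywhere with
  \<open>fourier_L2 f\<close>. Without integrability the integral in \<open>sobolev_norm\<close>
  would be 0 by default and the norm would bound nothing.\<close>

lemma sobolev_weight_integrable:
  fixes f :: "real^'d \<Rightarrow> complex"
  assumes f: "continuous_on UNIV f" and nu: "nu2 f > ereal \<sigma>"
  shows "has_fourier_L2 f (fourier_L2 f)"
    and "integrable lebesgue (\<lambda>\<xi>. (cmod (fourier_L2 f \<xi>))\<^sup>2 * (1 + (norm \<xi>)\<^sup>2) powr \<sigma>)"
proof -
  from nu obtain t where t: "f \<in> sobolev t" "\<sigma> < t"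
    by (auto simp: nu2_def less_SUP_iff)
  then obtain F where F: "has_fourier_L2 f F"
      and i: "integrable lebesgue (\<lambda>\<xi>. (cmod (F \<xi>))\<^sup>2 * (1 + (norm \<xi>)\<^sup>2) powr t)"
    by (auto simp: sobolev_def)
  show G: "has_fourier_L2 f (fourier_L2 f)"
    unfolding fourier_L2_def by (rule someI[of "has_fourier_L2 f", OF F])
  have [measurable]: "fourier_L2 f \<in> borel_measurable lebesgue"
    using G by (auto simp: has_fourier_L2_def square_integrable_def)
  have [measurable]: "(\<lambda>\<xi>::real^'d. (1 + (norm \<xi>)\<^sup>2) powr \<sigma>) \<in> borel_measurable lebesgue"
    by (rule measurable_completion) measurable
  show "integrable lebesgue (\<lambda>\<xi>. (cmod (fourier_L2 f \<xi>))\<^sup>2 * (1 + (norm \<xi>)\<^sup>2) powr \<sigma>)"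
  proof (rule Bochner_Integration.integrable_bound[OF i])
    show "AE \<xi> in lebesgue. norm ((cmod (fourier_L2 f \<xi>))\<^sup>2 * (1 + (norm \<xi>)\<^sup>2) powr \<sigma>)
        \<le> norm ((cmod (F \<xi>))\<^sup>2 * (1 + (norm \<xi>)\<^sup>2) powr t)"
      using has_fourier_L2_unique[OF f F G]
    proof eventually_elim
      fix \<xi> assume "F \<xi> = fourier_L2 f \<xi>"
      moreover have "(1 + (norm \<xi>)\<^sup>2) powr \<sigma> \<le> (1 + (norm \<xi>)\<^sup>2) powr t"
        using t by (intro powr_mono) auto
      ultimately show "norm ((cmod (fourier_L2 f \<xi>))\<^sup>2 * (1 + (norm \<xi>)\<^sup>2) powr \<sigma>)
        \<le> norm ((cmod (F \<xi>))\<^sup>2 * (1 + (norm \<xi>)\<^sup>2) powr t)"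
        by (simp add: mult_left_mono)
    qed
  qed measurable
qed

lemma sobolev_norm_nonneg: "0 \<le> sobolev_norm \<sigma> f"
  by (simp add: sobolev_norm_def)

text \<open>Cauchy-Schwarz with |F| (1 + |\<xi>|^2) powr (\<sigma> / 2) and (1 + |\<xi>|^2) powr (-
  s / 2); the second factor is square integrable, and the surplus power (\<sigma> - s) / 2 absorbs
  the multiplier. The free coefficient \<alpha> lets one statement give both the sup bound (\<alpha>
  = 0) and the difference bound (\<alpha> = 1).\<close>

lemma sobolev_pointwise_bound:
  assumes s: "s > real CARD('d) / 2"
  obtains H where "H > 0"
    and "\<And>(f :: real^'d \<Rightarrow> complex) x y \<alpha> \<beta>. continuous_on UNIV f \<Longrightarrow> nu2 f > ereal \<sigma> \<Longrightarrow> 0 \<le> \<beta> \<Longrightarrow>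
      (\<And>\<xi>. cmod (exp (\<i> * complex_of_real (x \<bullet> \<xi>)) - \<alpha> * exp (\<i> * complex_of_real (y \<bullet> \<xi>)))
          \<le> \<beta> * (1 + (norm \<xi>)\<^sup>2) powr ((\<sigma> - s) / 2)) \<Longrightarrow>
      cmod (f x - \<alpha> * f y) \<le> H * sobolev_norm \<sigma> f * \<beta>"
proof -
  define W where "W = (LINT \<xi>|(lborel :: (real^'d) measure). (1 + (norm \<xi>)\<^sup>2) powr (- s))"
  have W: "W \<ge> 0" unfolding W_def by simp
  have nnW: "(\<integral>\<^sup>+ \<xi>. ennreal ((1 + (norm \<xi>)\<^sup>2) powr (- s)) \<partial>(lebesgue :: (real^'d) measure)) = ennreal W"
    unfolding W_def nn_integral_completion
    by (rule nn_integral_eq_integral[OF integrable_japanese_bracket[OF s]]) simp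
  define p where "p = (2 * pi) ^ CARD('d)"
  have p: "p > 0" "(2 * pi) powr (- (real CARD('d) / 2)) = 1 / sqrt p"
  proof -
    show "p > 0" by (simp add: p_def)
    have "sqrt p = (2 * pi) powr (real CARD('d) / 2)"
    proof -
      have "p = (2 * pi) powr real CARD('d)" by (simp add: p_def powr_realpow del: powr_mult)
      then show ?thesis by (simp only: powr_half_sqrt[symmetric] powr_powr powr_ge_zero) simp
    qed
    then show "(2 * pi) powr (- (real CARD('d) / 2)) = 1 / sqrt p"
      by (simp add: powr_minus_divide)
  qed
  show thesis
  \<comment> \<open>The added 1 makes the constant positive without an argument that
    \<open>W\<close> is. Of the factor \<open>p\<close> of the inversion, one \<open>sqrt p\<close>
    is absorbed by the normalisation of the Sobolev norm.\<close>
  proof (rule that[of "(1 + sqrt W) / sqrt p"])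
    show "0 < (1 + sqrt W) / sqrt p" using W p by (simp add: add_pos_nonneg)
    fix f :: "real^'d \<Rightarrow> complex" and x y :: "real^'d" and \<alpha> :: complex and \<beta> :: real
    assume f: "continuous_on UNIV f" and nu: "nu2 f > ereal \<sigma>" and \<beta>: "0 \<le> \<beta>"
      and le: "\<And>\<xi>. cmod (exp (\<i> * complex_of_real (x \<bullet> \<xi>)) - \<alpha> * exp (\<i> * complex_of_real (y \<bullet> \<xi>)))
          \<le> \<beta> * (1 + (norm \<xi>)\<^sup>2) powr ((\<sigma> - s) / 2)"
    define F where "F = fourier_L2 f"
    have F: "has_fourier_L2 f F" and i: "integrable lebesgue (\<lambda>\<xi>. (cmod (F \<xi>))\<^sup>2 * (1 + (norm \<xi>)\<^sup>2) powr \<sigma>)"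
      using sobolev_weight_integrable[OF f nu] by (auto simp: F_def)
    have [measurable]: "F \<in> borel_measurable lebesgue"
      using F by (auto simp: has_fourier_L2_def square_integrable_def)
    have [measurable]: "(\<lambda>\<xi>::real^'d. (1 + (norm \<xi>)\<^sup>2) powr t) \<in> borel_measurable lebesgue" for t
      by (rule measurable_completion) measurable
    define Q where "Q = (LINT \<xi>|lebesgue. (cmod (F \<xi>))\<^sup>2 * (1 + (norm \<xi>)\<^sup>2) powr \<sigma>)"
    have Q: "Q \<ge> 0" unfolding Q_def by simp
    have S: "sobolev_norm \<sigma> f = sqrt Q / sqrt p"
      unfolding sobolev_norm_def p(2) Q_def F_def by simp
    let ?u = "\<lambda>\<xi>::real^'d. cmod (F \<xi>) * (1 + (norm \<xi>)\<^sup>2) powr (\<sigma> / 2)"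
    let ?v = "\<lambda>\<xi>::real^'d. (1 + (norm \<xi>)\<^sup>2) powr (- s / 2)"
    have pos: "0 < 1 + (norm \<xi>)\<^sup>2" for \<xi> :: "real^'d" by (simp add: add_pos_nonneg)
    have u2: "(?u \<xi>)\<^sup>2 = (cmod (F \<xi>))\<^sup>2 * (1 + (norm \<xi>)\<^sup>2) powr \<sigma>" for \<xi>
      using pos[of \<xi>] by (simp add: power_mult_distrib power2_eq_square flip: powr_add)
    have v2: "(?v \<xi>)\<^sup>2 = (1 + (norm \<xi>)\<^sup>2) powr (- s)" for \<xi>
      using pos[of \<xi>] by (simp add: power2_eq_square flip: powr_add)
    define X where "X = (\<integral>\<^sup>+ \<xi>. ennreal (?u \<xi>) * ennreal (?v \<xi>) \<partial>lebesgue)"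
    have "X\<^sup>2 \<le> (\<integral>\<^sup>+ \<xi>. (ennreal (?u \<xi>))\<^sup>2 \<partial>lebesgue) * (\<integral>\<^sup>+ \<xi>. (ennreal (?v \<xi>))\<^sup>2 \<partial>lebesgue)"
      unfolding X_def by (rule Cauchy_Schwarz_nn_integral) measurable
    also have "(\<integral>\<^sup>+ \<xi>. (ennreal (?u \<xi>))\<^sup>2 \<partial>lebesgue) = ennreal Q"
      unfolding Q_def nn_integral_eq_integral[OF i, symmetric, simplified]
      by (simp add: ennreal_power u2)
    also have "(\<integral>\<^sup>+ \<xi>. (ennreal (?v \<xi>))\<^sup>2 \<partial>lebesgue) = ennreal W"
      by (simp only: ennreal_power powr_ge_zero v2 nnW)
    finally have X2: "X\<^sup>2 \<le> ennreal (Q * W)" using Q by (simp add: ennreal_mult')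
    have X: "X \<le> ennreal (sqrt (Q * W))"
    proof (cases X)
      case (real r)
      then have "r\<^sup>2 \<le> Q * W" using X2 Q W by (simp add: ennreal_power ennreal_le_iff)
      then show ?thesis using real by (auto intro!: ennreal_leI real_le_rsqrt)
    next
      case top
      then show ?thesis using X2 by (simp add: power2_eq_square top_unique)
    qed
    have "ennreal (p * cmod (f x - \<alpha> * f y)) \<le> (\<integral>\<^sup>+ \<xi>. ennreal (cmod (F \<xi>) *
        cmod (exp (\<i> * complex_of_real (x \<bullet> \<xi>)) - \<alpha> * exp (\<i> * complex_of_real (y \<bullet> \<xi>)))) \<partial>lebesgue)"
      unfolding p_def by (rule fourier_L2_pointwise_bound[OF f F])
    also have "\<dots> \<le> (\<integral>\<^sup>+ \<xi>. ennreal \<beta> * (ennreal (?u \<xi>) * ennreal (?v \<xi>)) \<partial>lebesgue)"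
    proof (rule nn_integral_mono)
      fix \<xi> :: "real^'d"
      have "cmod (F \<xi>) * cmod (exp (\<i> * complex_of_real (x \<bullet> \<xi>)) - \<alpha> * exp (\<i> * complex_of_real (y \<bullet> \<xi>)))
          \<le> cmod (F \<xi>) * (\<beta> * (1 + (norm \<xi>)\<^sup>2) powr ((\<sigma> - s) / 2))"
        by (intro mult_left_mono le) auto
      also have "(1 + (norm \<xi>)\<^sup>2) powr ((\<sigma> - s) / 2) = (1 + (norm \<xi>)\<^sup>2) powr (\<sigma> / 2) * ?v \<xi>"
        by (simp add: diff_divide_distrib flip: powr_add)
      finally have "cmod (F \<xi>) * cmod (exp (\<i> * complex_of_real (x \<bullet> \<xi>)) - \<alpha> * exp (\<i> * complex_of_real (y \<bullet> \<xi>)))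
          \<le> \<beta> * (?u \<xi> * ?v \<xi>)" by (simp add: mult_ac)
      then have "ennreal (cmod (F \<xi>) * cmod (exp (\<i> * complex_of_real (x \<bullet> \<xi>)) - \<alpha> * exp (\<i> * complex_of_real (y \<bullet> \<xi>))))
          \<le> ennreal (\<beta> * (?u \<xi> * ?v \<xi>))" by (rule ennreal_leI)
      also have "\<dots> = ennreal \<beta> * (ennreal (?u \<xi>) * ennreal (?v \<xi>))"
        using \<beta> by (subst ennreal_mult, simp, simp, subst ennreal_mult, simp_all)
      finally show "ennreal (cmod (F \<xi>) * cmod (exp (\<i> * complex_of_real (x \<bullet> \<xi>)) - \<alpha> * exp (\<i> * complex_of_real (y \<bullet> \<xi>))))
          \<le> ennreal \<beta> * (ennreal (?u \<xi>) * ennreal (?v \<xi>))" .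
    qed
    also have "\<dots> = ennreal \<beta> * X"
      unfolding X_def by (rule nn_integral_cmult) measurable
    also have "\<dots> \<le> ennreal \<beta> * ennreal (sqrt (Q * W))"
      by (intro mult_left_mono X) simp
    also have "\<dots> = ennreal (\<beta> * sqrt (Q * W))" using \<beta> by (simp add: ennreal_mult')
    finally have "p * cmod (f x - \<alpha> * f y) \<le> \<beta> * sqrt (Q * W)"
      using \<beta> Q W by (subst (asm) ennreal_le_iff) auto
    also have "\<dots> \<le> \<beta> * (sqrt Q * (1 + sqrt W))"
      using \<beta> Q by (intro mult_left_mono) (auto simp: real_sqrt_mult intro!: mult_left_mono)
    finally have "cmod (f x - \<alpha> * f y) \<le> \<beta> * (sqrt Q * (1 + sqrt W)) / p"
      using p by (simp add: field_simps)
    also have "\<dots> = (1 + sqrt W) / sqrt p * sobolev_norm \<sigma> f * \<beta>"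
      unfolding S using p(1) by (simp add: field_simps)
    finally show "cmod (f x - \<alpha> * f y) \<le> (1 + sqrt W) / sqrt p * sobolev_norm \<sigma> f * \<beta>" .
  qed
qed

text \<open>Interpolation between the trivial bound 2 and the Lipschitz bound |a - b|, according to
  whether |a - b| exceeds 1.\<close>

lemma cis_diff_le:
  assumes "0 < \<zeta>" "\<zeta> \<le> 1"
  shows "cmod (exp (\<i> * complex_of_real a) - exp (\<i> * complex_of_real b)) \<le> 2 * \<bar>a - b\<bar> powr \<zeta>"
proof -
  have le2: "cmod (exp (\<i> * complex_of_real a) - exp (\<i> * complex_of_real b)) \<le> 2"
    by (rule order_trans[OF norm_triangle_ineq4]) simp
  have le1: "cmod (exp (\<i> * complex_of_real a) - exp (\<i> * complex_of_real b)) \<le> \<bar>a - b\<bar>"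
  proof -
    have "exp (\<i> * complex_of_real a) - exp (\<i> * complex_of_real b)
        = exp (\<i> * complex_of_real b) * (exp (\<i> * complex_of_real (a - b)) - 1)"
      by (simp add: algebra_simps flip: exp_add)
    then have "cmod (exp (\<i> * complex_of_real a) - exp (\<i> * complex_of_real b)) = cmod (exp (\<i> * complex_of_real (a - b)) - 1)"
      by (simp add: norm_mult)
    also have "\<dots> \<le> \<bar>a - b\<bar>" using iexp_approx1[of "a - b" 0] by simp
    finally show ?thesis .
  qed
  show ?thesis
  proof (cases "\<bar>a - b\<bar> \<le> 1")
    case True
    have "\<bar>a - b\<bar> = \<bar>a - b\<bar> powr 1" by simp
    also have "\<dots> \<le> \<bar>a - b\<bar> powr \<zeta>" using True assms
      by (intro powr_mono') auto
    finally show ?thesis using le1 by linarith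
  next
    case False
    then have "1 \<le> \<bar>a - b\<bar> powr \<zeta>" using assms by (intro ge_one_powr_ge_zero) auto
    then show ?thesis using le2 by linarith
  qed
qed

text \<open>The multiplier difference is at most 2 (|x - y| |\<xi>|) powr \<zeta>, and |\<xi>| powr
  \<zeta> is absorbed by the surplus weight because \<zeta> \<le> \<sigma> - s.\<close>

lemma sobolev_holder:
  assumes s: "s > real CARD('d) / 2" and \<zeta>: "0 < \<zeta>" "\<zeta> \<le> 1" "\<zeta> \<le> \<sigma> - s"
  shows "\<exists>H>0. \<forall>f :: real^'d \<Rightarrow> complex. continuous_on UNIV f \<longrightarrow> nu2 f > ereal \<sigma> \<longrightarrow>
    (\<forall>x. cmod (f x) \<le> H * sobolev_norm \<sigma> f) \<and>
    (\<forall>x y. cmod (f x - f y) \<le> H * sobolev_norm \<sigma> f * norm (x - y) powr \<zeta>)"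
proof -
  from sobolev_pointwise_bound[OF s, of \<sigma>] obtain H where H: "H > 0"
    and b: "\<And>(f :: real^'d \<Rightarrow> complex) x y \<alpha> \<beta>. continuous_on UNIV f \<Longrightarrow> nu2 f > ereal \<sigma> \<Longrightarrow> 0 \<le> \<beta> \<Longrightarrow>
      (\<And>\<xi>. cmod (exp (\<i> * complex_of_real (x \<bullet> \<xi>)) - \<alpha> * exp (\<i> * complex_of_real (y \<bullet> \<xi>)))
          \<le> \<beta> * (1 + (norm \<xi>)\<^sup>2) powr ((\<sigma> - s) / 2)) \<Longrightarrow>
      cmod (f x - \<alpha> * f y) \<le> H * sobolev_norm \<sigma> f * \<beta>" by blast
  show ?thesis
  proof (rule exI[of _ "2 * H"], intro conjI allI impI)
    show "0 < 2 * H" using H by simp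
    fix f :: "real^'d \<Rightarrow> complex" and x y :: "real^'d"
    assume f: "continuous_on UNIV f" "nu2 f > ereal \<sigma>"
    have "cmod (f x - 0 * f x) \<le> H * sobolev_norm \<sigma> f * 1"
      using \<zeta> by (intro b f) (auto intro!: ge_one_powr_ge_zero)
    also have "\<dots> \<le> 2 * H * sobolev_norm \<sigma> f"
      using H sobolev_norm_nonneg[of \<sigma> f] by simp
    finally show "cmod (f x) \<le> 2 * H * sobolev_norm \<sigma> f" by simp
    have "cmod (f x - 1 * f y) \<le> H * sobolev_norm \<sigma> f * (2 * norm (x - y) powr \<zeta>)"
    proof (rule b[OF f])
      fix \<xi> :: "real^'d"
      have "cmod (exp (\<i> * complex_of_real (x \<bullet> \<xi>)) - exp (\<i> * complex_of_real (y \<bullet> \<xi>)))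
          \<le> 2 * \<bar>x \<bullet> \<xi> - y \<bullet> \<xi>\<bar> powr \<zeta>" by (rule cis_diff_le[OF \<zeta>(1,2)])
      also have "\<bar>x \<bullet> \<xi> - y \<bullet> \<xi>\<bar> powr \<zeta> \<le> (norm (x - y) * norm \<xi>) powr \<zeta>"
        using \<zeta> Cauchy_Schwarz_ineq2[of "x - y" \<xi>] by (intro powr_mono2) (auto simp: inner_diff_left)
      also have "\<dots> = norm (x - y) powr \<zeta> * norm \<xi> powr \<zeta>" by (simp add: powr_mult)
      also have "norm \<xi> powr \<zeta> \<le> (1 + (norm \<xi>)\<^sup>2) powr ((\<sigma> - s) / 2)"
      proof -
        have "norm \<xi> = ((norm \<xi>)\<^sup>2) powr (1 / 2)" by (simp add: powr_half_sqrt)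
        also have "\<dots> \<le> (1 + (norm \<xi>)\<^sup>2) powr (1 / 2)" by (intro powr_mono2) auto
        finally have "norm \<xi> powr \<zeta> \<le> ((1 + (norm \<xi>)\<^sup>2) powr (1 / 2)) powr \<zeta>"
          using \<zeta> by (intro powr_mono2) auto
        also have "\<dots> = (1 + (norm \<xi>)\<^sup>2) powr (\<zeta> / 2)" by (simp add: powr_powr)
        also have "\<dots> \<le> (1 + (norm \<xi>)\<^sup>2) powr ((\<sigma> - s) / 2)"
          using \<zeta> by (intro powr_mono) auto
        finally show ?thesis .
      qed
      finally show "cmod (exp (\<i> * complex_of_real (x \<bullet> \<xi>)) - 1 * exp (\<i> * complex_of_real (y \<bullet> \<xi>)))
          \<le> 2 * norm (x - y) powr \<zeta> * (1 + (norm \<xi>)\<^sup>2) powr ((\<sigma> - s) / 2)"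
        by (simp add: mult_left_mono mult.assoc)
    qed simp
    then show "cmod (f x - f y) \<le> 2 * H * sobolev_norm \<sigma> f * norm (x - y) powr \<zeta>"
      by (simp add: mult_ac)
  qed
qed

section \<open>Partition of unity\<close>

lemma int_lattice_add: "j \<in> int_lattice \<Longrightarrow> k \<in> int_lattice \<Longrightarrow> j + k \<in> int_lattice"
  and int_lattice_minus: "k \<in> int_lattice \<Longrightarrow> - k \<in> int_lattice"
  and int_lattice_0: "0 \<in> int_lattice"
  and int_lattice_axis: "axis l 1 \<in> int_lattice"
  by (auto simp: int_lattice_def axis_def)

lemma int_lattice_diff: "j \<in> int_lattice \<Longrightarrow> k \<in> int_lattice \<Longrightarrow> j - k \<in> int_lattice"
  using int_lattice_add[OF _ int_lattice_minus, of j k] by simp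

lemma int_lattice_eqI:
  assumes "j \<in> int_lattice" "k \<in> int_lattice" "\<And>l. \<bar>j $ l - k $ l\<bar> < 1"
  shows "j = k"
proof (rule vec_eq_iff[THEN iffD2], rule allI)
  fix l
  have "j $ l - k $ l \<in> \<int>" using assms(1,2) by (auto simp: int_lattice_def)
  then obtain z where z: "j $ l - k $ l = of_int z" by (elim Ints_cases)
  then have "real_of_int \<bar>z\<bar> < 1" using assms(3)[of l] by simp
  then have "z = 0" by linarith
  then show "j $ l = k $ l" using z by simp
qed

lemma finite_int_lattice_bounded:
  fixes S :: "(real^'d) set"
  assumes "bounded S"
  shows "finite (S \<inter> int_lattice)"
proof -
  obtain B where B: "\<And>x. x \<in> S \<Longrightarrow> norm x \<le> B" using assms by (auto simp: bounded_iff)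
  have "S \<inter> int_lattice \<subseteq> (\<lambda>c. \<chi> l. real_of_int (c l)) ` (PiE UNIV (\<lambda>_. {- \<lceil>B\<rceil>..\<lceil>B\<rceil>}))"
  proof
    fix k assume k: "k \<in> S \<inter> int_lattice"
    have "k = (\<chi> l. real_of_int \<lfloor>k $ l\<rfloor>)"
      using k by (auto simp: int_lattice_def vec_eq_iff)
    moreover have "(\<lambda>l. \<lfloor>k $ l\<rfloor>) \<in> PiE UNIV (\<lambda>_. {- \<lceil>B\<rceil>..\<lceil>B\<rceil>})"
    proof (rule PiE_I)
      fix l
      have "\<bar>k $ l\<bar> \<le> B" using component_le_norm_cart[of k l] B[of k] k by auto
      then show "\<lfloor>k $ l\<rfloor> \<in> {- \<lceil>B\<rceil>..\<lceil>B\<rceil>}" by simp linarith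
    qed auto
    ultimately show "k \<in> (\<lambda>c. \<chi> l. real_of_int (c l)) ` (PiE UNIV (\<lambda>_. {- \<lceil>B\<rceil>..\<lceil>B\<rceil>}))"
      by (rule image_eqI)
  qed
  then show ?thesis by (rule finite_subset) (intro finite_imageI finite_PiE; simp)
qed

section \<open>Zeros of the Fourier transform on the dual lattice\<close>

lemma fourier_continuous:
  fixes f :: "real^'d \<Rightarrow> complex"
  assumes f: "integrable lborel f"
  shows "continuous_on UNIV (fourier f)"
proof (rule continuous_at_imp_continuous_on, rule ballI)
  fix \<xi> :: "real^'d"
  have [measurable]: "f \<in> borel_measurable borel" using f by auto
  show "isCont (fourier f) \<xi>"
    unfolding continuous_at_sequentially comp_def
  proof (intro allI impI)
    fix X assume X: "X \<longlonglongrightarrow> \<xi>"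
    have "(\<lambda>n. LINT x|lborel. f x * exp (- (\<i> * complex_of_real (x \<bullet> X n))))
        \<longlonglongrightarrow> (LINT x|lborel. f x * exp (- (\<i> * complex_of_real (x \<bullet> \<xi>))))"
    proof (rule integral_dominated_convergence[OF _ _ integrable_norm[OF f]])
      show "AE x in lborel. (\<lambda>n. f x * exp (- (\<i> * complex_of_real (x \<bullet> X n))))
          \<longlonglongrightarrow> f x * exp (- (\<i> * complex_of_real (x \<bullet> \<xi>)))"
        by (intro AE_I2 tendsto_intros X)
    qed (auto simp: norm_mult)
    then show "(\<lambda>n. fourier f (X n)) \<longlonglongrightarrow> fourier f \<xi>"
      by (simp add: fourier_lborel)
  qed
qed

text \<open>The sum rule controls the mask only in a punctured neighbourhood of 2 \<pi> g. Hence the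
  refinement equation is not evaluated there but passed to the limit, with continuity of
  \<open>fourier f\<close> on both sides; the positive exponent n + 1 sends the mask to 0.\<close>

lemma fourier_vanishes_at_sum_rule:
  assumes f: "integrable lborel f" and ref: "refinable f a" and sr: "has_sum_rules a (n + 1)"
    and g: "2 *\<^sub>R g \<in> int_lattice" "g \<notin> int_lattice"
  shows "fourier f ((4 * pi) *\<^sub>R g) = 0"
proof -
  note c = fourier_continuous[OF f, THEN continuous_on_eq_continuous_at[OF open_UNIV, THEN iffD1], rule_format, OF UNIV_I]
  let ?p = "(2 * pi) *\<^sub>R g"
  have "(\<lambda>\<xi>. a (\<xi> + ?p)) \<in> O[at 0](\<lambda>\<xi>. complex_of_real (norm \<xi> ^ (n + 1)))"
    using sr g unfolding has_sum_rules_def by blast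
  then obtain K where K: "eventually (\<lambda>\<xi>. norm (a (\<xi> + ?p)) \<le> K * norm (complex_of_real (norm \<xi> ^ (n + 1)))) (at 0)"
    by (elim landau_o.bigE)
  have "((\<lambda>\<xi>. a (\<xi> + ?p)) \<longlongrightarrow> 0) (at 0)"
  proof (rule Lim_null_comparison[OF K])
    have "((\<lambda>\<xi>::real^'a. norm \<xi>) \<longlongrightarrow> 0) (at 0)"
      by (rule tendsto_norm_zero) (rule tendsto_ident_at)
    from tendsto_mult[OF tendsto_const[of K] tendsto_power[OF this, of "n + 1"]]
    show "((\<lambda>\<xi> :: real^'a. K * norm (complex_of_real (norm \<xi> ^ (n + 1)))) \<longlongrightarrow> 0) (at 0)"
      by (simp add: norm_mult norm_power)
  qed
  moreover have "((\<lambda>\<xi>. fourier f (\<xi> + ?p)) \<longlongrightarrow> fourier f (0 + ?p)) (at 0)"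
    by (intro isCont_tendsto_compose[OF c] tendsto_intros)
  ultimately have "((\<lambda>\<xi>. a (\<xi> + ?p) * fourier f (\<xi> + ?p)) \<longlongrightarrow> 0 * fourier f (0 + ?p)) (at 0)"
    by (rule tendsto_mult)
  moreover have "a (\<xi> + ?p) * fourier f (\<xi> + ?p) = fourier f (2 *\<^sub>R (\<xi> + ?p))" for \<xi>
    using ref by (simp add: refinable_def)
  ultimately have "((\<lambda>\<xi>. fourier f (2 *\<^sub>R (\<xi> + ?p))) \<longlongrightarrow> 0) (at 0)" by simp
  moreover have "((\<lambda>\<xi>. fourier f (2 *\<^sub>R (\<xi> + ?p))) \<longlongrightarrow> fourier f (2 *\<^sub>R (0 + ?p))) (at 0)"
    by (intro isCont_tendsto_compose[OF c] tendsto_intros)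
  ultimately have "fourier f (2 *\<^sub>R (0 + ?p)) = 0"
    by (intro tendsto_unique[OF _ _ _]) auto
  then show ?thesis by simp
qed

text \<open>Descent by halving. If k / 2 is off the lattice, the sum rule applies at it; otherwise
  the refinement equation carries a zero at 2 \<pi> (k / 2) to 2 \<pi> k. The dyadic size of k drops
  each time, and norm below 1 forces k = 0.\<close>

lemma fourier_vanishes_on_dual_lattice:
  fixes f :: "real^'d \<Rightarrow> complex"
  assumes f: "integrable lborel f" and ref: "refinable f a" and sr: "has_sum_rules a (n + 1)"
    and k: "k \<in> int_lattice" "k \<noteq> 0"
  shows "fourier f ((2 * pi) *\<^sub>R k) = 0"
proof -
  have "fourier f ((2 * pi) *\<^sub>R k) = 0" if "norm k < 2 ^ j" "k \<in> int_lattice" "k \<noteq> 0" for j and k :: "real^'d"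
    using that
  proof (induction j arbitrary: k)
    case 0
    have "k = 0"
    proof (rule int_lattice_eqI[OF 0(2) int_lattice_0])
      fix l show "\<bar>k $ l - 0 $ l\<bar> < 1" using component_le_norm_cart[of k l] 0(1) by simp
    qed
    with 0 show ?case by simp
  next
    case (Suc j)
    define h where "h = (1/2) *\<^sub>R k"
    have kh: "k = 2 *\<^sub>R h" by (simp add: h_def)
    show ?case
    proof (cases "h \<in> int_lattice")
      case False
      then show ?thesis
        using fourier_vanishes_at_sum_rule[OF f ref sr, of h] Suc.prems by (simp add: kh mult.commute)
    next
      case True
      have "fourier f (2 *\<^sub>R ((2 * pi) *\<^sub>R h)) = a ((2 * pi) *\<^sub>R h) * fourier f ((2 * pi) *\<^sub>R h)"
        using ref unfolding refinable_def by blast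
      moreover have "fourier f ((2 * pi) *\<^sub>R h) = 0"
        using Suc.prems True by (intro Suc.IH) (auto simp: kh)
      ultimately show ?thesis by (simp add: kh mult.commute)
    qed
  qed
  moreover obtain j where "norm k < 2 ^ j" using real_arch_pow[of 2 "norm k"] by auto
  ultimately show ?thesis using k by blast
qed

section \<open>Characters of the torus\<close>

text \<open>Spelled exactly as the kernel of \<open>fourier\<close> at the frequency 2 \<pi> j, so
  that Fourier coefficients and Fourier integrals match without rewriting.\<close>

abbreviation wave :: "real^'d \<Rightarrow> real^'d \<Rightarrow> complex" where
  "wave j x \<equiv> exp (- (\<i> * complex_of_real (x \<bullet> ((2 * pi) *\<^sub>R j))))"

lemma wave_add: "wave (j + k) x = wave j x * wave k x"
  by (simp add: inner_add_right algebra_simps exp_add exp_diff exp_minus divide_simps)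

lemma exp_int_2pi: "x \<in> \<int> \<Longrightarrow> exp (- (\<i> * complex_of_real (2 * pi * x))) = 1"
proof -
  assume "x \<in> \<int>"
  then obtain z where "x = of_int z" by (elim Ints_cases)
  then show ?thesis unfolding exp_eq_1 by (auto intro!: exI[of _ "- z"])
qed

lemma inner_int_lattice: "j \<in> int_lattice \<Longrightarrow> k \<in> int_lattice \<Longrightarrow> j \<bullet> k \<in> \<int>"
  by (auto simp: int_lattice_def inner_vec_def intro!: Ints_sum Ints_mult)

lemma wave_periodic:
  assumes "j \<in> int_lattice" "k \<in> int_lattice"
  shows "wave j (x - k) = wave j x"
proof -
  have "wave j (x - k) = wave j x / exp (- (\<i> * complex_of_real (2 * pi * (k \<bullet> j))))"
    by (simp add: inner_diff_left algebra_simps flip: exp_diff)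
  then show ?thesis using exp_int_2pi[OF inner_int_lattice[OF assms(2,1)]] by simp
qed

lemma integral_wave_1d:
  assumes "n \<in> \<int>" "n \<noteq> 0"
  shows "((\<lambda>t. exp (- (\<i> * complex_of_real (t * (2 * pi * n))))) has_integral 0) {0..1}"
proof -
  define c where "c = - (\<i> * complex_of_real (2 * pi * n))"
  have c: "c \<noteq> 0" using assms by (simp add: c_def)
  have "((\<lambda>t. exp (of_real t * c)) has_integral (exp (of_real 1 * c) / c - exp (of_real 0 * c) / c)) {0..1}"
  proof (rule fundamental_theorem_of_calculus)
    fix t :: real
    show "((\<lambda>t. exp (of_real t * c) / c) has_vector_derivative exp (of_real t * c)) (at t within {0..1})"
      using c by (auto intro!: derivative_eq_intros has_vector_derivative_real_field)
  qed simp
  moreover have "exp c = 1" unfolding c_def using assms by (intro exp_int_2pi)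
  ultimately have "((\<lambda>t. exp (of_real t * c)) has_integral 0) {0..1}" by simp
  then show ?thesis by (simp add: c_def algebra_simps)
qed

lemma cbox_vec_01: "x \<in> cbox 0 (1::real^'d) \<longleftrightarrow> (\<forall>l. x $ l \<in> {0..1})"
  by (auto simp: mem_box_cart)

text \<open>With the indicator of the cube the integrand splits over the coordinates, and a nonzero
  coordinate of j contributes a vanishing factor.\<close>

lemma integral_wave:
  fixes j :: "real^'d"
  assumes j: "j \<in> int_lattice" "j \<noteq> 0"
  shows "integral (cbox 0 1) (wave j) = 0"
proof -
  obtain m where m: "j $ m \<noteq> 0" using j by (auto simp: vec_eq_iff)
  let ?h = "\<lambda>l t. indicator {0..1} t *\<^sub>R exp (- (\<i> * complex_of_real (t * (2 * pi * j $ l))))"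
  have i: "set_integrable lborel {0..1} (\<lambda>t. exp (- (\<i> * complex_of_real (t * (2 * pi * j $ l)))))" for l
    unfolding set_integrable_def by (rule borel_integrable_compact) (auto intro!: continuous_intros)
  have i': "integrable lborel (?h l)" for l using i[of l] by (simp add: set_integrable_def)
  have prod: "indicator (cbox 0 1) x *\<^sub>R wave j x = (\<Prod>l\<in>UNIV. ?h l (x $ l))" for x
  proof (cases "x \<in> cbox 0 1")
    case True
    then have "\<And>l. x $ l \<in> {0..1}" by (simp only: cbox_vec_01)
    then show ?thesis using True
      by (simp add: inner_vec_def exp_sum sum_distrib_left flip: sum_negf)
  next
    case False
    then obtain l where "x $ l \<notin> {0..1}" by (auto simp only: cbox_vec_01)
    then have "(\<Prod>l\<in>UNIV. ?h l (x $ l)) = 0" by (intro prod_zero) (auto intro!: exI[of _ l])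
    then show ?thesis using False by simp
  qed
  have "set_integrable lborel (cbox 0 1) (wave j)"
    unfolding set_integrable_def by (rule borel_integrable_compact) (auto intro!: continuous_intros)
  from set_borel_integral_eq_integral(2)[OF this]
  have "integral (cbox 0 1) (wave j) = (LINT x|lborel. indicator (cbox 0 1) x *\<^sub>R wave j x)"
    by (simp add: set_lebesgue_integral_def)
  also have "\<dots> = (\<Prod>l\<in>UNIV. (LINT t|lborel. ?h l t))"
    unfolding prod by (rule integral_prod_components[OF i'])
  also have "\<dots> = 0"
  proof (rule prod_zero)
    have "(LINT t|lborel. ?h m t) = integral {0..1} (\<lambda>t. exp (- (\<i> * complex_of_real (t * (2 * pi * j $ m)))))"
      using set_borel_integral_eq_integral(2)[OF i[of m]] by (simp add: set_lebesgue_integral_def)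
    also have "\<dots> = 0"
      using j m by (intro integral_unique integral_wave_1d) (auto simp: int_lattice_def)
    finally show "\<exists>l\<in>UNIV. (LINT t|lborel. ?h l t) = 0" by blast
  qed simp
  finally show ?thesis .
qed

section \<open>Periodization and its Fourier coefficients\<close>

text \<open>Restricted to the nonzero terms, the sum is finite for f of bounded support; over the
  whole lattice, an infinite set, \<open>sum\<close> would be 0 by default.\<close>

definition periodization :: "(real^'d \<Rightarrow> complex) \<Rightarrow> real^'d \<Rightarrow> complex" where
  "periodization f x = (\<Sum>k\<in>{k\<in>int_lattice. f (x - k) \<noteq> 0}. f (x - k))"

context
  fixes f :: "real^'d \<Rightarrow> complex" and M :: "real^'d"
  assumes cont: "continuous_on UNIV f" and supp: "\<And>x. f x \<noteq> 0 \<Longrightarrow> x \<in> cbox 0 M"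
begin

lemma periodization_finite:
  assumes "bounded S"
  shows "finite {k \<in> int_lattice. \<exists>x\<in>S. x - k \<in> cbox 0 M}"
proof -
  have "{k. \<exists>x\<in>S. x - k \<in> cbox 0 M} \<subseteq> {x - y | x y. x \<in> S \<and> y \<in> cbox 0 M}"
  proof safe
    fix k x assume "x \<in> S" "x - k \<in> cbox 0 M"
    then show "\<exists>x' y. k = x' - y \<and> x' \<in> S \<and> y \<in> cbox 0 M"
      by (intro exI[of _ x] exI[of _ "x - k"]) simp
  qed
  moreover have "bounded {x - y | x y. x \<in> S \<and> y \<in> cbox 0 M}"
  proof -
    obtain A B where "\<And>x. x \<in> S \<Longrightarrow> norm x \<le> A" "\<And>y. y \<in> cbox 0 M \<Longrightarrow> norm y \<le> B"
      using assms bounded_cbox[of 0 M] by (auto simp: bounded_iff)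
    then have "norm (x - y) \<le> A + B" if "x \<in> S" "y \<in> cbox 0 M" for x y
      using norm_triangle_ineq4[of x y] that by (meson add_mono order_trans)
    then show ?thesis unfolding bounded_iff by blast
  qed
  ultimately have "finite ({k. \<exists>x\<in>S. x - k \<in> cbox 0 M} \<inter> int_lattice)"
    by (intro finite_int_lattice_bounded) (rule bounded_subset)
  then show ?thesis by (rule finite_subset[rotated]) auto
qed

lemma periodization_eq:
  assumes "finite K" "K \<subseteq> int_lattice" "\<And>k. k \<in> int_lattice \<Longrightarrow> f (x - k) \<noteq> 0 \<Longrightarrow> k \<in> K"
  shows "periodization f x = (\<Sum>k\<in>K. f (x - k))"
  unfolding periodization_def by (rule sum.mono_neutral_left) (use assms in auto)

text \<open>A single index set for all points of S reduces continuity of the periodization to that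
  of a finite sum.\<close>

lemma periodization_eq_on_bounded:
  assumes "bounded S"
  obtains K where "finite K" "K \<subseteq> int_lattice" "\<And>x. x \<in> S \<Longrightarrow> periodization f x = (\<Sum>k\<in>K. f (x - k))"
proof (rule that)
  let ?K = "{k \<in> int_lattice. \<exists>x\<in>S. x - k \<in> cbox 0 M}"
  show "finite ?K" by (rule periodization_finite[OF assms])
  show "periodization f x = (\<Sum>k\<in>?K. f (x - k))" if "x \<in> S" for x
    by (rule periodization_eq[OF periodization_finite[OF assms]]) (use that supp in blast)+
qed auto

lemma periodization_continuous: "continuous_on UNIV (periodization f)"
proof (rule continuous_at_imp_continuous_on, rule ballI)
  fix x :: "real^'d"
  obtain K where K: "\<And>y. y \<in> ball x 1 \<Longrightarrow> periodization f y = (\<Sum>k\<in>K. f (y - k))"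
    by (rule periodization_eq_on_bounded[of "ball x 1"]) auto
  have "continuous_on (ball x 1) (\<lambda>y. \<Sum>k\<in>K. f (y - k))"
    by (intro continuous_intros continuous_on_compose2[OF cont]) auto
  then have "continuous_on (ball x 1) (periodization f)"
    by (rule continuous_on_eq) (simp add: K)
  then show "isCont (periodization f) x"
    by (simp add: continuous_on_eq_continuous_at)
qed

lemma periodization_periodic:
  assumes "j \<in> int_lattice"
  shows "periodization f (x + j) = periodization f x"
  unfolding periodization_def
  by (rule sum.reindex_bij_witness[of _ "\<lambda>k. k + j" "\<lambda>k. k - j"])
    (use assms in \<open>auto intro: int_lattice_add int_lattice_diff simp: algebra_simps\<close>)

text \<open>Unfolding, as in Poisson summation: lattice shifts leave the character unchanged, and
  the shifted cubes tile the support of f.\<close>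

lemma integral_periodization_wave:
  assumes j: "j \<in> int_lattice"
  shows "integral (cbox 0 1) (\<lambda>x. periodization f x * wave j x) = fourier f ((2 * pi) *\<^sub>R j)"
proof -
  define K where "K = {k \<in> int_lattice. \<exists>x\<in>cbox 0 1. x - k \<in> cbox 0 M}"
  have K: "finite K" unfolding K_def by (rule periodization_finite) simp
  have eq: "periodization f x = (\<Sum>k\<in>K. f (x - k))" if "x \<in> cbox 0 1" for x
    by (rule periodization_eq[OF K]) (use that supp in \<open>auto simp: K_def\<close>)
  let ?g = "\<lambda>x. f x * wave j x"
  let ?B = "\<lambda>k::real^'d. cbox (- k) (1 - k)"
  have int: "?g integrable_on cbox a b" for a b
    by (intro integrable_continuous continuous_intros continuous_on_subset[OF cont]) auto
  have shift: "((\<lambda>x. f (x - k) * wave j x) has_integral (integral (?B k) ?g)) (cbox 0 1)" if "k \<in> K" for k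
  proof -
    have "((\<lambda>x. ?g (1 *\<^sub>R x + - k)) has_integral (1 / \<bar>1\<bar> ^ DIM(real^'d)) *\<^sub>R integral (?B k) ?g)
        ((\<lambda>x. (1 / 1) *\<^sub>R x + - ((1 / 1) *\<^sub>R - k)) ` ?B k)"
      by (rule has_integral_affinity[OF integrable_integral[OF int]]) simp
    moreover have "(\<lambda>x. x + k) ` ?B k = cbox 0 1"
      using cbox_translation[of k "- k" "1 - k"] by (simp add: add.commute)
    ultimately have "((\<lambda>x. ?g (x - k)) has_integral integral (?B k) ?g) (cbox 0 1)"
      by simp
    then show ?thesis using wave_periodic[OF j, of k] that by (simp add: K_def)
  qed
  have "((\<lambda>x. \<Sum>k\<in>K. f (x - k) * wave j x) has_integral (\<Sum>k\<in>K. integral (?B k) ?g)) (cbox 0 1)"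
    by (rule has_integral_sum[OF K shift])
  moreover have "periodization f x * wave j x = (\<Sum>k\<in>K. f (x - k) * wave j x)" if "x \<in> cbox 0 1" for x
    using eq[OF that] by (simp add: sum_distrib_right)
  ultimately have 1: "integral (cbox 0 1) (\<lambda>x. periodization f x * wave j x) = (\<Sum>k\<in>K. integral (?B k) ?g)"
    by (intro integral_unique) (simp cong: has_integral_cong)
  have "(?g has_integral (\<Sum>k\<in>K. integral (?B k) ?g)) (\<Union>k\<in>K. ?B k)"
  proof (rule has_integral_UN[OF K integrable_integral[OF int]])
    show "pairwise (\<lambda>k k'. negligible (?B k \<inter> ?B k')) K"
    proof (rule pairwiseI)
      fix k k' assume k: "k \<in> K" "k' \<in> K" "k \<noteq> k'"
      then obtain l where l: "\<not> \<bar>k $ l - k' $ l\<bar> < 1"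
        using int_lattice_eqI[of k k'] by (auto simp: K_def)
      \<comment> \<open>The closed cubes share faces. Distinct lattice points differ by at least 1
        in some coordinate l, so cubes of side 1 meet only in a hyperplane orthogonal to that
        axis.\<close>
      have "?B k \<inter> ?B k' \<subseteq> {x. x $ l = - k $ l} \<union> {x. x $ l = - k' $ l}"
      proof
        fix x assume "x \<in> ?B k \<inter> ?B k'"
        then have "- k $ l \<le> x $ l" "x $ l \<le> 1 - k $ l" "- k' $ l \<le> x $ l" "x $ l \<le> 1 - k' $ l"
          by (auto simp: mem_box_cart dest!: spec[of _ l])
        then show "x \<in> {x. x $ l = - k $ l} \<union> {x. x $ l = - k' $ l}" using l by auto
      qed
      moreover have "negligible {x::real^'d. x $ l = c}" for c
      proof -
        have "axis l 1 \<in> (Basis :: (real^'d) set)" by (auto simp: Basis_vec_def)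
        from negligible_standard_hyperplane[OF this, of c] show ?thesis
          by (simp add: inner_axis)
      qed
      ultimately show "negligible (?B k \<inter> ?B k')"
        by (meson negligible_Un negligible_subset)
    qed
  qed
  then have 2: "(?g has_integral (\<Sum>k\<in>K. integral (?B k) ?g)) UNIV"
  proof (rule has_integral_on_superset)
    fix y assume y: "y \<notin> (\<Union>k\<in>K. ?B k)"
    show "?g y = 0"
    proof (rule ccontr)
      assume "?g y \<noteq> 0"
      then have yM: "y \<in> cbox 0 M" using supp by auto
      \<comment> \<open>This shift moves \<open>y\<close> into the unit cube, and there it witnesses
        membership in \<open>K\<close>.\<close>
      define k where "k = (\<chi> l. - real_of_int \<lfloor>y $ l\<rfloor>)"
      have "k \<in> int_lattice" by (simp add: k_def int_lattice_def)
      moreover have "y + k \<in> cbox 0 1"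
        by (auto simp: mem_box_cart k_def) linarith
      moreover have "(y + k) - k \<in> cbox 0 M" using yM by simp
      ultimately have "k \<in> K" unfolding K_def by blast
      moreover have "y \<in> ?B k" using \<open>y + k \<in> cbox 0 1\<close>
        by (auto simp: mem_box_cart) (smt (verit, best))+
      ultimately show False using y by blast
    qed
  qed simp
  have 3: "(?g has_integral fourier f ((2 * pi) *\<^sub>R j)) UNIV"
  proof -
    have fm [measurable]: "f \<in> borel_measurable borel" by (rule borel_measurable_continuous_onI[OF cont])
    have "integrable lborel (\<lambda>x. indicator (cbox 0 M) x *\<^sub>R ?g x)"
      by (rule borel_integrable_compact) (auto intro!: continuous_intros continuous_on_subset[OF cont])
    moreover have "indicator (cbox 0 M) x *\<^sub>R ?g x = ?g x" for x
      using supp[of x] by (auto simp: indicator_def)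
    ultimately have "integrable lborel ?g" by simp
    then show ?thesis
      using has_integral_integral_lborel[of ?g] by (simp add: fourier_lborel[OF fm])
  qed
  show ?thesis using 1 has_integral_unique[OF 2 3] by simp
qed

end

text \<open>Uniqueness of Fourier coefficients: a periodic function factors through the torus, where
  polynomials in the coordinates are dense and pull back to trigonometric polynomials.\<close>

lemma periodic_continuous_eq_0:
  fixes h :: "real^'d \<Rightarrow> real"
  assumes cont: "continuous_on (cbox 0 1) h"
    and per: "\<And>x y. x \<in> cbox 0 1 \<Longrightarrow> y \<in> cbox 0 1 \<Longrightarrow> x - y \<in> int_lattice \<Longrightarrow> h x = h y"
    and coeff: "\<And>j. j \<in> int_lattice \<Longrightarrow> integral (cbox 0 1) (\<lambda>x. complex_of_real (h x) * wave j x) = 0"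
    and x: "x \<in> cbox 0 1"
  shows "h x = 0"
proof -
  let ?Q = "cbox 0 (1::real^'d)"
  \<comment> \<open>\<open>orth q\<close> says that all Fourier coefficients of h q vanish, which is
    not visibly stable under products. The functions \<open>mlt\<close> that preserve
    \<open>orth\<close> form an algebra by construction, so the induction over polynomials runs on
    them and is applied to \<open>orth\<close> of the constant 1 at the end.\<close>
  define orth where "orth q \<longleftrightarrow> continuous_on ?Q q \<and>
    (\<forall>j\<in>int_lattice. integral ?Q (\<lambda>x. complex_of_real (h x) * (q x * wave j x)) = 0)" for q :: "real^'d \<Rightarrow> complex"
  define mlt where "mlt p \<longleftrightarrow> continuous_on ?Q p \<and> (\<forall>q. orth q \<longrightarrow> orth (\<lambda>x. p x * q x))"
    for p :: "real^'d \<Rightarrow> complex"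
  have int: "(\<lambda>x. complex_of_real (h x) * (q x * wave j x)) integrable_on ?Q" if "continuous_on ?Q q" for q j
    by (intro integrable_continuous continuous_intros that cont)
  have orth_add: "orth (\<lambda>x. p x + q x)" if "orth p" "orth q" for p q
    using that int unfolding orth_def by (auto simp: algebra_simps integral_add intro!: continuous_intros)
  have orth_cmul: "orth (\<lambda>x. c * q x)" if "orth q" for c q
  proof -
    have "integral ?Q (\<lambda>x. complex_of_real (h x) * (c * q x * wave j x))
        = c * integral ?Q (\<lambda>x. complex_of_real (h x) * (q x * wave j x))" for j
      by (simp flip: integral_mult_right add: mult_ac)
    with that show ?thesis unfolding orth_def by (auto intro!: continuous_intros)
  qed
  have orth_wave: "orth (\<lambda>x. wave k x * q x)" if "orth q" "k \<in> int_lattice" for k q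
  proof -
    have "(\<lambda>x. complex_of_real (h x) * (wave k x * q x * wave j x))
        = (\<lambda>x. complex_of_real (h x) * (q x * wave (k + j) x))" for j
      by (rule ext) (subst wave_add, simp only: mult_ac)
    then show ?thesis using that int_lattice_add unfolding orth_def
      by (auto intro!: continuous_intros)
  qed
  have mlt_wave: "mlt (wave k)" if "k \<in> int_lattice" for k
    unfolding mlt_def using orth_wave that by (auto intro!: continuous_intros)
  have mlt_const: "mlt (\<lambda>x. c)" for c unfolding mlt_def using orth_cmul by auto
  have mlt_mult: "mlt (\<lambda>x. p x * q x)" if "mlt p" "mlt q" for p q
    using that unfolding mlt_def by (auto simp: mult.assoc intro!: continuous_intros)
  have mlt_add: "mlt (\<lambda>x. p x + q x)" if "mlt p" "mlt q" for p q
    using that orth_add unfolding mlt_def by (auto simp: distrib_right intro!: continuous_intros)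
  have mlt_sum: "mlt (\<lambda>x. \<Sum>i\<in>I. p i x)" if "\<And>i. i \<in> I \<Longrightarrow> mlt (p i)" "finite I" for p and I :: "'d set"
    using that(2,1) by (induction I) (auto intro: mlt_const mlt_add)
  define E where "E x = (\<chi> l. exp (\<i> * complex_of_real (2 * pi * x $ l)))" for x :: "real^'d"
  have E_cont: "continuous_on S E" for S unfolding E_def by (intro continuous_intros)
  have wave_axis: "wave (axis l 1) x = cnj (E x $ l)" "wave (- axis l 1) x = E x $ l" for l x
    by (simp_all add: E_def inner_axis exp_cnj)
  have mlt_Re: "mlt (\<lambda>x. complex_of_real (Re (E x $ l)))" and mlt_Im: "mlt (\<lambda>x. complex_of_real (Im (E x $ l)))" for l
  proof -
    have a: "mlt (\<lambda>x. E x $ l)" "mlt (\<lambda>x. cnj (E x $ l))"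
      using mlt_wave[of "- axis l 1"] mlt_wave[of "axis l 1"] int_lattice_axis[of l] int_lattice_minus[of "axis l 1"]
      by (simp_all only: wave_axis)
    have "mlt (\<lambda>x. (1/2) * E x $ l + (1/2) * cnj (E x $ l))"
      by (intro mlt_add mlt_mult mlt_const a)
    moreover have "(1/2) * z + (1/2) * cnj z = complex_of_real (Re z)" for z by (simp add: complex_eq_iff)
    ultimately show "mlt (\<lambda>x. complex_of_real (Re (E x $ l)))" by (simp only:)
    have "mlt (\<lambda>x. (- \<i> / 2) * E x $ l + (\<i> / 2) * cnj (E x $ l))"
      by (intro mlt_add mlt_mult mlt_const a)
    moreover have "(- \<i> / 2) * z + (\<i> / 2) * cnj z = complex_of_real (Im z)" for z by (simp add: complex_eq_iff)
    ultimately show "mlt (\<lambda>x. complex_of_real (Im (E x $ l)))" by (simp only:)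
  qed
  have mlt_poly: "mlt (\<lambda>x. complex_of_real (p (E x)))" if "real_polynomial_function p" for p
    using that
  proof induction
    case (linear p)
    interpret bounded_linear p by fact
    \<comment> \<open>The real polynomials are over the real vector space \<open>complex^'d\<close>,
      so a linear one is determined by its values on the real basis \<open>axis l 1\<close>,
      \<open>axis l \<i>\<close>.\<close>
    have z: "z = (\<Sum>l\<in>UNIV. Re (z $ l) *\<^sub>R axis l 1 + Im (z $ l) *\<^sub>R axis l \<i>)" for z :: "complex^'d"
    proof (rule vec_eq_iff[THEN iffD2], rule allI)
      fix m
      have "(\<Sum>l\<in>UNIV. Re (z $ l) *\<^sub>R axis l 1 + Im (z $ l) *\<^sub>R axis l \<i>) $ m
          = (\<Sum>l\<in>UNIV. if l = m then Re (z $ l) *\<^sub>R 1 + Im (z $ l) *\<^sub>R \<i> else 0)"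
        unfolding sum_component by (intro sum.cong) (auto simp: axis_def)
      then show "z $ m = (\<Sum>l\<in>UNIV. Re (z $ l) *\<^sub>R axis l 1 + Im (z $ l) *\<^sub>R axis l \<i>) $ m"
        by (simp add: complex_eq_iff)
    qed
    have "p (E x) = (\<Sum>l\<in>UNIV. Re (E x $ l) * p (axis l 1) + Im (E x $ l) * p (axis l \<i>))" for x
      by (subst z[of "E x"]) (simp add: sum add scaleR)
    moreover have "mlt (\<lambda>x. \<Sum>l\<in>UNIV. complex_of_real (Re (E x $ l)) * complex_of_real (p (axis l 1))
        + complex_of_real (Im (E x $ l)) * complex_of_real (p (axis l \<i>)))"
      by (intro mlt_sum mlt_add mlt_mult mlt_const mlt_Re mlt_Im finite)
    ultimately show ?case by simp
  qed (simp_all add: mlt_const mlt_add mlt_mult)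
  have orth_1: "orth (\<lambda>x. 1)" unfolding orth_def using coeff by auto
  have poly0: "integral ?Q (\<lambda>x. h x * p (E x)) = 0" if "real_polynomial_function p" for p
  proof -
    have "orth (\<lambda>x. complex_of_real (p (E x)) * 1)" using mlt_poly[OF that] orth_1 unfolding mlt_def by blast
    then have c: "continuous_on ?Q (\<lambda>x. complex_of_real (p (E x)))"
      and "integral ?Q (\<lambda>x. complex_of_real (h x) * (complex_of_real (p (E x)) * 1 * wave 0 x)) = 0"
      unfolding orth_def using int_lattice_0 by auto
    then have "integral ?Q (\<lambda>x. complex_of_real (h x * p (E x))) = 0" by simp
    moreover have "continuous_on ?Q (\<lambda>x. p (E x))"
      using continuous_on_Re[OF c] by simp
    then have "(\<lambda>x. h x * p (E x)) integrable_on ?Q"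
      by (intro integrable_continuous continuous_intros cont)
    then have "integral ?Q (\<lambda>x. complex_of_real (h x * p (E x))) = complex_of_real (integral ?Q (\<lambda>x. h x * p (E x)))"
      using integral_linear[OF _ bounded_linear_of_real, of "\<lambda>x. h x * p (E x)" ?Q] by (simp add: o_def)
    ultimately show ?thesis by simp
  qed
  have E_eq: "h x = h y" if xy: "x \<in> ?Q" "y \<in> ?Q" and E: "E x = E y" for x y
  proof (rule per[OF xy])
    have "x $ l - y $ l \<in> \<int>" for l
    proof -
      have "exp (\<i> * complex_of_real (2 * pi * x $ l)) = exp (\<i> * complex_of_real (2 * pi * y $ l))"
        using E by (simp add: E_def vec_eq_iff)
      then obtain n :: int where "\<i> * complex_of_real (2 * pi * x $ l) = \<i> * complex_of_real (2 * pi * y $ l) + complex_of_real (real_of_int (2 * n) * pi) * \<i>"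
        unfolding exp_eq by blast
      from arg_cong[OF this, of Im] have "2 * pi * x $ l = 2 * pi * y $ l + real_of_int (2 * n) * pi"
        by (simp only: Im_complex_of_real Im_i_times plus_complex.sel Re_complex_of_real times_complex.sel imaginary_unit.sel)
      then have "2 * pi * (x $ l - y $ l) = 2 * pi * real_of_int n" by (simp add: algebra_simps)
      then have "x $ l - y $ l = real_of_int n" by simp
      then show ?thesis by simp
    qed
    then show "x - y \<in> int_lattice" by (simp add: int_lattice_def)
  qed
  \<comment> \<open>The choice of preimage is harmless: points of the cube with the same image
    differ by a lattice vector, typically on opposite faces, where h agrees.\<close>
  define g where "g z = h (SOME x. x \<in> ?Q \<and> E x = z)" for z
  have g: "g (E x) = h x" if "x \<in> ?Q" for x
  proof -
    have "(SOME y. y \<in> ?Q \<and> E y = E x) \<in> ?Q \<and> E (SOME y. y \<in> ?Q \<and> E y = E x) = E x"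
      by (rule someI[of "\<lambda>y. y \<in> ?Q \<and> E y = E x"]) (use that in simp)
    then show ?thesis unfolding g_def using E_eq that by blast
  qed
  have T: "compact (E ` ?Q)" by (intro compact_continuous_image E_cont compact_cbox)
  \<comment> \<open>On a compact cube \<open>E\<close> is a closed map, so preimages under
    \<open>g\<close> of closed sets are closed as images of compact sets.\<close>
  have g_cont: "continuous_on (E ` ?Q) g"
    unfolding continuous_on_closed_vimage[OF compact_imp_closed[OF T]]
  proof (intro allI impI)
    fix B :: "real set" assume "closed B"
    then have "closed (h -` B \<inter> ?Q)"
      using cont continuous_on_closed_vimage[OF closed_cbox] by blast
    then have "compact (h -` B \<inter> ?Q)"
      using compact_Int_closed[OF compact_cbox, of "h -` B \<inter> ?Q" 0 1] by (simp add: Int_ac)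
    then have "compact (E ` (h -` B \<inter> ?Q))" by (intro compact_continuous_image E_cont)
    moreover have "g -` B \<inter> E ` ?Q = E ` (h -` B \<inter> ?Q)" using g by auto
    ultimately show "closed (g -` B \<inter> E ` ?Q)" by (simp add: compact_imp_closed)
  qed
  have hh: "(\<lambda>x. h x * h x) integrable_on ?Q" and ah: "(\<lambda>x. \<bar>h x\<bar>) integrable_on ?Q"
    by (intro integrable_continuous continuous_intros cont)+
  have "integral ?Q (\<lambda>x. h x * h x) \<le> 0 + e" if e: "e > 0" for e
  proof -
    \<comment> \<open>As h is orthogonal to every p (E x), the integral of h^2 equals that of h (h -
      p (E x)), at most \<open>A\<close> times the uniform error. The tolerance e / (A + 1) allows
      for A = 0.\<close>
    define A where "A = integral ?Q (\<lambda>x. \<bar>h x\<bar>)"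
    have A: "A \<ge> 0" unfolding A_def by (rule integral_nonneg[OF ah]) simp
    have "e / (A + 1) > 0" using A e by simp
    then obtain p where p: "real_polynomial_function p" "\<And>z. z \<in> E ` ?Q \<Longrightarrow> \<bar>g z - p z\<bar> < e / (A + 1)"
      using Stone_Weierstrass_real_polynomial_function[OF T g_cont] by blast
    have pE: "continuous_on ?Q (\<lambda>x. p (E x))"
      using mlt_poly[OF p(1)] continuous_on_Re[of ?Q "\<lambda>x. complex_of_real (p (E x))"] unfolding mlt_def by simp
    have hp: "(\<lambda>x. h x * p (E x)) integrable_on ?Q"
      by (intro integrable_continuous continuous_intros cont pE)
    have "integral ?Q (\<lambda>x. h x * h x) = integral ?Q (\<lambda>x. h x * h x - h x * p (E x))"
      using poly0[OF p(1)] by (simp add: integral_diff[OF hh hp])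
    also have "\<dots> \<le> integral ?Q (\<lambda>x. e / (A + 1) * \<bar>h x\<bar>)"
    proof (rule integral_le)
      show "(\<lambda>x. h x * h x - h x * p (E x)) integrable_on ?Q" by (rule integrable_diff[OF hh hp])
      show "(\<lambda>x. e / (A + 1) * \<bar>h x\<bar>) integrable_on ?Q" using ah by (rule integrable_on_mult_right)
      fix x assume x: "x \<in> ?Q"
      have "\<bar>h x - p (E x)\<bar> \<le> e / (A + 1)" using p(2)[of "E x"] g[OF x] x by auto
      then have "\<bar>h x\<bar> * \<bar>h x - p (E x)\<bar> \<le> \<bar>h x\<bar> * (e / (A + 1))" by (intro mult_left_mono) auto
      moreover have "h x * (h x - p (E x)) \<le> \<bar>h x\<bar> * \<bar>h x - p (E x)\<bar>"
        by (metis abs_ge_self abs_mult)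
      ultimately show "h x * h x - h x * p (E x) \<le> e / (A + 1) * \<bar>h x\<bar>"
        by (simp add: algebra_simps)
    qed
    also have "\<dots> = e / (A + 1) * A" by (simp add: A_def)
    also have "\<dots> \<le> 0 + e" using A e by (simp add: field_simps)
    finally show ?thesis .
  qed
  then have "integral ?Q (\<lambda>x. h x * h x) \<le> 0" by (rule field_le_epsilon)
  moreover have "0 \<le> integral ?Q (\<lambda>x. h x * h x)" by (rule integral_nonneg[OF hh]) simp
  ultimately have "integral ?Q (\<lambda>x. h x * h x) = 0" by simp
  moreover have "box 0 (1::real^'d) \<noteq> {}"
  proof -
    have "(\<chi> i. 1 / 2) \<in> box 0 (1::real^'d)" by (simp add: mem_box_cart)
    then show ?thesis by blast
  qed
  moreover have "continuous_on ?Q (\<lambda>x. h x * h x)" by (intro continuous_intros cont)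
  ultimately have "\<forall>x\<in>?Q. h x * h x = 0"
    using integral_cbox_eq_0_iff[of 0 1 "\<lambda>x. h x * h x"] by simp
  then show ?thesis using x by simp
qed

text \<open>The periodization minus 1 has no nonzero Fourier coefficient: the normalisation
  \<open>fourier \<phi> 0 = 1\<close> settles frequency 0, the zeros on the dual lattice all others.
  Any finite K that catches the contributing shifts is allowed, so that \<open>Lambda\<close> can
  take its place.\<close>

lemma partition_of_unity:
  fixes \<phi> :: "real^'d \<Rightarrow> real"
  assumes cont: "continuous_on UNIV \<phi>" and supp: "\<And>x. \<phi> x \<noteq> 0 \<Longrightarrow> x \<in> cbox 0 M"
    and ref: "refinable (\<lambda>x. complex_of_real (\<phi> x)) a" and sr: "has_sum_rules a (n + 1)"
    and K: "finite K" "K \<subseteq> int_lattice" "\<And>k. k \<in> int_lattice \<Longrightarrow> \<phi> (x - k) \<noteq> 0 \<Longrightarrow> k \<in> K"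
  shows "(\<Sum>k\<in>K. \<phi> (x - k)) = 1"
proof -
  let ?f = "\<lambda>x. complex_of_real (\<phi> x)"
  have f: "continuous_on UNIV ?f" "\<And>x. ?f x \<noteq> 0 \<Longrightarrow> x \<in> cbox 0 M"
    using cont supp by (auto intro!: continuous_intros)
  have int: "integrable lborel ?f"
  proof -
    have "integrable lborel (\<lambda>x. indicator (cbox 0 M) x *\<^sub>R ?f x)"
      by (rule borel_integrable_compact[OF compact_cbox]) (rule continuous_on_subset[OF f(1)], simp)
    moreover have "indicator (cbox 0 M) x *\<^sub>R ?f x = ?f x" for x
      using supp[of x] by (auto simp: indicator_def)
    ultimately show ?thesis by simp
  qed
  define P where "P = periodization ?f"
  have P_real: "P x = complex_of_real (Re (P x))" for x
    unfolding P_def periodization_def by (simp flip: of_real_sum)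
  have P_cont: "continuous_on S P" for S
    unfolding P_def using periodization_continuous[OF f] continuous_on_subset by blast
  have P_per: "P (x + j) = P x" if "j \<in> int_lattice" for x j
    unfolding P_def by (rule periodization_periodic[OF f that])
  have one: "Re (P x) - 1 = 0" if "x \<in> cbox 0 1" for x
  proof (rule periodic_continuous_eq_0[OF _ _ _ that])
    show "continuous_on (cbox 0 1) (\<lambda>x. Re (P x) - 1)"
      by (intro continuous_intros P_cont)
    show "Re (P x) - 1 = Re (P y) - 1" if "x - y \<in> int_lattice" for x y
      using P_per[OF that, of y] by simp
    fix j :: "real^'d" assume j: "j \<in> int_lattice"
    have "integral (cbox 0 1) (\<lambda>x. complex_of_real (Re (P x) - 1) * wave j x)
        = integral (cbox 0 1) (\<lambda>x. P x * wave j x - wave j x)"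
      using P_real by (simp add: left_diff_distrib)
    also have "\<dots> = integral (cbox 0 1) (\<lambda>x. P x * wave j x) - integral (cbox 0 1) (wave j)"
      by (intro integral_diff integrable_continuous continuous_intros P_cont)
    also have "integral (cbox 0 1) (\<lambda>x. P x * wave j x) = fourier ?f ((2 * pi) *\<^sub>R j)"
      unfolding P_def by (rule integral_periodization_wave[OF f j])
    also have "fourier ?f ((2 * pi) *\<^sub>R j) - integral (cbox 0 1) (wave j) = 0"
    proof (cases "j = 0")
      case True
      have "(0::real^'d) \<in> cbox 0 1" by (simp add: mem_box_cart)
      then have "cbox 0 (1::real^'d) \<noteq> {}" by blast
      then have "Henstock_Kurzweil_Integration.content (cbox 0 (1::real^'d)) = 1" by (simp add: content_cbox_cart)
      moreover have "fourier ?f 0 = 1" using ref unfolding refinable_def by blast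
      ultimately show ?thesis using True by simp
    next
      case False
      then show ?thesis
        using fourier_vanishes_on_dual_lattice[OF int ref sr j] integral_wave[OF j] by simp
    qed
    finally show "integral (cbox 0 1) (\<lambda>x. complex_of_real (Re (P x) - 1) * wave j x) = 0" .
  qed
  define k where "k = (\<chi> l. real_of_int \<lfloor>x $ l\<rfloor>)"
  have "k \<in> int_lattice" by (simp add: k_def int_lattice_def)
  then have "P (x - k) = P x" using P_per[of k "x - k"] by simp
  moreover have "x - k \<in> cbox 0 1" by (auto simp: mem_box_cart k_def) linarith
  ultimately have "P x = 1" using one[of "x - k"] P_real[of x] by simp
  moreover have "P x = (\<Sum>k\<in>K. ?f (x - k))"
    unfolding P_def by (rule periodization_eq[OF f K(1,2)]) (use K(3) in auto)
  ultimately have "complex_of_real (\<Sum>k\<in>K. \<phi> (x - k)) = 1" by simp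
  then show ?thesis using of_real_eq_1_iff by blast
qed

section \<open>Reconstruction from intensities\<close>

lemma Lmin_Lmax_bounds:
  assumes "k \<in> \<Omega> \<inter> int_lattice" "finite (\<Omega> \<inter> int_lattice)"
  shows "Lmin \<Omega> $ l \<le> k $ l" "k $ l \<le> Lmax \<Omega> $ l"
  using assms by (auto simp: Lmin_def Lmax_def intro!: Min_le Max_ge)

text \<open>A coordinate that separates \<open>0\<close> from the box at level \<open>1\<close> does so at all higher levels.\<close>

lemma Lambda_away_from_0:
  assumes M: "\<And>l. 0 < M $ l" and z: "0 \<notin> Lambda M \<Omega> 1"
  obtains r where "r > 0" "\<And>N k. N \<ge> 1 \<Longrightarrow> k \<in> Lambda M \<Omega> N \<Longrightarrow> r * 2 ^ N \<le> norm k"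
proof -
  have "0 \<in> int_lattice" by (simp add: int_lattice_def)
  with z obtain l where l: "2 * Lmin \<Omega> $ l - M $ l > 0 \<or> Lmax \<Omega> $ l < 0"
    by (auto simp: Lambda_def not_le)
  \<comment> \<open>After division by 2^N the lower edge is
    \<open>Lmin \<Omega> $ l - M $ l / 2 ^ N\<close>, which is smallest at N = 1; the upper edge
    does not change.\<close>
  define r where "r = (if Lmax \<Omega> $ l < 0 then - Lmax \<Omega> $ l else Lmin \<Omega> $ l - M $ l / 2)"
  show thesis
  proof (rule that)
    show "r > 0" using l by (auto simp: r_def)
    fix N :: nat and k assume N: "N \<ge> 1" and k: "k \<in> Lambda M \<Omega> N"
    have k: "2 ^ N * Lmin \<Omega> $ l - M $ l \<le> k $ l" "k $ l \<le> 2 ^ N * Lmax \<Omega> $ l"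
      using k by (auto simp: Lambda_def)
    have "2 * M $ l \<le> 2 ^ N * M $ l"
      using N M[of l] power_increasing[of 1 N "2::real"] by (intro mult_right_mono) auto
    then have "r * 2 ^ N \<le> \<bar>k $ l\<bar>" using k by (auto simp: r_def algebra_simps)
    then show "r * 2 ^ N \<le> norm k" using component_le_norm_cart[of k l] by linarith
  qed
qed

text \<open>The sampling points 2^-N k thus stay in one ball for all N, which turns the relative
  perturbation 2^-N in a triple into an absolute one.\<close>

lemma Lambda_norm_le:
  assumes M: "\<And>l. 0 < M $ l"
  obtains \<rho> where "\<rho> > 0" "\<And>N k. k \<in> Lambda M \<Omega> N \<Longrightarrow> norm k \<le> \<rho> * 2 ^ N"
proof -
  define \<rho> where "\<rho> = 1 + (\<Sum>l\<in>UNIV. \<bar>Lmin \<Omega> $ l\<bar> + \<bar>Lmax \<Omega> $ l\<bar> + M $ l)"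
  show thesis
  proof (rule that)
    show "\<rho> > 0" unfolding \<rho>_def using M by (intro add_pos_nonneg sum_nonneg) (auto simp: less_imp_le)
    fix N k assume k: "k \<in> Lambda M \<Omega> N"
    have "\<bar>k $ l\<bar> \<le> (\<bar>Lmin \<Omega> $ l\<bar> + \<bar>Lmax \<Omega> $ l\<bar> + M $ l) * 2 ^ N" for l
    proof -
      have "2 ^ N * Lmin \<Omega> $ l - M $ l \<le> k $ l" "k $ l \<le> 2 ^ N * Lmax \<Omega> $ l"
        using k by (auto simp: Lambda_def)
      moreover have "M $ l \<le> 2 ^ N * M $ l" using M[of l] by simp
      moreover have "2 ^ N * Lmax \<Omega> $ l \<le> 2 ^ N * \<bar>Lmax \<Omega> $ l\<bar>" "- (2 ^ N * \<bar>Lmin \<Omega> $ l\<bar>) \<le> 2 ^ N * Lmin \<Omega> $ l"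
        using abs_ge_minus_self[of "2 ^ N * Lmin \<Omega> $ l"] by (auto simp: abs_mult)
      moreover have "0 \<le> 2 ^ N * \<bar>Lmax \<Omega> $ l\<bar>" "0 \<le> 2 ^ N * \<bar>Lmin \<Omega> $ l\<bar>" by auto
      ultimately have "\<bar>k $ l\<bar> \<le> 2 ^ N * \<bar>Lmin \<Omega> $ l\<bar> + 2 ^ N * \<bar>Lmax \<Omega> $ l\<bar> + 2 ^ N * M $ l"
        using M[of l] unfolding abs_le_iff by (intro conjI) linarith+
      then show ?thesis by (simp add: algebra_simps)
    qed
    then have "(\<Sum>l\<in>UNIV. \<bar>k $ l\<bar>) \<le> (\<Sum>l\<in>UNIV. (\<bar>Lmin \<Omega> $ l\<bar> + \<bar>Lmax \<Omega> $ l\<bar> + M $ l) * 2 ^ N)"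
      by (intro sum_mono) auto
    then have "norm k \<le> (\<Sum>l\<in>UNIV. \<bar>Lmin \<Omega> $ l\<bar> + \<bar>Lmax \<Omega> $ l\<bar> + M $ l) * 2 ^ N"
      using norm_le_l1_cart[of k] by (simp add: sum_distrib_right)
    also have "\<dots> \<le> \<rho> * 2 ^ N" by (simp add: \<rho>_def)
    finally show "norm k \<le> \<rho> * 2 ^ N" .
  qed
qed

section \<open>Admissible waves and inversion of the intensities\<close>

lemma spherical_wave_cmod:
  assumes "spherical_wave g"
  obtains b where "b > 0" "\<And>x. x \<noteq> 0 \<Longrightarrow> cmod (g x) = b / norm x"
  using assms by (auto simp: spherical_wave_def norm_mult norm_divide)

text \<open>A vanishing cross term has quotient \<infinity>, which the finite bound \<gamma> on the
  supremum excludes.\<close>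

lemma admissible_quotient_le:
  assumes "admissible \<gamma> g (Xi M \<Omega> N) N" and k: "k \<in> Lambda M \<Omega> N"
  defines "k' \<equiv> (1 + 1 / 2 ^ N) *\<^sub>R k" and "k'' \<equiv> (1 - 1 / 2 ^ N) *\<^sub>R k"
  shows "cross_term g N k k' k'' \<noteq> 0"
    and "max (cmod (at_level g N k - at_level g N k')) (cmod (at_level g N k - at_level g N k''))
      \<le> \<gamma> * \<bar>cross_term g N k k' k''\<bar>"
proof -
  have "(k, k', k'') \<in> Xi M \<Omega> N" using k by (auto simp: Xi_def k'_def k''_def)
  then have "(case (k, k', k'') of (k, k', k'') \<Rightarrow> admissibility_quotient g N k k' k'') \<le>
      (SUP (k, k', k'')\<in>Xi M \<Omega> N. admissibility_quotient g N k k' k'')"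
    by (rule SUP_upper)
  also have "\<dots> \<le> ereal \<gamma>" using assms(1) by (simp add: admissible_def)
  finally have q: "admissibility_quotient g N k k' k'' \<le> ereal \<gamma>" by simp
  then show ne: "cross_term g N k k' k'' \<noteq> 0"
    by (auto simp: admissibility_quotient_def split: if_splits)
  have "cmod (cnj (at_level g N k) - cnj (at_level g N k'')) = cmod (at_level g N k - at_level g N k'')"
    by (metis complex_cnj_diff complex_mod_cnj)
  with q ne show "max (cmod (at_level g N k - at_level g N k')) (cmod (at_level g N k - at_level g N k''))
      \<le> \<gamma> * \<bar>cross_term g N k k' k''\<bar>"
    by (simp add: admissibility_quotient_def divide_le_eq)
qed

text \<open>For F0 = F1 the quadratic terms cancel and the left side is 0. In general |F0|^2 -
  |F1|^2 + 2 Re ((F0 - F1) cnj G1) remains, and each part carries a factor |F0 - F1|. Only the wave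
  at the perturbed point enters.\<close>

lemma intensity_difference_error:
  fixes F0 F1 G0 G1 :: complex
  shows "\<bar>(cmod (F0 + G0))\<^sup>2 - (cmod (F1 + G1))\<^sup>2 + (cmod G1)\<^sup>2 - (cmod G0)\<^sup>2 - 2 * Re (F0 * cnj (G0 - G1))\<bar>
    \<le> cmod (F0 - F1) * (cmod F0 + cmod F1 + 2 * cmod G1)"
proof -
  have "(cmod (F0 + G0))\<^sup>2 - (cmod (F1 + G1))\<^sup>2 + (cmod G1)\<^sup>2 - (cmod G0)\<^sup>2 - 2 * Re (F0 * cnj (G0 - G1))
      = (cmod F0 - cmod F1) * (cmod F0 + cmod F1) + 2 * Re ((F0 - F1) * cnj G1)"
  proof -
    have "(cmod F0 - cmod F1) * (cmod F0 + cmod F1) = (cmod F0)\<^sup>2 - (cmod F1)\<^sup>2"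
      by (simp add: power2_eq_square algebra_simps)
    then show ?thesis
      by (simp only: cmod_power2) (simp only: plus_complex.sel minus_complex.sel times_complex.sel cnj.sel power2_eq_square, simp add: algebra_simps)
  qed
  also have "\<bar>\<dots>\<bar> \<le> \<bar>(cmod F0 - cmod F1) * (cmod F0 + cmod F1)\<bar> + \<bar>2 * Re ((F0 - F1) * cnj G1)\<bar>"
    by (rule abs_triangle_ineq)
  also have "\<dots> \<le> cmod (F0 - F1) * (cmod F0 + cmod F1) + 2 * (cmod (F0 - F1) * cmod G1)"
  proof (rule add_mono)
    show "\<bar>(cmod F0 - cmod F1) * (cmod F0 + cmod F1)\<bar> \<le> cmod (F0 - F1) * (cmod F0 + cmod F1)"
      using norm_triangle_ineq3[of F0 F1] by (simp add: abs_mult mult_right_mono)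
    show "\<bar>2 * Re ((F0 - F1) * cnj G1)\<bar> \<le> 2 * (cmod (F0 - F1) * cmod G1)"
      using abs_Re_le_cmod[of "(F0 - F1) * cnj G1"] by (simp add: norm_mult)
  qed
  finally show ?thesis by (simp add: algebra_simps)
qed

text \<open>Cramer's rule with determinant \<open>- X\<close> is exact on the linear part, so only
  the residuals \<open>p\<close>, \<open>p'\<close> propagate. Read as one complex number the error
  is \<i> (p' a - p b) / (2 Y), and the triangle inequality produces exactly the admissibility
  quotient.\<close>

lemma linear_inversion_error:
  fixes F0 a b :: complex and r r' :: real
  defines "X \<equiv> Im (a * cnj b)"
  assumes X: "X \<noteq> 0"
  shows "cmod (Complex ((Im b * r - Im a * r') / (2 * - X)) ((- Re b * r + Re a * r') / (2 * - X)) - F0)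
    \<le> max (cmod a) (cmod b) / \<bar>X\<bar> * ((\<bar>r - 2 * Re (F0 * cnj a)\<bar> + \<bar>r' - 2 * Re (F0 * cnj b)\<bar>) / 2)"
proof -
  define p where "p = r - 2 * Re (F0 * cnj a)"
  define p' where "p' = r' - 2 * Re (F0 * cnj b)"
  define Y where "Y = - X"
  have Y: "Y \<noteq> 0" "\<bar>Y\<bar> = \<bar>X\<bar>" "Y = Re a * Im b - Im a * Re b" using X by (auto simp: Y_def X_def algebra_simps)
  have r: "r = p + 2 * Re (F0 * cnj a)" "r' = p' + 2 * Re (F0 * cnj b)" by (simp_all add: p_def p'_def)
  have 1: "(Im b * r - Im a * r') / (2 * Y) - Re F0 = (Im b * p - Im a * p') / (2 * Y)"
  proof -
    have "Im b * r - Im a * r' = Im b * p - Im a * p' + Re F0 * (2 * Y)"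
      unfolding r Y(3) by (simp add: algebra_simps)
    then show ?thesis using Y(1) by (simp add: add_divide_distrib)
  qed
  have 2: "(- Re b * r + Re a * r') / (2 * Y) - Im F0 = (- Re b * p + Re a * p') / (2 * Y)"
  proof -
    have "- Re b * r + Re a * r' = - Re b * p + Re a * p' + Im F0 * (2 * Y)"
      unfolding r Y(3) by (simp add: algebra_simps)
    then show ?thesis using Y(1) by (simp add: add_divide_distrib)
  qed
  have "Complex ((Im b * r - Im a * r') / (2 * Y)) ((- Re b * r + Re a * r') / (2 * Y)) - F0
      = (complex_of_real p * (- \<i> * b) + complex_of_real p' * (\<i> * a)) / complex_of_real (2 * Y)"
  proof (rule complex_eqI)
    show "Re (Complex ((Im b * r - Im a * r') / (2 * Y)) ((- Re b * r + Re a * r') / (2 * Y)) - F0)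
      = Re ((complex_of_real p * (- \<i> * b) + complex_of_real p' * (\<i> * a)) / complex_of_real (2 * Y))"
      using 1 by (simp only: Re_divide_of_real) (simp add: mult.commute)
    show "Im (Complex ((Im b * r - Im a * r') / (2 * Y)) ((- Re b * r + Re a * r') / (2 * Y)) - F0)
      = Im ((complex_of_real p * (- \<i> * b) + complex_of_real p' * (\<i> * a)) / complex_of_real (2 * Y))"
      using 2 by (simp only: Im_divide_of_real) (simp add: mult.commute)
  qed
  then have "cmod (Complex ((Im b * r - Im a * r') / (2 * Y)) ((- Re b * r + Re a * r') / (2 * Y)) - F0)
      = cmod (complex_of_real p * (- \<i> * b) + complex_of_real p' * (\<i> * a)) / (2 * \<bar>X\<bar>)"
    using Y(2) by (simp add: norm_divide norm_mult)
  also have "\<dots> \<le> (\<bar>p\<bar> * cmod b + \<bar>p'\<bar> * cmod a) / (2 * \<bar>X\<bar>)"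
    by (intro divide_right_mono order_trans[OF norm_triangle_ineq]) (auto simp: norm_mult)
  also have "\<dots> \<le> (\<bar>p\<bar> * max (cmod a) (cmod b) + \<bar>p'\<bar> * max (cmod a) (cmod b)) / (2 * \<bar>X\<bar>)"
    by (intro divide_right_mono add_mono mult_left_mono) auto
  also have "\<dots> = max (cmod a) (cmod b) / \<bar>X\<bar> * ((\<bar>p\<bar> + \<bar>p'\<bar>) / 2)"
    by (simp add: field_simps)
  finally show ?thesis by (simp add: Y_def p_def p'_def)
qed

lemma reconstruct_triple_error:
  assumes X: "cross_term g N k k' k'' \<noteq> 0"
    and q: "max (cmod (at_level g N k - at_level g N k')) (cmod (at_level g N k - at_level g N k''))
      \<le> \<gamma> * \<bar>cross_term g N k k' k''\<bar>"
    and D: "cmod (at_level f N k - at_level f N k') \<le> D" "cmod (at_level f N k - at_level f N k'') \<le> D"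
    and B: "\<And>x. cmod (f x) \<le> B"
    and A: "cmod (at_level g N k') \<le> A" "cmod (at_level g N k'') \<le> A"
    and \<gamma>: "0 \<le> \<gamma>"
  shows "cmod (reconstruct_triple f g N k k' k'' - at_level f N k) \<le> 2 * \<gamma> * D * (B + A)"
proof -
  let ?F = "at_level f N" and ?G = "at_level g N"
  define a b where "a = ?G k - ?G k'" and "b = ?G k - ?G k''"
  define r where "r = intensity f g N k - intensity f g N k' + (cmod (?G k'))\<^sup>2 - (cmod (?G k))\<^sup>2"
  define r' where "r' = intensity f g N k - intensity f g N k'' + (cmod (?G k''))\<^sup>2 - (cmod (?G k))\<^sup>2"
  have ct: "cross_term g N k k' k'' = Im (a * cnj b)" by (simp add: cross_term_def a_def b_def)
  have D0: "0 \<le> D" using D(1) norm_ge_zero order_trans by blast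
  have BA: "0 \<le> 2 * (B + A)"
    using order_trans[OF norm_ge_zero B] order_trans[OF norm_ge_zero A(1)] by simp
  have err: "cmod (?F k - ?F m) * (cmod (?F k) + cmod (?F m) + 2 * cmod (?G m)) \<le> D * (2 * (B + A))"
    if "cmod (?F k - ?F m) \<le> D" "cmod (?G m) \<le> A" for m
    using that B[of "(1 / 2 ^ N) *\<^sub>R k"] B[of "(1 / 2 ^ N) *\<^sub>R m"] D0 BA by (intro mult_mono) auto
  have "\<bar>r - 2 * Re (?F k * cnj a)\<bar> \<le> D * (2 * (B + A))"
    using intensity_difference_error[of "?F k" "?G k" "?F k'" "?G k'"] err[OF D(1) A(1)]
    by (simp add: r_def intensity_def a_def)
  moreover have "\<bar>r' - 2 * Re (?F k * cnj b)\<bar> \<le> D * (2 * (B + A))"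
    using intensity_difference_error[of "?F k" "?G k" "?F k''" "?G k''"] err[OF D(2) A(2)]
    by (simp add: r'_def intensity_def b_def)
  ultimately have rr: "(\<bar>r - 2 * Re (?F k * cnj a)\<bar> + \<bar>r' - 2 * Re (?F k * cnj b)\<bar>) / 2 \<le> D * (2 * (B + A))"
    by simp
  have g: "max (cmod a) (cmod b) / \<bar>Im (a * cnj b)\<bar> \<le> \<gamma>"
    using q X by (simp add: divide_le_eq ct flip: a_def b_def)
  have "reconstruct_triple f g N k k' k'' =
      Complex ((Im b * r - Im a * r') / (2 * - Im (a * cnj b))) ((- Re b * r + Re a * r') / (2 * - Im (a * cnj b)))"
    unfolding reconstruct_triple_def Let_def ct r_def r'_def a_def b_def by simp
  also have "cmod (\<dots> - ?F k) \<le> max (cmod a) (cmod b) / \<bar>Im (a * cnj b)\<bar> *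
      ((\<bar>r - 2 * Re (?F k * cnj a)\<bar> + \<bar>r' - 2 * Re (?F k * cnj b)\<bar>) / 2)"
    by (rule linear_inversion_error) (use X ct in simp)
  also have "\<dots> \<le> \<gamma> * (D * (2 * (B + A)))"
    using \<gamma> by (intro mult_mono g rr) auto
  finally show ?thesis by (simp add: algebra_simps)
qed

text \<open>\<open>L2_norm_on\<close> is infinite unless the restriction is measurable and square
  integrable, so both are established before the size. The pointwise bound on Z holds almost
  everywhere on \<Omega>.\<close>

lemma L2_norm_on_le:
  fixes h :: "real^'d \<Rightarrow> complex"
  assumes \<Omega>: "bounded \<Omega>" "\<Omega> \<in> sets lebesgue" and h: "continuous_on UNIV h" and E: "0 \<le> E"
    and Z: "negligible (\<Omega> - Z)" and le: "\<And>x. x \<in> \<Omega> \<Longrightarrow> x \<in> Z \<Longrightarrow> cmod (h x) \<le> E"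
  shows "L2_norm_on \<Omega> h \<le> ennreal (E * sqrt (measure lebesgue \<Omega>))"
proof -
  have fin: "emeasure lebesgue \<Omega> < \<infinity>"
    using fmeasurableD2[OF bounded_set_imp_lmeasurable[OF \<Omega>]]
    by (simp only: less_top infinity_ennreal_def)
  have "h \<in> borel_measurable borel" by (rule borel_measurable_continuous_onI[OF h])
  then have [measurable]: "h \<in> borel_measurable lebesgue" by (simp add: measurable_completion)
  note [measurable] = \<Omega>(2)
  have m: "set_borel_measurable lebesgue \<Omega> h" unfolding set_borel_measurable_def by measurable
  have I: "integrable lebesgue (\<lambda>x. indicator \<Omega> x *\<^sub>R E\<^sup>2)"
    using fin \<Omega>(2) by (intro integrable_scaleR_left) (simp add: integrable_indicator_iff)
  have ae: "AE x in lebesgue. indicator \<Omega> x *\<^sub>R (cmod (h x))\<^sup>2 \<le> indicator \<Omega> x *\<^sub>R E\<^sup>2"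
  proof (rule AE_I')
    show "\<Omega> - Z \<in> null_sets lebesgue" using Z by (simp add: negligible_iff_null_sets)
    show "{x \<in> space lebesgue. \<not> indicator \<Omega> x *\<^sub>R (cmod (h x))\<^sup>2 \<le> indicator \<Omega> x *\<^sub>R E\<^sup>2} \<subseteq> \<Omega> - Z"
      using le by (auto simp: indicator_def power_mono split: if_splits)
  qed
  have J: "integrable lebesgue (\<lambda>x. indicator \<Omega> x *\<^sub>R (cmod (h x))\<^sup>2)"
    by (rule Bochner_Integration.integrable_bound[OF I]) (use ae in \<open>auto elim!: eventually_mono\<close>)
  have "(LINT x:\<Omega>|lebesgue. (cmod (h x))\<^sup>2) \<le> (LINT x|lebesgue. indicator \<Omega> x *\<^sub>R E\<^sup>2)"
    unfolding set_lebesgue_integral_def by (rule integral_mono_AE[OF J I ae])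
  also have "\<dots> = E\<^sup>2 * measure lebesgue \<Omega>" using \<Omega>(2) by simp
  finally have "sqrt (LINT x:\<Omega>|lebesgue. (cmod (h x))\<^sup>2) \<le> sqrt (E\<^sup>2 * measure lebesgue \<Omega>)" by simp
  also have "\<dots> = E * sqrt (measure lebesgue \<Omega>)" using E by (simp add: real_sqrt_mult)
  finally show ?thesis
    unfolding L2_norm_on_def using m J by (simp add: set_integrable_def ennreal_leI)
qed

text \<open>From |Im (a cnj c)| \<le> |a| |c| the factor |c| cancels against the maximum, leaving 1
  \<le> \<gamma> |a|. The outward difference a is the one kept: the modulus of the wave decreases
  with the radius, whence |a| \<le> 2 |g x|.\<close>

lemma admissible_lower_bound:
  assumes g: "spherical_wave g" and adm: "admissible \<gamma> g (Xi M \<Omega> N) N"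
    and k: "2 ^ N *\<^sub>R x \<in> Lambda M \<Omega> N" and x: "x \<noteq> 0" and \<gamma>: "0 < \<gamma>"
  shows "1 \<le> 2 * \<gamma> * cmod (g x)"
proof -
  obtain b where b: "b > 0" "\<And>x. x \<noteq> 0 \<Longrightarrow> cmod (g x) = b / norm x"
    using spherical_wave_cmod[OF g] by blast
  define a where "a = g x - g ((1 + 1 / 2 ^ N) *\<^sub>R x)"
  define c where "c = g x - g ((1 - 1 / 2 ^ N) *\<^sub>R x)"
  let ?k = "2 ^ N *\<^sub>R x"
  have lev: "at_level g N ?k - at_level g N ((1 + 1 / 2 ^ N) *\<^sub>R ?k) = a"
      "at_level g N ?k - at_level g N ((1 - 1 / 2 ^ N) *\<^sub>R ?k) = c"
    by (simp_all add: a_def c_def)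
  have ct: "cross_term g N ?k ((1 + 1 / 2 ^ N) *\<^sub>R ?k) ((1 - 1 / 2 ^ N) *\<^sub>R ?k) = Im (a * cnj c)"
    by (simp add: cross_term_def flip: lev)
  have ne: "Im (a * cnj c) \<noteq> 0" and q: "max (cmod a) (cmod c) \<le> \<gamma> * \<bar>Im (a * cnj c)\<bar>"
    using admissible_quotient_le[OF adm k] unfolding ct lev by auto
  have "cmod c \<le> max (cmod a) (cmod c)" by simp
  also have "\<dots> \<le> \<gamma> * \<bar>Im (a * cnj c)\<bar>" by (rule q)
  also have "\<dots> \<le> \<gamma> * (cmod a * cmod c)"
    using \<gamma> abs_Im_le_cmod[of "a * cnj c"] by (intro mult_left_mono) (auto simp: norm_mult)
  finally have "1 * cmod c \<le> (\<gamma> * cmod a) * cmod c" by simp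
  moreover have "0 < cmod c" using ne by auto
  ultimately have "1 \<le> \<gamma> * cmod a" by (simp only: mult_le_cancel_right_pos)
  also have "cmod a \<le> 2 * cmod (g x)"
  proof -
    have p: "1 \<le> 1 + 1 / (2 ^ N :: real)" by simp
    then have "(1 + 1 / 2 ^ N) *\<^sub>R x \<noteq> 0"
    proof -
      have "1 + 1 / (2 ^ N :: real) \<noteq> 0" using p by linarith
      with x show ?thesis by (simp only: scaleR_eq_0_iff simp_thms)
    qed
    then have "cmod (g ((1 + 1 / 2 ^ N) *\<^sub>R x)) = b / ((1 + 1 / 2 ^ N) * norm x)"
      using b(2)[of "(1 + 1 / 2 ^ N) *\<^sub>R x"] by simp
    also have "\<dots> \<le> b / (1 * norm x)"
    proof (intro divide_left_mono mult_right_mono p mult_pos_pos)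
      show "0 < 1 + 1 / (2 ^ N :: real)" using p by linarith
    qed (use b(1) x in auto)
    also have "\<dots> = cmod (g x)" using b(2)[OF x] by simp
    finally show ?thesis unfolding a_def using norm_triangle_ineq4[of "g x" "g ((1 + 1 / 2 ^ N) *\<^sub>R x)"] by linarith
  qed
  then have "\<gamma> * cmod a \<le> \<gamma> * (2 * cmod (g x))" using \<gamma> by (intro mult_left_mono) auto
  finally show ?thesis by simp
qed

section \<open>The error bound\<close>

lemma powr_div_2_power:
  assumes "0 \<le> a"
  shows "(a / 2 ^ N) powr z = a powr z * 2 powr (- (real N * z))"
proof -
  have "(2::real) ^ N = 2 powr real N" by (simp add: powr_realpow)
  then have "(a / 2 ^ N) powr z = a powr z / 2 powr (real N * z)"
    using assms by (simp add: powr_divide powr_powr)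
  then show ?thesis by (simp add: powr_minus_divide)
qed

text \<open>The order of the quantifiers expresses what the constants may depend on. Functions are
  taken as their continuous representatives, since point samples are used. The
  \<open>negligible\<close> condition confines \<Omega>, up to a null set, to the box where the
  shifts indexed by \<open>Lambda\<close> are complete, and \<open>ennreal\<close> on the right
  spares an argument that the supremum of the waves is finite.\<close>

theorem theorem4p7:
  fixes \<phi> :: "real^'d \<Rightarrow> real" and mask :: "real^'d \<Rightarrow> complex" and M :: "real^'d"
    and s \<sigma> :: real and \<kappa> :: nat
  assumes "s > real CARD('d) / 2" and "\<sigma> > s"
    and "(\<lambda>x. complex_of_real (\<phi> x)) \<in> sobolev s" and "continuous_on UNIV \<phi>"
    and "nu2 (\<lambda>x. complex_of_real (\<phi> x)) > ereal \<sigma>"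
    and "\<And>x. 0 \<le> \<phi> x"
    and "\<And>l. 0 < M $ l" and "closure {x. \<phi> x \<noteq> 0} \<subseteq> cbox 0 M"
    and "refinable (\<lambda>x. complex_of_real (\<phi> x)) mask"
    and "has_sum_rules mask (\<kappa> + 1)" and "real (\<kappa> + 1) > \<sigma>"
  shows "\<exists>C::real. C > 0 \<and>
    (\<forall>\<Omega> :: (real^'d) set.
      bounded \<Omega> \<and> \<Omega> \<in> sets lebesgue \<and> \<Omega> \<inter> int_lattice \<noteq> {} \<and>
      negligible (\<Omega> - cbox (Lmin \<Omega>) (Lmax \<Omega>)) \<and> (\<forall>N\<ge>1. 0 \<notin> Lambda M \<Omega> N) \<longrightarrow>
      (\<exists>C\<^sub>1::real. C\<^sub>1 > 0 \<and>
        (\<forall>(\<gamma>::real) (g :: nat \<Rightarrow> real^'d \<Rightarrow> complex).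
          \<gamma> > 0 \<and> (\<forall>N\<ge>1. spherical_wave (g N)) \<and> uniformly_admissible \<gamma> g (Xi M \<Omega>) \<longrightarrow>
          (\<forall>(f :: real^'d \<Rightarrow> complex) (N::nat).
            f \<in> sobolev s \<and> continuous_on UNIV f \<and> nu2 f > ereal \<sigma> \<and> N \<ge> 1 \<longrightarrow>
            L2_norm_on \<Omega> (\<lambda>x. f x - (\<Sum>k\<in>Lambda M \<Omega> N.
                reconstructed_sample f (g N) N k * complex_of_real (\<phi> (2 ^ N *\<^sub>R x - k))))
            \<le> ennreal (C * sobolev_norm \<sigma> f * 2 powr (- (real N * (\<sigma> - s) / 2)))
              + ennreal (\<gamma> * C\<^sub>1 * sobolev_norm \<sigma> f)
                * (ennreal (sobolev_norm \<sigma> f) + (SUP k\<in>{1..}. SUP x\<in>\<Omega>. ennreal (cmod (g k x))))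
                * ennreal (2 powr (- (real N * min 1 (\<sigma> - s))))))))"
proof -
  define \<zeta> where "\<zeta> = min 1 (\<sigma> - s)"
  have \<zeta>: "0 < \<zeta>" "\<zeta> \<le> 1" "\<zeta> \<le> \<sigma> - s" using assms(2) by (auto simp: \<zeta>_def)
  from sobolev_holder[OF assms(1) \<zeta>] obtain H where H: "H > 0"
    and HH: "\<forall>f :: real^'d \<Rightarrow> complex. continuous_on UNIV f \<longrightarrow> nu2 f > ereal \<sigma> \<longrightarrow>
      (\<forall>x. cmod (f x) \<le> H * sobolev_norm \<sigma> f) \<and>
      (\<forall>x y. cmod (f x - f y) \<le> H * sobolev_norm \<sigma> f * norm (x - y) powr \<zeta>)"
    by (elim exE conjE)
  have H_bound: "cmod (f x) \<le> H * sobolev_norm \<sigma> f"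
    and H_holder: "cmod (f x - f y) \<le> H * sobolev_norm \<sigma> f * norm (x - y) powr \<zeta>"
    if "continuous_on UNIV f" "nu2 f > ereal \<sigma>" for f :: "real^'d \<Rightarrow> complex" and x y
    using HH[rule_format, OF that] by simp_all
  have supp: "x \<in> cbox 0 M" if "\<phi> x \<noteq> 0" for x
    using that assms(8) closure_subset[of "{x. \<phi> x \<noteq> 0}"] by auto
  have main: "\<exists>C\<^sub>1::real. C\<^sub>1 > 0 \<and>
      (\<forall>(\<gamma>::real) (g :: nat \<Rightarrow> real^'d \<Rightarrow> complex).
        \<gamma> > 0 \<and> (\<forall>N\<ge>1. spherical_wave (g N)) \<and> uniformly_admissible \<gamma> g (Xi M \<Omega>) \<longrightarrow>
        (\<forall>(f :: real^'d \<Rightarrow> complex) (N::nat).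
          f \<in> sobolev s \<and> continuous_on UNIV f \<and> nu2 f > ereal \<sigma> \<and> N \<ge> 1 \<longrightarrow>
          L2_norm_on \<Omega> (\<lambda>x. f x - (\<Sum>k\<in>Lambda M \<Omega> N.
              reconstructed_sample f (g N) N k * complex_of_real (\<phi> (2 ^ N *\<^sub>R x - k))))
          \<le> ennreal (1 * sobolev_norm \<sigma> f * 2 powr (- (real N * (\<sigma> - s) / 2)))
            + ennreal (\<gamma> * C\<^sub>1 * sobolev_norm \<sigma> f)
              * (ennreal (sobolev_norm \<sigma> f) + (SUP k\<in>{1..}. SUP x\<in>\<Omega>. ennreal (cmod (g k x))))
              * ennreal (2 powr (- (real N * \<zeta>)))))"
    if \<Omega>: "bounded \<Omega>" "\<Omega> \<in> sets lebesgue" "\<Omega> \<inter> int_lattice \<noteq> {}"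
      and neg: "negligible (\<Omega> - cbox (Lmin \<Omega>) (Lmax \<Omega>))" and zero: "\<forall>N\<ge>1. 0 \<notin> Lambda M \<Omega> N"
    for \<Omega> :: "(real^'d) set"
  proof -
    \<comment> \<open>The reference point for all moduli: being a lattice point of \<Omega>, it is a
      sampling point at every level and is seen by the supremum over \<Omega>.\<close>
    obtain x0 where x0: "x0 \<in> \<Omega>" "x0 \<in> int_lattice" using \<Omega>(3) by blast
    note x0_bounds = Lmin_Lmax_bounds[OF _ finite_int_lattice_bounded[OF \<Omega>(1)], of x0]
    have k0: "2 ^ N *\<^sub>R x0 \<in> Lambda M \<Omega> N" for N
      unfolding Lambda_def
    proof (intro CollectI conjI allI)
      show "2 ^ N *\<^sub>R x0 \<in> int_lattice" using x0(2) by (auto simp: int_lattice_def)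
      fix l
      have "Lmin \<Omega> $ l \<le> x0 $ l" "x0 $ l \<le> Lmax \<Omega> $ l" using x0_bounds x0 by auto
      then have "2 ^ N * Lmin \<Omega> $ l \<le> 2 ^ N * x0 $ l" "2 ^ N * x0 $ l \<le> 2 ^ N * Lmax \<Omega> $ l" by auto
      then show "2 ^ N * Lmin \<Omega> $ l - M $ l \<le> (2 ^ N *\<^sub>R x0) $ l" "(2 ^ N *\<^sub>R x0) $ l \<le> 2 ^ N * Lmax \<Omega> $ l"
        using assms(7)[of l] unfolding vector_scaleR_component real_scaleR_def by linarith+
    qed
    have "0 \<notin> Lambda M \<Omega> 1" using zero by simp
    from Lambda_away_from_0[OF assms(7) this] obtain r where r: "r > 0"
      and r_le: "\<And>N k. N \<ge> 1 \<Longrightarrow> k \<in> Lambda M \<Omega> N \<Longrightarrow> r * 2 ^ N \<le> norm k" by blast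
    from Lambda_norm_le[OF assms(7), of \<Omega>] obtain \<rho> where \<rho>: "\<rho> > 0"
      and \<rho>_le: "\<And>N k. k \<in> Lambda M \<Omega> N \<Longrightarrow> norm k \<le> \<rho> * 2 ^ N" by blast
    have x0_ne: "x0 \<noteq> 0" using r_le[OF _ k0[of 1]] r by auto
    have fin: "finite (Lambda M \<Omega> N)" for N
    proof -
      have "bounded (Lambda M \<Omega> N)" unfolding bounded_iff using \<rho>_le by blast
      moreover have "Lambda M \<Omega> N \<subseteq> int_lattice" by (auto simp: Lambda_def)
      ultimately show ?thesis using finite_int_lattice_bounded by (metis inf.absorb1)
    qed
    \<comment> \<open>\<open>m\<close> stems from |x - 2^-N k| \<le> |M| / 2^N for a shift that is
      nonzero at x, \<open>p\<close> from the displacement \<rho> / 2^N within a triple. In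
      \<open>C'\<close> the first summand is the approximation error with the factor 2 from
      \<open>1 \<le> 2 * \<gamma> * G\<close>; the second is the reconstruction error, where
      \<open>2 * norm x0 / r\<close> is the ratio of the wave bound \<open>A\<close> to
      \<open>G\<close>.\<close>
    define m where "m = norm M powr \<zeta>"
    define p where "p = \<rho> powr \<zeta>"
    define C' where "C' = 2 * H * m + 2 * H * p * (H + 2 * norm x0 / r)"
    \<comment> \<open>The added 1 keeps the constant positive when \<Omega> is a null set.\<close>
    define C\<^sub>1 where "C\<^sub>1 = C' * (sqrt (measure lebesgue \<Omega>) + 1)"
    have mp: "0 \<le> m" "0 < p" using \<rho> by (auto simp: m_def p_def)
    have C': "0 < C'" unfolding C'_def using H mp r
      by (intro add_nonneg_pos mult_nonneg_nonneg mult_pos_pos add_pos_nonneg) auto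
    show ?thesis
    proof (rule exI[of _ C\<^sub>1], intro conjI allI impI)
      show "0 < C\<^sub>1" unfolding C\<^sub>1_def using C' by (intro mult_pos_pos add_nonneg_pos) auto
      fix \<gamma> :: real and g :: "nat \<Rightarrow> real^'d \<Rightarrow> complex" and f :: "real^'d \<Rightarrow> complex" and N :: nat
      assume hyp: "\<gamma> > 0 \<and> (\<forall>N\<ge>1. spherical_wave (g N)) \<and> uniformly_admissible \<gamma> g (Xi M \<Omega>)"
        and "f \<in> sobolev s \<and> continuous_on UNIV f \<and> nu2 f > ereal \<sigma> \<and> N \<ge> 1"
      then have \<gamma>: "\<gamma> > 0" and wave: "spherical_wave (g N)" and adm: "admissible \<gamma> (g N) (Xi M \<Omega> N) N"
        and f: "continuous_on UNIV f" "nu2 f > ereal \<sigma>" and N: "N \<ge> 1"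
        by (auto simp: uniformly_admissible_def)
      define S where "S = sobolev_norm \<sigma> f"
      define G where "G = cmod (g N x0)"
      define t where "t = 2 powr (- (real N * \<zeta>))"
      have S: "0 \<le> S" unfolding S_def by (rule sobolev_norm_nonneg)
      have t: "0 < t" unfolding t_def by simp
      have G: "0 \<le> G" "1 \<le> 2 * \<gamma> * G"
        using admissible_lower_bound[OF wave adm k0 x0_ne \<gamma>] by (auto simp: G_def)
      obtain b where b: "b > 0" "\<And>x. x \<noteq> 0 \<Longrightarrow> cmod (g N x) = b / norm x"
        using spherical_wave_cmod[OF wave] by blast
      have b_eq: "b = G * norm x0" using b(2)[OF x0_ne] x0_ne by (simp add: G_def)
      \<comment> \<open>This is b / (r / 2) with b = G |x0|: the wave at distance r / 2 from the
        origin, expressed through its modulus at \<open>x0\<close>.\<close>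
      define A where "A = 2 * norm x0 / r * G"
      have half: "1 / 2 ^ N \<le> (1 / 2 :: real)"
        using N power_increasing[of 1 N "2::real"] by (simp add: field_simps)
      \<comment> \<open>Because N \<ge> 1, both dilation factors 1 + 2^-N and 1 - 2^-N are at least
        1/2.\<close>
      have A_bound: "cmod (at_level (g N) N (c *\<^sub>R k)) \<le> A" if k: "k \<in> Lambda M \<Omega> N" and c: "1 / 2 \<le> c" for k c
      proof -
        have "r * 2 ^ N \<le> norm k" by (rule r_le[OF N k])
        then have "r \<le> norm k / 2 ^ N" by (simp add: field_simps)
        then have "1 / 2 * r \<le> c * (norm k / 2 ^ N)" using c r by (intro mult_mono) auto
        then have n: "r / 2 \<le> norm ((1 / 2 ^ N) *\<^sub>R (c *\<^sub>R k))" using c by simp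
        then have "(1 / 2 ^ N) *\<^sub>R (c *\<^sub>R k) \<noteq> 0"
        proof -
          have "norm ((1 / 2 ^ N) *\<^sub>R (c *\<^sub>R k)) \<noteq> 0" using n r by linarith
          then show ?thesis by (simp only: norm_eq_zero simp_thms)
        qed
        then have "cmod (at_level (g N) N (c *\<^sub>R k)) = b / norm ((1 / 2 ^ N) *\<^sub>R (c *\<^sub>R k))"
          by (rule b(2))
        also have "\<dots> \<le> b / (r / 2)"
          using n r b(1) by (intro divide_left_mono mult_pos_pos) (linarith | simp)+
        also have "\<dots> = A" using r by (simp add: A_def b_eq field_simps)
        finally show ?thesis .
      qed
      have sample: "cmod (reconstructed_sample f (g N) N k - at_level f N k) \<le> 2 * \<gamma> * (H * S * p * t) * (H * S + A)"
        if k: "k \<in> Lambda M \<Omega> N" for k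
      proof -
        \<comment> \<open>One bound for both neighbours, c = 2^-N outward and c = - 2^-N inward; the
          displacement is |c| times the norm of 2^-N k.\<close>
        have D: "cmod (at_level f N k - at_level f N ((1 + c) *\<^sub>R k)) \<le> H * S * p * t" if c: "\<bar>c\<bar> = 1 / 2 ^ N" for c
        proof -
          have "norm k / 2 ^ N \<le> \<rho>" using \<rho>_le[OF k] by (simp add: field_simps)
          then have le: "norm ((1 / 2 ^ N) *\<^sub>R k - (1 / 2 ^ N) *\<^sub>R ((1 + c) *\<^sub>R k)) \<le> \<rho> / 2 ^ N"
          proof -
            have "(1 / 2 ^ N) *\<^sub>R k - (1 / 2 ^ N) *\<^sub>R ((1 + c) *\<^sub>R k) = (- c) *\<^sub>R ((1 / 2 ^ N) *\<^sub>R k)"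
              by (simp add: algebra_simps)
            then have "norm ((1 / 2 ^ N) *\<^sub>R k - (1 / 2 ^ N) *\<^sub>R ((1 + c) *\<^sub>R k)) = (norm k / 2 ^ N) / 2 ^ N"
              using c by simp
            also have "\<dots> \<le> \<rho> / 2 ^ N" using \<open>norm k / 2 ^ N \<le> \<rho>\<close> by (intro divide_right_mono) auto
            finally show ?thesis .
          qed
          have "cmod (at_level f N k - at_level f N ((1 + c) *\<^sub>R k))
              \<le> H * S * norm ((1 / 2 ^ N) *\<^sub>R k - (1 / 2 ^ N) *\<^sub>R ((1 + c) *\<^sub>R k)) powr \<zeta>"
            unfolding S_def by (rule H_holder[OF f])
          also have "\<dots> \<le> H * S * (\<rho> / 2 ^ N) powr \<zeta>"
            using H S \<zeta> le by (intro mult_left_mono powr_mono2) auto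
          also have "\<dots> = H * S * p * t"
            using \<rho> by (simp add: powr_div_2_power p_def t_def)
          finally show ?thesis .
        qed
        show ?thesis
          unfolding reconstructed_sample_def
        proof (rule reconstruct_triple_error[OF admissible_quotient_le[OF adm k]])
          show "cmod (at_level f N k - at_level f N ((1 + 1 / 2 ^ N) *\<^sub>R k)) \<le> H * S * p * t" by (rule D) simp
          show "cmod (at_level f N k - at_level f N ((1 - 1 / 2 ^ N) *\<^sub>R k)) \<le> H * S * p * t"
            using D[of "- (1 / 2 ^ N)"] by simp
          show "cmod (f x) \<le> H * S" for x unfolding S_def by (rule H_bound[OF f])
          show "cmod (at_level (g N) N ((1 + 1 / 2 ^ N) *\<^sub>R k)) \<le> A" by (rule A_bound[OF k]) simp
          show "cmod (at_level (g N) N ((1 - 1 / 2 ^ N) *\<^sub>R k)) \<le> A" by (rule A_bound[OF k]) (use half in linarith)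
          show "0 \<le> \<gamma>" using \<gamma> by simp
        qed
      qed
      define E where "E = H * S * m * t + 2 * \<gamma> * (H * S * p * t) * (H * S + A)"
      have A0: "0 \<le> A" unfolding A_def using r G by simp
      have E0: "0 \<le> E" unfolding E_def using H S mp t \<gamma> A0 by simp
      let ?h = "\<lambda>x. f x - (\<Sum>k\<in>Lambda M \<Omega> N.
          reconstructed_sample f (g N) N k * complex_of_real (\<phi> (2 ^ N *\<^sub>R x - k)))"
      have h_le: "cmod (?h x) \<le> E" if x: "x \<in> cbox (Lmin \<Omega>) (Lmax \<Omega>)" for x
      proof -
        \<comment> \<open>The bounds 0 \<le> 2^N x - k \<le> M on the support, combined with those
          of the box for x, put every contributing k into
          \<open>Lambda M \<Omega> N\<close>.\<close>
        have one: "(\<Sum>k\<in>Lambda M \<Omega> N. \<phi> (2 ^ N *\<^sub>R x - k)) = 1"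
        proof (rule partition_of_unity[OF assms(4) supp assms(9,10) fin])
          show "Lambda M \<Omega> N \<subseteq> int_lattice" by (auto simp: Lambda_def)
          fix k assume k: "k \<in> int_lattice" "\<phi> (2 ^ N *\<^sub>R x - k) \<noteq> 0"
          then have c: "2 ^ N *\<^sub>R x - k \<in> cbox 0 M" by (intro supp)
          show "k \<in> Lambda M \<Omega> N" unfolding Lambda_def
          proof (intro CollectI conjI allI k(1))
            fix l
            have "0 \<le> 2 ^ N * x $ l - k $ l" "2 ^ N * x $ l - k $ l \<le> M $ l" "Lmin \<Omega> $ l \<le> x $ l" "x $ l \<le> Lmax \<Omega> $ l"
              using c x by (auto simp: mem_box_cart)
            moreover from this have "2 ^ N * Lmin \<Omega> $ l \<le> 2 ^ N * x $ l" "2 ^ N * x $ l \<le> 2 ^ N * Lmax \<Omega> $ l" by auto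
            ultimately show "2 ^ N * Lmin \<Omega> $ l - M $ l \<le> k $ l" "k $ l \<le> 2 ^ N * Lmax \<Omega> $ l" by linarith+
          qed
        qed
        have summand: "cmod ((f x - reconstructed_sample f (g N) N k) * complex_of_real (\<phi> (2 ^ N *\<^sub>R x - k)))
            \<le> E * \<phi> (2 ^ N *\<^sub>R x - k)" if k: "k \<in> Lambda M \<Omega> N" for k
        proof (cases "\<phi> (2 ^ N *\<^sub>R x - k) = 0")
          case False
          then have c: "2 ^ N *\<^sub>R x - k \<in> cbox 0 M" by (intro supp)
          have "norm (2 ^ N *\<^sub>R x - k) \<le> norm M"
            using c by (intro norm_le_componentwise_cart) (auto simp: mem_box_cart intro: order_trans)
          moreover have "x - (1 / 2 ^ N) *\<^sub>R k = (1 / 2 ^ N) *\<^sub>R (2 ^ N *\<^sub>R x - k)"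
            by (simp add: algebra_simps)
          then have "norm (x - (1 / 2 ^ N) *\<^sub>R k) = norm (2 ^ N *\<^sub>R x - k) / 2 ^ N" by simp
          ultimately have le: "norm (x - (1 / 2 ^ N) *\<^sub>R k) \<le> norm M / 2 ^ N"
            by (simp add: divide_right_mono)
          have "cmod (f x - at_level f N k) \<le> H * S * norm (x - (1 / 2 ^ N) *\<^sub>R k) powr \<zeta>"
            unfolding S_def by (rule H_holder[OF f])
          also have "\<dots> \<le> H * S * (norm M / 2 ^ N) powr \<zeta>"
            using H S \<zeta> le by (intro mult_left_mono powr_mono2) auto
          also have "\<dots> = H * S * m * t" by (simp add: powr_div_2_power m_def t_def)
          finally have "cmod (f x - at_level f N k) \<le> H * S * m * t" .
          moreover have "cmod (f x - reconstructed_sample f (g N) N k)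
              \<le> cmod (f x - at_level f N k) + cmod (reconstructed_sample f (g N) N k - at_level f N k)"
            using norm_triangle_ineq4[of "f x - at_level f N k" "reconstructed_sample f (g N) N k - at_level f N k"] by simp
          ultimately have "cmod (f x - reconstructed_sample f (g N) N k) \<le> E"
            using sample[OF k] unfolding E_def by linarith
          then show ?thesis using assms(6)[of "2 ^ N *\<^sub>R x - k"]
            by (simp add: norm_mult mult_right_mono)
        qed simp
        \<comment> \<open>The weights are nonnegative with sum 1, so the error is a weighted mean of
          sample errors and inherits their common bound \<open>E\<close>, however many shifts
          overlap.\<close>
        have "?h x = (\<Sum>k\<in>Lambda M \<Omega> N. (f x - reconstructed_sample f (g N) N k) * complex_of_real (\<phi> (2 ^ N *\<^sub>R x - k)))"
        proof -
          have "f x = f x * complex_of_real (\<Sum>k\<in>Lambda M \<Omega> N. \<phi> (2 ^ N *\<^sub>R x - k))" by (simp add: one)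
          also have "\<dots> = (\<Sum>k\<in>Lambda M \<Omega> N. f x * complex_of_real (\<phi> (2 ^ N *\<^sub>R x - k)))"
            by (simp add: sum_distrib_left)
          finally have fx: "f x = (\<Sum>k\<in>Lambda M \<Omega> N. f x * complex_of_real (\<phi> (2 ^ N *\<^sub>R x - k)))" .
          show ?thesis by (subst fx) (simp only: left_diff_distrib sum_subtractf)
        qed
        also have "cmod \<dots> \<le> (\<Sum>k\<in>Lambda M \<Omega> N. E * \<phi> (2 ^ N *\<^sub>R x - k))"
          by (rule sum_norm_le) (rule summand)
        also have "\<dots> = E" by (simp only: one mult_1_right flip: sum_distrib_left)
        finally show ?thesis .
      qed
      have "L2_norm_on \<Omega> ?h \<le> ennreal (E * sqrt (measure lebesgue \<Omega>))"
      proof (rule L2_norm_on_le[OF \<Omega>(1,2) _ E0 neg h_le])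
        show "continuous_on UNIV ?h"
          by (intro continuous_intros f(1) continuous_on_compose2[OF assms(4)]) auto
      qed
      also have "\<dots> \<le> ennreal (\<gamma> * C\<^sub>1 * S * (S + G) * t)"
      proof (rule ennreal_leI)
        \<comment> \<open>Raising the explicit 1 to \<open>2 * \<gamma> * G\<close>, and then
          \<open>S\<close> and \<open>G\<close> to \<open>S + G\<close>, brings all terms to the
          common factor \<gamma> S (S + G) t.\<close>
        have "E = S * t * (H * m * 1 + 2 * \<gamma> * H * p * (H * S + A))"
          by (simp add: E_def algebra_simps)
        also have "\<dots> \<le> S * t * (H * m * (2 * \<gamma> * G) + 2 * \<gamma> * H * p * (H * S + A))"
          using S t H mp G by (intro mult_left_mono add_right_mono) auto
        also have "\<dots> = S * t * (\<gamma> * (2 * H * m * G + 2 * H * p * (H * S + 2 * norm x0 / r * G)))"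
          by (simp add: A_def algebra_simps)
        also have "\<dots> \<le> S * t * (\<gamma> * (2 * H * m * (S + G) + 2 * H * p * (H * (S + G) + 2 * norm x0 / r * (S + G))))"
          using S t H mp G \<gamma> r by (intro mult_left_mono add_mono) auto
        also have "\<dots> = \<gamma> * C' * S * (S + G) * t" by (simp add: C'_def algebra_simps)
        finally have "E * sqrt (measure lebesgue \<Omega>) \<le> \<gamma> * C' * S * (S + G) * t * (sqrt (measure lebesgue \<Omega>) + 1)"
          using E0 by (intro mult_mono) auto
        then show "E * sqrt (measure lebesgue \<Omega>) \<le> \<gamma> * C\<^sub>1 * S * (S + G) * t"
          by (simp add: C\<^sub>1_def mult_ac)
      qed
      also have "\<dots> = ennreal (\<gamma> * C\<^sub>1 * S) * (ennreal S + ennreal G) * ennreal t"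
      proof -
        have "0 \<le> \<gamma> * C\<^sub>1 * S" using \<gamma> \<open>0 < C\<^sub>1\<close> S by simp
        then show ?thesis using S G t by (simp add: ennreal_mult ennreal_plus)
      qed
      also have "\<dots> \<le> ennreal (\<gamma> * C\<^sub>1 * S) * (ennreal S + (SUP k\<in>{1..}. SUP x\<in>\<Omega>. ennreal (cmod (g k x)))) * ennreal t"
      proof (intro mult_right_mono mult_left_mono add_left_mono)
        show "ennreal G \<le> (SUP k\<in>{1..}. SUP x\<in>\<Omega>. ennreal (cmod (g k x)))"
          unfolding G_def using N x0(1) by (intro SUP_upper2[of N] SUP_upper2[of x0]) auto
      qed auto
      also have "\<dots> \<le> ennreal (1 * S * 2 powr (- (real N * (\<sigma> - s) / 2))) + \<dots>" by simp
      finally show "L2_norm_on \<Omega> ?h \<le> ennreal (1 * sobolev_norm \<sigma> f * 2 powr (- (real N * (\<sigma> - s) / 2)))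
            + ennreal (\<gamma> * C\<^sub>1 * sobolev_norm \<sigma> f)
              * (ennreal (sobolev_norm \<sigma> f) + (SUP k\<in>{1..}. SUP x\<in>\<Omega>. ennreal (cmod (g k x))))
              * ennreal (2 powr (- (real N * \<zeta>)))"
        unfolding S_def t_def .
    qed
  qed
  show ?thesis (is "\<exists>C. C > 0 \<and> (\<forall>\<Omega>. ?A \<Omega> \<longrightarrow> ?P C \<Omega>)")
  proof (rule exI[of _ 1], intro conjI allI impI)
    fix \<Omega> :: "(real^'d) set"
    assume "bounded \<Omega> \<and> \<Omega> \<in> sets lebesgue \<and> \<Omega> \<inter> int_lattice \<noteq> {} \<and>
      negligible (\<Omega> - cbox (Lmin \<Omega>) (Lmax \<Omega>)) \<and> (\<forall>N\<ge>1. 0 \<notin> Lambda M \<Omega> N)"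
    then show "?P 1 \<Omega>" using main[of \<Omega>] unfolding \<zeta>_def by blast
  qed simp
qed

end
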